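(* Let $P_1,\dots,P_N$ be discrete probability measures on $\mathbb{R}^d$ and let $\lambda_1,\dots,\lambda_N>0$ with $\sum_{i=1}^N\lambda_i=1$. Algorithm 3 (described in the context), run on this input, returns an approximate barycenter $\bar P'$ (in the set $S_{\text{org}}$ used in its last iteration) supported on a subset of $$S=\Big\{\sum_{i=1}^N\lambda_ix_i:\ x_i\in\operatorname{supp}(P_i)\Big\}$$ for which $\phi(\bar P')\le2\cdot\phi(\bar P)$, where $\bar P$ is a barycenter of $P_1,\dots,P_N$, and there is a non-mass splitting optimal transport from $\bar P'$ to $P_1,\dots,P_N$ realizing this bound. Further, $$|\bar P'|\le\sum_{i=1}^N|P_i|-N+1 .$$
   Context: **Basic notions.** A discrete probability measure is a probability measure with finite support. Write $\operatorname{supp}(P_i)=\{x_{ik}:k=1,\dots,|P_i|\}$, where $|P_i|$ is the number of support points (similarly $|P|$ for any discrete measure $P$), and let $d_{ik}>0$ be the mass of $x_{ik}$ in $P_i$. $W_2$ is the quadratic Wasserstein distance (Euclidean ground norm), $\phi(P)=\sum_{i=1}^N\lambda_iW_2(P,P_i)^2$, and a barycenter $\bar P$ is a minimizer of $\phi$ over all probability measures on $\mathbb{R}^d$ with finite second moments. For a finite set $S_0\subset\mathbb{R}^d$, an approximate barycenter in $S_0$ is a probability measure supported in $S_0$ that minimizes $\phi$ among all probability measures supported in $S_0$. **Transports.** A transport from a discrete probability measure $P_0$ (support points $x_j$ with masses $d_j$) to $P_1,\dots,P_N$ is a family $y=(y_{ijk})$, $y_{ijk}\ge0$, with $\sum_k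 y_{ijk}=d_j$ for all $i,j$ and $\sum_jy_{ijk}=d_{ik}$ for all $i,k$. Its cost is $\sum_i\lambda_i\sum_j\sum_k\|x_j-x_{ik}\|^2y_{ijk}$; it is optimal if its cost is minimal, in which case the cost equals $\phi(P_0)$. It is non-mass splitting if for all support points $x_j$ of $P_0$ and all $i$ there is exactly one $k$ with $y_{ijk}=d_j$, while $y_{ijk'}=0$ for all $k'\ne k$. **Algorithm 1** (for a finite set $S_0=\{x_1,\dots,x_{|S_0|}\}$ of possible support points). Compute an optimal vertex $(z,y)$ of the linear program: minimize $\sum_{i=1}^N\lambda_i\sum_{j=1}^{|S_0|}\sum_{k=1}^{|P_i|}\|x_j-x_{ik}\|^2y_{ijk}$ subject to $\sum_{k}y_{ijk}=z_j$ for all $i,j$; $\sum_jy_{ijk}=d_{ik}$ for all $i,k$; $y_{ijk}\ge0$; $z_j\in\mathbb{R}$. Return the measure $\bar P_{\text{org}}$ with mass $z_j$ on $x_j$, and its optimal transport $y$. **Algorithm 2.** Input: $P_1,\dots,P_N$, $\lambda$, and the output $\bar P_{\text{org}}$, $(z,y)$ of Algorithm 1. *Step 1.* Let $\operatorname{supp}(\bar P_{\text{org}})=\{s_1,\dots,s_r\}=\{x_{t_1},\dots,x_{t_r}\}$ with masses $d_l=z_{t_l}>0$. For each $l\le r$, $i\le N$, let $P_i^l$ be the partial measure consisting of those $x_{ik}$ with $y_{it_lk}>0$, with mass $y_{it_lk}$. Index its support points as $x^l_{i1},\dots,x^l_{i|P_i^l|}$ with masses $d^l_{i1},\dots,d^l_{i|P_i^l|}$.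 *Step 2.* For $l=r$ descending to $1$, for $j=1$ ascending to $l-1$ (while $d_l>0$): (a) For each $i\le N$ choose an index $q_i\in\arg\max_{q\le|P_i^l|}(s_j-s_l)^Tx^l_{iq}$, and let $c=\sum_{i=1}^N\lambda_ix^l_{iq_i}$. (b) If $\|c-s_j\|^2=\|c-s_l\|^2$, then: let $d_{\min}=\min_{i\le N}d^l_{iq_i}$; decrease $d_l$ and all $d^l_{iq_i}$ ($i\le N$) by $d_{\min}$; remove $x^l_{iq_i}$ from $P_i^l$ if its mass has become $0$ (and reindex); for each $i\le N$ add the point $x^l_{iq_i}$ to $\operatorname{supp}(P_i^j)$ (with initial mass $0$) if not already present, and increase its mass in $P_i^j$ by $d_{\min}$; increase $d_j$ by $d_{\min}$; if $d_l>0$, go back to (a) for the same $l,j$. (Otherwise, continue with the next $j$.) *Step 3.* For $l=1$ ascending to $r$: create an empty partial measure $\bar P^l$, and while $d_l>0$ repeat: (a) for each $i\le N$ let $x^l_{iq_i}$ be the lexicographically maximal support point of $P_i^l$ (largest first coordinate, among those largest second coordinate, and so on); let $c=\sum_{i=1}^N\lambda_ix^l_{iq_i}$; (b) let $d_{\min}=\min_{i\le N}d^l_{iq_i}$; decrease $d_l$ and all $d^l_{iq_i}$ by $d_{\min}$; remove $x^l_{iq_i}$ from $P_i^l$ if its mass has become $0$ (and reindex); add $c$ to $\operatorname{supp}(\bar P^l)$ with mass $d_{\min}$. *Step 4.* Return $\bar P'=\sum_{l=1}^r\bar P^l$. **Algorithm 3.** Input: $P_1,\dots,P_N$ and $\lambda$.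 Initially $S_{\text{org}}=\bigcup_{i=1}^N\operatorname{supp}(P_i)$. 1. Run Algorithm 1 with $S_0=S_{\text{org}}$ to obtain $\bar P_{\text{org}}$ and an optimal transport. 2. Use these as input for Algorithm 2 to obtain a measure $\bar P'$. If $\bar P'\ne\bar P_{\text{org}}$, set $S_{\text{org}}=\operatorname{supp}(\bar P')$ and go back to 1. Otherwise return $\bar P'$. *)

theory Defs
  imports "HOL-Probability.Probability"
begin

section \<open>Wasserstein distance and barycenters\<close>

text \<open>
  A discrete probability measure is a \<open>pmf\<close> \<open>Q\<close> with \<open>finite (set_pmf Q)\<close>; its support is
  \<open>set_pmf Q\<close>.  The given measures are \<open>P 1, \<dots>, P N\<close>; values of \<open>P\<close> and \<open>lam\<close> outside
  \<open>{1..N}\<close> are irrelevant.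
\<close>

definition borel_pmf :: "'a::euclidean_space pmf \<Rightarrow> 'a measure" where
  "borel_pmf Q = distr (measure_pmf Q) borel (\<lambda>x. x)"

definition couplings :: "'a::euclidean_space measure \<Rightarrow> 'a measure \<Rightarrow> ('a \<times> 'a) measure set" where
  "couplings M M' = {\<gamma>. prob_space \<gamma> \<and> sets \<gamma> = sets (borel \<Otimes>\<^sub>M borel)
     \<and> distr \<gamma> borel fst = M \<and> distr \<gamma> borel snd = M'}"

definition finite_second_moment :: "'a::euclidean_space measure \<Rightarrow> bool" where
  "finite_second_moment M \<longleftrightarrow>
     prob_space M \<and> sets M = sets borel \<and> integrable M (\<lambda>x. (norm x)\<^sup>2)"

text \<open>
  The infimum is finite for measures with finite second moment, the only ones to which the
  distance is applied below, so \<open>enn2real\<close> loses nothing there.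
\<close>

definition W2 :: "'a::euclidean_space measure \<Rightarrow> 'a measure \<Rightarrow> real" where
  "W2 M M' = sqrt (enn2real
     (INF \<gamma>\<in>couplings M M'. \<integral>\<^sup>+p. ennreal ((norm (fst p - snd p))\<^sup>2) \<partial>\<gamma>))"

definition phi ::
  "nat \<Rightarrow> (nat \<Rightarrow> real) \<Rightarrow> (nat \<Rightarrow> 'a::euclidean_space pmf) \<Rightarrow> 'a measure \<Rightarrow> real" where
  "phi N lam P M = (\<Sum>i\<in>{1..N}. lam i * (W2 M (borel_pmf (P i)))\<^sup>2)"

definition barycenter ::
  "nat \<Rightarrow> (nat \<Rightarrow> real) \<Rightarrow> (nat \<Rightarrow> 'a::euclidean_space pmf) \<Rightarrow> 'a measure \<Rightarrow> bool" where
  "barycenter N lam P M \<longleftrightarrow> finite_second_moment M \<and>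
     (\<forall>M'. finite_second_moment M' \<longrightarrow> phi N lam P M \<le> phi N lam P M')"

text \<open>Used for finite \<open>S0\<close> only, where every probability measure supported in \<open>S0\<close> is a \<open>pmf\<close>.\<close>

definition approximate_barycenter ::
  "nat \<Rightarrow> (nat \<Rightarrow> real) \<Rightarrow> (nat \<Rightarrow> 'a::euclidean_space pmf) \<Rightarrow> 'a set \<Rightarrow> 'a pmf \<Rightarrow> bool" where
  "approximate_barycenter N lam P S0 Q \<longleftrightarrow> set_pmf Q \<subseteq> S0 \<and>
     (\<forall>Q'. set_pmf Q' \<subseteq> S0 \<longrightarrow> phi N lam P (borel_pmf Q) \<le> phi N lam P (borel_pmf Q'))"

definition weighted_means ::
  "nat \<Rightarrow> (nat \<Rightarrow> real) \<Rightarrow> (nat \<Rightarrow> 'a::euclidean_space pmf) \<Rightarrow> 'a set" where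
  "weighted_means N lam P =
     {\<Sum>i\<in>{1..N}. lam i *\<^sub>R x i | x. \<forall>i\<in>{1..N}. x i \<in> set_pmf (P i)}"


section \<open>Transports\<close>

text \<open>
  The points of a support being distinct, they serve as their own indices: \<open>y i x k\<close> is the mass
  sent from the point \<open>x\<close> to the support point \<open>k\<close> of \<open>P i\<close>.
\<close>

definition is_transport ::
  "nat \<Rightarrow> (nat \<Rightarrow> 'a pmf) \<Rightarrow> 'a pmf \<Rightarrow> (nat \<Rightarrow> 'a \<Rightarrow> 'a \<Rightarrow> real) \<Rightarrow> bool" where
  "is_transport N P Q y \<longleftrightarrow>
     (\<forall>i\<in>{1..N}. \<forall>x\<in>set_pmf Q. \<forall>k\<in>set_pmf (P i). 0 \<le> y i x k) \<and>
     (\<forall>i\<in>{1..N}. \<forall>x\<in>set_pmf Q. (\<Sum>k\<in>set_pmf (P i). y i x k) = pmf Q x) \<and>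
     (\<forall>i\<in>{1..N}. \<forall>k\<in>set_pmf (P i). (\<Sum>x\<in>set_pmf Q. y i x k) = pmf (P i) k)"

definition transport_cost ::
  "nat \<Rightarrow> (nat \<Rightarrow> real) \<Rightarrow> (nat \<Rightarrow> 'a::euclidean_space pmf) \<Rightarrow> 'a set
    \<Rightarrow> (nat \<Rightarrow> 'a \<Rightarrow> 'a \<Rightarrow> real) \<Rightarrow> real" where
  "transport_cost N lam P X y =
     (\<Sum>i\<in>{1..N}. lam i * (\<Sum>x\<in>X. \<Sum>k\<in>set_pmf (P i). (norm (x - k))\<^sup>2 * y i x k))"

definition optimal_transport ::
  "nat \<Rightarrow> (nat \<Rightarrow> real) \<Rightarrow> (nat \<Rightarrow> 'a::euclidean_space pmf) \<Rightarrow> 'a pmf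
    \<Rightarrow> (nat \<Rightarrow> 'a \<Rightarrow> 'a \<Rightarrow> real) \<Rightarrow> bool" where
  "optimal_transport N lam P Q y \<longleftrightarrow> is_transport N P Q y \<and>
     (\<forall>y'. is_transport N P Q y' \<longrightarrow>
        transport_cost N lam P (set_pmf Q) y \<le> transport_cost N lam P (set_pmf Q) y')"

definition non_mass_splitting ::
  "nat \<Rightarrow> (nat \<Rightarrow> 'a pmf) \<Rightarrow> 'a pmf \<Rightarrow> (nat \<Rightarrow> 'a \<Rightarrow> 'a \<Rightarrow> real) \<Rightarrow> bool" where
  "non_mass_splitting N P Q y \<longleftrightarrow>
     (\<forall>x\<in>set_pmf Q. \<forall>i\<in>{1..N}. \<exists>!k. k \<in> set_pmf (P i) \<and> y i x k = pmf Q x \<and>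
        (\<forall>k'\<in>set_pmf (P i). k' \<noteq> k \<longrightarrow> y i x k' = 0))"


section \<open>The linear program for a finite set of possible support points\<close>

text \<open>
  The variables are \<open>z x\<close> and \<open>y i x k\<close> for \<open>i \<in> {1..N}\<close>, \<open>x \<in> S0\<close>, \<open>k \<in> set_pmf (P i)\<close>.
  The last two conjuncts fix the functions to be zero at all other arguments, so that they
  correspond one-to-one to vectors of the variables.
\<close>

definition lp_feasible ::
  "nat \<Rightarrow> (nat \<Rightarrow> 'a pmf) \<Rightarrow> 'a set \<Rightarrow> ('a \<Rightarrow> real) \<Rightarrow> (nat \<Rightarrow> 'a \<Rightarrow> 'a \<Rightarrow> real) \<Rightarrow> bool" where
  "lp_feasible N P S0 z y \<longleftrightarrow>
     (\<forall>i\<in>{1..N}. \<forall>x\<in>S0. (\<Sum>k\<in>set_pmf (P i). y i x k) = z x) \<and>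
     (\<forall>i\<in>{1..N}. \<forall>k\<in>set_pmf (P i). (\<Sum>x\<in>S0. y i x k) = pmf (P i) k) \<and>
     (\<forall>i\<in>{1..N}. \<forall>x\<in>S0. \<forall>k\<in>set_pmf (P i). 0 \<le> y i x k) \<and>
     (\<forall>x. x \<notin> S0 \<longrightarrow> z x = 0) \<and>
     (\<forall>i x k. \<not> (i \<in> {1..N} \<and> x \<in> S0 \<and> k \<in> set_pmf (P i)) \<longrightarrow> y i x k = 0)"

text \<open>
  A vertex is an extreme point of the feasible polyhedron; this is the condition of
  \<open>extreme_point_of\<close>, which is not available for functions.
\<close>

definition lp_vertex ::
  "nat \<Rightarrow> (nat \<Rightarrow> 'a pmf) \<Rightarrow> 'a set \<Rightarrow> ('a \<Rightarrow> real) \<Rightarrow> (nat \<Rightarrow> 'a \<Rightarrow> 'a \<Rightarrow> real) \<Rightarrow> bool" where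
  "lp_vertex N P S0 z y \<longleftrightarrow> lp_feasible N P S0 z y \<and>
     (\<forall>z1 y1 z2 y2 t. lp_feasible N P S0 z1 y1 \<and> lp_feasible N P S0 z2 y2 \<and> 0 < t \<and> t < 1 \<and>
        z = (\<lambda>x. (1 - t) * z1 x + t * z2 x) \<and>
        y = (\<lambda>i x k. (1 - t) * y1 i x k + t * y2 i x k) \<longrightarrow> z1 = z2 \<and> y1 = y2)"

definition alg1_output ::
  "nat \<Rightarrow> (nat \<Rightarrow> real) \<Rightarrow> (nat \<Rightarrow> 'a::euclidean_space pmf) \<Rightarrow> 'a set
    \<Rightarrow> ('a \<Rightarrow> real) \<Rightarrow> (nat \<Rightarrow> 'a \<Rightarrow> 'a \<Rightarrow> real) \<Rightarrow> bool" where
  "alg1_output N lam P S0 z y \<longleftrightarrow> lp_vertex N P S0 z y \<and>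
     (\<forall>z' y'. lp_feasible N P S0 z' y' \<longrightarrow>
        transport_cost N lam P S0 y \<le> transport_cost N lam P S0 y')"


section \<open>Local improvement of an approximate barycenter\<close>

text \<open>
  Partial measures are given by their mass functions: \<open>m l i x\<close> is the mass of the point \<open>x\<close> in
  the partial measure \<open>P\<^sub>i\<^sup>l\<close>, whose support consists of the points of positive mass.  Removing
  points of mass zero, or adding a point with initial mass zero, is thus implicit.
\<close>

definition mass_supp :: "('a \<Rightarrow> real) \<Rightarrow> 'a set" where
  "mass_supp w = {x. 0 < w x}"

definition lex_less :: "real ^ 'd::{finite,linorder} \<Rightarrow> real ^ 'd::{finite,linorder} \<Rightarrow> bool" where
  "lex_less u v \<longleftrightarrow> (\<exists>a. u $ a < v $ a \<and> (\<forall>b<a. u $ b = v $ b))"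

definition lex_maximal :: "(real ^ 'd::{finite,linorder}) set \<Rightarrow> real ^ 'd::{finite,linorder} \<Rightarrow> bool" where
  "lex_maximal A v \<longleftrightarrow> v \<in> A \<and> (\<forall>u\<in>A. u \<noteq> v \<longrightarrow> lex_less u v)"

definition mean_point ::
  "nat \<Rightarrow> (nat \<Rightarrow> real) \<Rightarrow> (nat \<Rightarrow> 'a::euclidean_space) \<Rightarrow> 'a" where
  "mean_point N lam q = (\<Sum>i\<in>{1..N}. lam i *\<^sub>R q i)"

definition d_min :: "nat \<Rightarrow> (nat \<Rightarrow> nat \<Rightarrow> 'a \<Rightarrow> real) \<Rightarrow> nat \<Rightarrow> (nat \<Rightarrow> 'a) \<Rightarrow> real" where
  "d_min N m l q = Min ((\<lambda>i. m l i (q i)) ` {1..N})"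

text \<open>\<open>add_mass N l q e m\<close> changes the mass of \<open>q i\<close> in \<open>P\<^sub>i\<^sup>l\<close> by \<open>e\<close>, for all \<open>i \<in> {1..N}\<close>.\<close>

definition add_mass ::
  "nat \<Rightarrow> nat \<Rightarrow> (nat \<Rightarrow> 'a) \<Rightarrow> real \<Rightarrow> (nat \<Rightarrow> nat \<Rightarrow> 'a \<Rightarrow> real) \<Rightarrow> (nat \<Rightarrow> nat \<Rightarrow> 'a \<Rightarrow> real)" where
  "add_mass N l q e m =
     (\<lambda>l' i x. if l' = l \<and> i \<in> {1..N} \<and> x = q i then m l' i x + e else m l' i x)"

text \<open>
  The algorithms are nondeterministic (choice of the optimal vertex, enumeration of the support,
  choice of the maximizers) and are given by small-step relations between states.
  The variables are those of the algorithm: \<open>d l\<close> is the mass of \<open>s l\<close>, and \<open>b l\<close> is the mass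
  function of the measure built from the \<open>l\<close>-th partial measures.  \<open>Step2 l j\<close> with \<open>l = 0\<close> is the
  exit of the descending loop over \<open>l\<close>, and \<open>Step3 l\<close> with \<open>l > r\<close> that of the ascending one.
\<close>

datatype 'a alg2_state =
    Step2 nat nat "nat \<Rightarrow> real" "nat \<Rightarrow> nat \<Rightarrow> 'a \<Rightarrow> real"
  | Step3 nat "nat \<Rightarrow> real" "nat \<Rightarrow> nat \<Rightarrow> 'a \<Rightarrow> real" "nat \<Rightarrow> 'a \<Rightarrow> real"
  | Step4 "'a \<Rightarrow> real"

definition alg2_init ::
  "(nat \<Rightarrow> 'a) \<Rightarrow> nat \<Rightarrow> ('a \<Rightarrow> real) \<Rightarrow> (nat \<Rightarrow> 'a \<Rightarrow> 'a \<Rightarrow> real) \<Rightarrow> 'a alg2_state" where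
  "alg2_init s r z y = Step2 r 1 (\<lambda>l. z (s l)) (\<lambda>l i x. y i (s l) x)"

inductive alg2_step ::
  "nat \<Rightarrow> (nat \<Rightarrow> real) \<Rightarrow> (nat \<Rightarrow> real ^ 'd::{finite,linorder}) \<Rightarrow> nat
    \<Rightarrow> (real ^ 'd::{finite,linorder}) alg2_state \<Rightarrow> (real ^ 'd::{finite,linorder}) alg2_state \<Rightarrow> bool"
  for N lam s r where
  step2_move:
    "\<lbrakk> 0 < l; j < l; 0 < d l;
       \<forall>i\<in>{1..N}. is_arg_max (\<lambda>x. (s j - s l) \<bullet> x) (\<lambda>x. x \<in> mass_supp (m l i)) (q i);
       c = mean_point N lam q;
       (norm (c - s j))\<^sup>2 = (norm (c - s l))\<^sup>2;
       e = d_min N m l q;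
       d' = d(l := d l - e, j := d j + e);
       m' = add_mass N j q e (add_mass N l q (- e) m) \<rbrakk>
     \<Longrightarrow> alg2_step N lam s r (Step2 l j d m) (Step2 l j d' m')"
| step2_next_j:
    "\<lbrakk> 0 < l; j < l; 0 < d l;
       \<forall>i\<in>{1..N}. is_arg_max (\<lambda>x. (s j - s l) \<bullet> x) (\<lambda>x. x \<in> mass_supp (m l i)) (q i);
       c = mean_point N lam q;
       (norm (c - s j))\<^sup>2 \<noteq> (norm (c - s l))\<^sup>2 \<rbrakk>
     \<Longrightarrow> alg2_step N lam s r (Step2 l j d m) (Step2 l (Suc j) d m)"
| step2_next_l:
    "\<lbrakk> 0 < l; \<not> (j < l \<and> 0 < d l) \<rbrakk>
     \<Longrightarrow> alg2_step N lam s r (Step2 l j d m) (Step2 (l - 1) 1 d m)"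
| step2_exit:
    "alg2_step N lam s r (Step2 0 j d m) (Step3 1 d m (\<lambda>_ _. 0))"
| step3_extract:
    "\<lbrakk> l \<le> r; 0 < d l;
       \<forall>i\<in>{1..N}. lex_maximal (mass_supp (m l i)) (q i);
       c = mean_point N lam q;
       e = d_min N m l q;
       d' = d(l := d l - e);
       m' = add_mass N l q (- e) m;
       b' = b(l := (b l)(c := b l c + e)) \<rbrakk>
     \<Longrightarrow> alg2_step N lam s r (Step3 l d m b) (Step3 l d' m' b')"
| step3_next_l:
    "\<lbrakk> l \<le> r; \<not> 0 < d l \<rbrakk>
     \<Longrightarrow> alg2_step N lam s r (Step3 l d m b) (Step3 (Suc l) d m b)"
| step3_exit:
    "r < l \<Longrightarrow> alg2_step N lam s r (Step3 l d m b) (Step4 (\<lambda>x. \<Sum>l'\<in>{1..r}. b l' x))"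


section \<open>The iterated algorithm\<close>

text \<open>
  The first component of every state is the current set \<open>S\<^sub>o\<^sub>r\<^sub>g\<close>.  In \<open>RunAlg2 S z s r a\<close>, \<open>z\<close> is the
  mass function of the solution of the linear program, \<open>s 1, \<dots>, s r\<close> enumerates its support, and
  \<open>a\<close> is the current state of the local improvement.
\<close>

datatype 'a alg3_state =
    RunAlg1 "'a set"
  | RunAlg2 "'a set" "'a \<Rightarrow> real" "nat \<Rightarrow> 'a" nat "'a alg2_state"
  | Return "'a set" "'a \<Rightarrow> real"

definition alg3_init :: "nat \<Rightarrow> (nat \<Rightarrow> 'a pmf) \<Rightarrow> 'a alg3_state" where
  "alg3_init N P = RunAlg1 (\<Union>i\<in>{1..N}. set_pmf (P i))"

inductive alg3_step ::
  "nat \<Rightarrow> (nat \<Rightarrow> real) \<Rightarrow> (nat \<Rightarrow> (real ^ 'd::{finite,linorder}) pmf)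
    \<Rightarrow> (real ^ 'd::{finite,linorder}) alg3_state \<Rightarrow> (real ^ 'd::{finite,linorder}) alg3_state \<Rightarrow> bool"
  for N lam P where
  alg3_solve:
    "\<lbrakk> alg1_output N lam P S z y; bij_betw s {1..r} (mass_supp z) \<rbrakk>
     \<Longrightarrow> alg3_step N lam P (RunAlg1 S) (RunAlg2 S z s r (alg2_init s r z y))"
| alg3_alg2:
    "alg2_step N lam s r a a'
     \<Longrightarrow> alg3_step N lam P (RunAlg2 S z s r a) (RunAlg2 S z s r a')"
| alg3_repeat:
    "w \<noteq> z \<Longrightarrow> alg3_step N lam P (RunAlg2 S z s r (Step4 w)) (RunAlg1 (mass_supp w))"
| alg3_return:
    "w = z \<Longrightarrow> alg3_step N lam P (RunAlg2 S z s r (Step4 w)) (Return S w)"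

end

theory Submission
  imports Defs
begin

text \<open>
  The cost of a transport from \<open>u\<close> to the points \<open>q i\<close> is the cost from their weighted mean \<open>c\<close>
  plus the squared distance of \<open>u\<close> and \<open>c\<close>.  Hence the moves of Step 2 preserve the cost, and
  Step 3 lowers it strictly unless every extracted mean is the point it is extracted from.  In the
  latter case all partial measures are single tuples, by the lexicographic order of the
  extractions; no move can have occurred, because the last one leaves behind a tuple with
  another mean; so the output is the input, and its transport is non-mass splitting.  Otherwise the
  optimal value of the linear program decreases strictly from one iteration to the next, while the
  sets of support points range over a finite family: the iteration terminates.

  The factor 2 is inherited from the first iteration: couplings of a measure with the \<open>P i\<close>
  disintegrate into kernels, and moving the mass of a point to an independent sample of the
  mixture of its kernels at most doubles the cost.  The sparsity bound holds since every
  optimal vertex has few support points, by a dimension count.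
\<close>

section \<open>Linear programs\<close>

text \<open>Distances are infima over Borel couplings, while the algorithms only see finite sums.
  The link is \<open>lp_value S\<close>, the optimal cost over a finite set S: it is at most
  \<open>phi\<close> of every measure on S, because near-optimal couplings yield feasible solutions,
  and for the returned measure its own transport gives the converse. Couplings are only used up to
  an arbitrary \<epsilon>, so attainment is needed for the linear program alone, where finiteness
  provides it.

  A run makes choices at every level, so the potential for termination must not depend on them; the
  value of the program depends on the set alone. At the return a strict improvement is impossible,
  since the support of the output lies in the current set, over which the input was optimal. What
  remains is the stationary case with its unsplit tuples. The initial set need not consist of
  weighted means, so that containment comes from the local improvement and not from the program
  being solved.\<close>

lemma homogeneous_system_nontrivial_solution:
  fixes c :: "'e \<Rightarrow> 'u \<Rightarrow> real"
  assumes "finite E" "finite U" "card E < card U"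
  shows "\<exists>a. (\<exists>u\<in>U. a u \<noteq> 0) \<and> (\<forall>e\<in>E. (\<Sum>u\<in>U. c e u * a u) = 0)"
  using assms
proof (induction E arbitrary: U c rule: finite_induct)
  case empty
  then have "U \<noteq> {}" by auto
  then show ?case by (intro exI[of _ "\<lambda>_. 1"]) auto
next
  case (insert e E)
  show ?case
  proof (cases "\<forall>u\<in>U. c e u = 0")
    case True
    from insert.IH[of U c] insert.prems insert.hyps obtain a
      where "\<exists>u\<in>U. a u \<noteq> 0" "\<forall>e\<in>E. (\<Sum>u\<in>U. c e u * a u) = 0" by auto
    with True show ?thesis by (intro exI[of _ a]) auto
  next
    case False
    then obtain p where p: "p \<in> U" "c e p \<noteq> 0" by blast
    let ?U = "U - {p}"
    \<comment> \<open>\<open>c' f\<close> is the equation f after the unknown p has been eliminated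
      with the help of e; afterwards e itself fixes the value of p.\<close>
    define c' where "c' = (\<lambda>f u. c f u - c f p * c e u / c e p)"
    have "card E < card ?U" using insert.prems insert.hyps p by simp
    with insert.IH[of ?U c'] insert.prems obtain a where
      a: "\<exists>u\<in>?U. a u \<noteq> 0" "\<forall>f\<in>E. (\<Sum>u\<in>?U. c' f u * a u) = 0" by auto
    define t where "t = (\<Sum>u\<in>?U. c e u * a u)"
    define b where "b = a(p := - t / c e p)"
    have split: "(\<Sum>u\<in>U. c f u * b u) = (\<Sum>u\<in>?U. c f u * a u) - c f p * t / c e p" for f
    proof -
      have "(\<Sum>u\<in>U. c f u * b u) = c f p * b p + (\<Sum>u\<in>?U. c f u * b u)"
        using p insert.prems by (simp add: sum.remove)
      also have "(\<Sum>u\<in>?U. c f u * b u) = (\<Sum>u\<in>?U. c f u * a u)"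
        by (rule sum.cong) (auto simp: b_def)
      finally show ?thesis by (simp add: b_def)
    qed
    have "(\<Sum>u\<in>U. c f u * b u) = 0" if "f \<in> insert e E" for f
    proof (cases "f = e")
      case True
      then show ?thesis using split[of e] p by (simp add: t_def)
    next
      case False
      with that have "f \<in> E" by simp
      with a have "0 = (\<Sum>u\<in>?U. c' f u * a u)" by simp
      also have "\<dots> = (\<Sum>u\<in>?U. c f u * a u - c f p / c e p * (c e u * a u))"
        by (rule sum.cong) (auto simp: c'_def algebra_simps)
      also have "\<dots> = (\<Sum>u\<in>?U. c f u * a u) - c f p / c e p * t"
        by (simp add: sum_subtractf sum_distrib_left t_def)
      finally show ?thesis using split[of f] by simp
    qed
    moreover have "\<exists>u\<in>U. b u \<noteq> 0" using a(1) by (auto simp: b_def)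
    ultimately show ?thesis by blast
  qed
qed

section \<open>Basic solutions of bounded linear programs\<close>

definition support :: "('v \<Rightarrow> real) \<Rightarrow> 'v set" where
  "support f = {v. f v \<noteq> 0}"

text \<open>Being determined by the support stands in for being a vertex: it implies extremeness for
  nonnegative points, and it leaves only finitely many such points when the supports lie in a finite
  set.\<close>

definition basic_in :: "('v \<Rightarrow> real) set \<Rightarrow> ('v \<Rightarrow> real) \<Rightarrow> bool" where
  "basic_in F f \<longleftrightarrow> f \<in> F \<and> (\<forall>g\<in>F. support g \<subseteq> support f \<longrightarrow> g = f)"

text \<open>
  A feasible point that is not basic can be moved along a line towards or away from another one
  with smaller support, in a direction that does not increase the cost, until a coordinate
  vanishes; the condition on the coordinate sums makes the polyhedron bounded.
\<close>

lemma basic_solution_improves: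
  fixes F :: "('v \<Rightarrow> real) set" and c :: "'v \<Rightarrow> real"
  assumes I: "finite I"
    and nonneg: "\<And>f v. f \<in> F \<Longrightarrow> 0 \<le> f v"
    and outside: "\<And>f v. f \<in> F \<Longrightarrow> v \<notin> I \<Longrightarrow> f v = 0"
    and affine: "\<And>f g t. f \<in> F \<Longrightarrow> g \<in> F \<Longrightarrow> (\<forall>v. 0 \<le> f v + t * (g v - f v)) \<Longrightarrow>
      (\<lambda>v. f v + t * (g v - f v)) \<in> F"
    and total: "\<And>f g. f \<in> F \<Longrightarrow> g \<in> F \<Longrightarrow> sum f I = sum g I"
    and "f \<in> F"
  shows "\<exists>g. basic_in F g \<and> (\<Sum>v\<in>I. c v * g v) \<le> (\<Sum>v\<in>I. c v * f v)"
  using \<open>f \<in> F\<close>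
proof (induction "card (support f)" arbitrary: f rule: less_induct)
  case less
  have sub: "support h \<subseteq> I" if "h \<in> F" for h
    using outside[OF that] by (auto simp: support_def)
  show ?case
  proof (cases "basic_in F f")
    case False
    with less.prems obtain g where g: "g \<in> F" "support g \<subseteq> support f" "g \<noteq> f"
      by (auto simp: basic_in_def)
    let ?C = "\<lambda>h. \<Sum>v\<in>I. c v * h v"
    define \<sigma> :: real where "\<sigma> = (if ?C g \<le> ?C f then 1 else - 1)"
    define h where "h = (\<lambda>v. \<sigma> * (g v - f v))"
    have \<sigma>: "\<sigma> \<noteq> 0" by (simp add: \<sigma>_def)
    have hC: "?C h \<le> 0"
      by (auto simp: h_def \<sigma>_def sum_subtractf right_diff_distrib sum_negf)
    have hout: "h v = 0" if "v \<notin> support f" for v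
      using that g by (auto simp: h_def support_def)
    have hsum: "sum h I = 0"
      using total[OF \<open>f \<in> F\<close> g(1)] by (simp add: h_def sum_distrib_left[symmetric] sum_subtractf)
    define B where "B = {v\<in>I. h v < 0}"
    \<comment> \<open>The coordinates of \<open>h\<close> sum to zero, so without a negative one
      \<open>h\<close> would vanish and g would equal f. This is where equal coordinate sums exclude
      unbounded directions.\<close>
    have "B \<noteq> {}"
    proof
      assume "B = {}"
      then have pos: "\<forall>v\<in>I. 0 \<le> h v" by (auto simp: B_def not_less)
      with hsum I have "\<forall>v\<in>I. h v = 0" by (simp add: sum_nonneg_eq_0_iff)
      moreover have "h v = 0" if "v \<notin> I" for v
        using that sub[OF \<open>f \<in> F\<close>] hout by auto
      ultimately have "g v = f v" for v using \<sigma> by (cases "v \<in> I") (force simp: h_def)+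
      with g(3) show False by auto
    qed
    moreover have "finite B" using I by (simp add: B_def)
    ultimately have Bfin: "finite B" "B \<noteq> {}" by auto
    \<comment> \<open>Ratio test: the longest step along \<open>h\<close> that keeps all coordinates
      nonnegative. The minimizing coordinate p drops out of the support.\<close>
    define t where "t = Min ((\<lambda>v. f v / - h v) ` B)"
    have "t \<in> (\<lambda>v. f v / - h v) ` B"
      unfolding t_def by (rule Min_in) (use Bfin in auto)
    then obtain p where p: "p \<in> B" "t = f p / - h p" by blast
    have t_le: "t \<le> f v / - h v" if "v \<in> B" for v
      using that Bfin unfolding t_def by (intro Min_le) auto
    have t0: "0 \<le> t"
      using p nonneg[OF \<open>f \<in> F\<close>, of p] by (auto simp: B_def divide_nonneg_neg)
    have nn: "0 \<le> f v + t * h v" for v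
    proof (cases "v \<in> B")
      case True
      then have "t * - h v \<le> f v"
        using t_le[OF True] by (simp add: B_def field_simps)
      then show ?thesis by simp
    next
      case False
      then have "0 \<le> h v" using hout[of v] sub[OF \<open>f \<in> F\<close>] by (force simp: B_def)
      then show ?thesis using t0 nonneg[OF \<open>f \<in> F\<close>, of v] by simp
    qed
    define f' where "f' = (\<lambda>v. f v + t * h v)"
    have f'F: "f' \<in> F"
      using affine[OF \<open>f \<in> F\<close> g(1), of "t * \<sigma>"] nn by (simp add: f'_def h_def mult.assoc)
    have "f' p = 0" using p by (simp add: f'_def B_def)
    moreover have "f p \<noteq> 0"
      using p(1) hout[of p] by (auto simp: B_def support_def)
    moreover have "support f' \<subseteq> support f"
      using hout by (auto simp: f'_def support_def)
    ultimately have "support f' \<subset> support f" by (auto simp: support_def)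
    then have "card (support f') < card (support f)"
      using sub[OF \<open>f \<in> F\<close>] I by (meson psubset_card_mono rev_finite_subset)
    from less.hyps[OF this f'F] obtain g' where
      g': "basic_in F g'" "?C g' \<le> ?C f'" by blast
    have "?C f' = ?C f + t * ?C h"
      by (simp add: f'_def sum.distrib sum_distrib_left algebra_simps)
    also have "\<dots> \<le> ?C f" using t0 hC by (simp add: mult_nonneg_nonpos)
    finally show ?thesis using g' by (intro exI[of _ g']) auto
  qed (use less.prems in auto)
qed

text \<open>There are finitely many basic points, and every feasible point is dominated by one of
  them, so the cheapest basic point is optimal; no compactness is involved.\<close>

lemma optimal_basic_solution_exists:
  fixes F :: "('v \<Rightarrow> real) set" and c :: "'v \<Rightarrow> real"
  assumes I: "finite I" and "F \<noteq> {}"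
    and nonneg: "\<And>f v. f \<in> F \<Longrightarrow> 0 \<le> f v"
    and outside: "\<And>f v. f \<in> F \<Longrightarrow> v \<notin> I \<Longrightarrow> f v = 0"
    and affine: "\<And>f g t. f \<in> F \<Longrightarrow> g \<in> F \<Longrightarrow> (\<forall>v. 0 \<le> f v + t * (g v - f v)) \<Longrightarrow>
      (\<lambda>v. f v + t * (g v - f v)) \<in> F"
    and total: "\<And>f g. f \<in> F \<Longrightarrow> g \<in> F \<Longrightarrow> sum f I = sum g I"
  shows "\<exists>g. basic_in F g \<and> (\<forall>f\<in>F. (\<Sum>v\<in>I. c v * g v) \<le> (\<Sum>v\<in>I. c v * f v))"
proof -
  let ?C = "\<lambda>h. \<Sum>v\<in>I. c v * h v"
  let ?B = "Collect (basic_in F)"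
  have improve: "\<exists>g\<in>?B. ?C g \<le> ?C f" if "f \<in> F" for f
    using basic_solution_improves[of I F f c] assms that by blast
  have "inj_on support ?B"
    by (rule inj_onI) (auto simp: basic_in_def)
  moreover have "support ` ?B \<subseteq> Pow I"
    using outside by (fastforce simp: support_def basic_in_def)
  ultimately have fin: "finite ?B"
    using I by (meson finite_Pow_iff finite_imageD finite_subset)
  have ne: "?B \<noteq> {}" using improve \<open>F \<noteq> {}\<close> by blast
  obtain g where g: "is_arg_min ?C (\<lambda>g. g \<in> ?B) g"
    using ex_is_arg_min_if_finite[OF fin ne, of ?C] by blast
  have "?C g \<le> ?C f" if f: "f \<in> F" for f
  proof -
    obtain g' where "g' \<in> ?B" "?C g' \<le> ?C f" using improve[OF f] by blast
    then show ?thesis using g by (force simp: is_arg_min_linorder)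
  qed
  then show ?thesis using g by (auto simp: is_arg_min_def)
qed

section \<open>The transport polytope over a finite set of possible support points\<close>

locale weighted_measures =
  fixes P :: "nat \<Rightarrow> 'a::euclidean_space pmf" and lam :: "nat \<Rightarrow> real" and N :: nat
  assumes finite_supp: "\<And>i. i \<in> {1..N} \<Longrightarrow> finite (set_pmf (P i))"
    and lam_pos: "\<And>i. i \<in> {1..N} \<Longrightarrow> 0 < lam i"
    and lam_sum: "(\<Sum>i\<in>{1..N}. lam i) = 1"
begin

abbreviation feasible where "feasible \<equiv> lp_feasible N P"
abbreviation cost where "cost \<equiv> transport_cost N lam P"

text \<open>An empty family of weights would sum to 0. The index 1 serves as reference wherever a
  mass is recovered from the transport to a single measure.\<close>

lemma N_pos: "1 \<in> {1..N}"
  using lam_sum by (cases N) auto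

lemma sum_pmf_P: "i \<in> {1..N} \<Longrightarrow> (\<Sum>k\<in>set_pmf (P i). pmf (P i) k) = 1"
  using finite_supp by (simp add: sum_pmf_eq_1)

lemma feasible_nonneg: "feasible S z y \<Longrightarrow> 0 \<le> y i x k"
  unfolding lp_feasible_def by (cases "i \<in> {1..N} \<and> x \<in> S \<and> k \<in> set_pmf (P i)") auto

lemma feasible_mass:
  assumes "feasible S z y" "i \<in> {1..N}"
  shows "(\<Sum>k\<in>set_pmf (P i). y i x k) = z x"
  using assms unfolding lp_feasible_def by (cases "x \<in> S") (auto intro!: sum.neutral)

lemma feasible_mass_nonneg: "feasible S z y \<Longrightarrow> 0 \<le> z x"
  using feasible_mass[OF _ N_pos, of S z y x] feasible_nonneg[of S z y]
  by (metis sum_nonneg)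

lemma feasible_mass_supp: "feasible S z y \<Longrightarrow> mass_supp z \<subseteq> S"
  unfolding lp_feasible_def mass_supp_def by force

lemma feasible_zero:
  assumes "feasible S z y" "i \<in> {1..N}" "z x = 0"
  shows "y i x k = 0"
proof (cases "k \<in> set_pmf (P i)")
  case True
  then show ?thesis
    using feasible_mass[OF assms(1,2), of x] assms feasible_nonneg[OF assms(1)] finite_supp
    by (simp add: sum_nonneg_eq_0_iff)
qed (use assms in \<open>auto simp: lp_feasible_def\<close>)

lemma feasible_total_mass:
  assumes "feasible S z y"
  shows "(\<Sum>x\<in>S. z x) = 1"
proof -
  have "(\<Sum>x\<in>S. z x) = (\<Sum>x\<in>S. \<Sum>k\<in>set_pmf (P 1). y 1 x k)"
    using feasible_mass[OF assms N_pos] by simp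
  also have "\<dots> = (\<Sum>k\<in>set_pmf (P 1). pmf (P 1) k)"
    using assms N_pos by (subst sum.swap) (auto simp: lp_feasible_def intro!: sum.cong)
  finally show ?thesis using sum_pmf_P[OF N_pos] by simp
qed

text \<open>The variables vanish off A, so a solution over A is literally one over B. This compares
  the programs for a support and for the set containing it.\<close>

lemma feasible_mono:
  assumes "feasible A z y" "A \<subseteq> B" "finite B"
  shows "feasible B z y" "cost B y = cost A y"
proof -
  have y0: "y i x k = 0" if "x \<notin> A" for i x k
    using assms(1) that by (auto simp: lp_feasible_def)
  have *: "(\<Sum>x\<in>B. y i x k) = (\<Sum>x\<in>A. y i x k)" for i k
    using assms y0 by (intro sum.mono_neutral_right) auto
  show "feasible B z y"
    unfolding lp_feasible_def *
  proof (intro conjI ballI allI impI)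
    show "z x = 0" if "x \<notin> B" for x
      using that assms(1,2) by (auto simp: lp_feasible_def)
    show "y i x k = 0" if "\<not> (i \<in> {1..N} \<and> x \<in> B \<and> k \<in> set_pmf (P i))" for i x k
      using that assms(1,2) by (cases "x \<in> A") (auto simp: lp_feasible_def)
    show "(\<Sum>x\<in>A. y i x k) = pmf (P i) k" if "i \<in> {1..N}" "k \<in> set_pmf (P i)" for i k
      using that assms(1) by (simp add: lp_feasible_def)
  qed (simp_all add: feasible_nonneg[OF assms(1)] feasible_mass[OF assms(1)])
  have "(\<Sum>x\<in>B. \<Sum>k\<in>set_pmf (P i). (norm (x - k))\<^sup>2 * y i x k) =
      (\<Sum>x\<in>A. \<Sum>k\<in>set_pmf (P i). (norm (x - k))\<^sup>2 * y i x k)" for i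
    using assms y0 by (intro sum.mono_neutral_right) auto
  then show "cost B y = cost A y" by (simp add: transport_cost_def)
qed

lemma cost_nonneg: "feasible S z y \<Longrightarrow> 0 \<le> cost S y"
  unfolding transport_cost_def
  by (intro sum_nonneg mult_nonneg_nonneg less_imp_le[OF lam_pos]) (auto intro: feasible_nonneg)

lemma feasible_exists:
  assumes "finite S" "S \<noteq> {}"
  shows "\<exists>z y. feasible S z y"
proof -
  obtain s where s: "s \<in> S" using assms by auto
  have "feasible S (\<lambda>x. if x = s then 1 else 0)
     (\<lambda>i x k. if i \<in> {1..N} \<and> x = s \<and> k \<in> set_pmf (P i) then pmf (P i) k else 0)"
    unfolding lp_feasible_def using s assms sum_pmf_P
    by (auto simp: sum.If_cases Int_def)
  then show ?thesis by blast
qed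

lemma feasible_affine:
  assumes "feasible S z y" "feasible S z' y'"
    and "\<And>i x k. 0 \<le> y i x k + t * (y' i x k - y i x k)"
  shows "feasible S (\<lambda>x. z x + t * (z' x - z x)) (\<lambda>i x k. y i x k + t * (y' i x k - y i x k))"
  using assms unfolding lp_feasible_def
  by (auto simp: sum.distrib sum_subtractf sum_distrib_left[symmetric])

text \<open>The program is flattened to functions on triples (i, x, k), to which the result on basic
  solutions applies. The masses \<open>z\<close> are left out because \<open>y\<close> determines
  them.\<close>

lemma alg1_output_exists:
  assumes S: "finite S" "S \<noteq> {}"
  shows "\<exists>z y. alg1_output N lam P S z y"
proof -
  define u :: "(nat \<Rightarrow> 'a \<Rightarrow> 'a \<Rightarrow> real) \<Rightarrow> nat \<times> 'a \<times> 'a \<Rightarrow> real"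
    where "u = (\<lambda>y (i, x, k). y i x k)"
  define F where "F = u ` {y. \<exists>z. feasible S z y}"
  define I where "I = (SIGMA i:{1..N}. S \<times> set_pmf (P i))"
  define c where "c = (\<lambda>(i, x, k). lam i * (norm (x - k :: 'a))\<^sup>2)"
  have u_inj: "u y = u y' \<longleftrightarrow> y = y'" for y y'
    by (auto simp: u_def fun_eq_iff)
  have finI: "finite I" using S finite_supp by (auto simp: I_def)
  have sumI: "sum f I = (\<Sum>i\<in>{1..N}. \<Sum>x\<in>S. \<Sum>k\<in>set_pmf (P i). f (i, x, k))" for f :: "_ \<Rightarrow> real"
  proof -
    have "(\<Sum>i\<in>{1..N}. \<Sum>x\<in>S. \<Sum>k\<in>set_pmf (P i). f (i, x, k)) =
        (\<Sum>i\<in>{1..N}. \<Sum>p\<in>S \<times> set_pmf (P i). f (i, p))"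
      by (simp add: sum.cartesian_product case_prod_beta')
    also have "\<dots> = sum f I"
      unfolding I_def using S finite_supp by (subst sum.Sigma) (auto simp: case_prod_beta')
    finally show ?thesis by simp
  qed
  have cost: "(\<Sum>v\<in>I. c v * u y v) = cost S y" for y
    by (simp add: sumI c_def u_def transport_cost_def sum_distrib_left mult.assoc)
  obtain g where g: "basic_in F g" "\<forall>f\<in>F. (\<Sum>v\<in>I. c v * g v) \<le> (\<Sum>v\<in>I. c v * f v)"
  proof -
    have "\<exists>g. basic_in F g \<and> (\<forall>f\<in>F. (\<Sum>v\<in>I. c v * g v) \<le> (\<Sum>v\<in>I. c v * f v))"
    proof (rule optimal_basic_solution_exists[OF finI])
      show "F \<noteq> {}" using feasible_exists[OF S] by (auto simp: F_def)
      show "0 \<le> f v" if "f \<in> F" for f v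
        using that feasible_nonneg by (cases v) (auto simp: F_def u_def)
      show "f v = 0" if "f \<in> F" "v \<notin> I" for f v
        using that by (cases v) (auto simp: F_def u_def lp_feasible_def I_def)
      show "sum f I = sum g I" if "f \<in> F" "g \<in> F" for f g
      proof -
        \<comment> \<open>Each of the N measures receives total mass 1, which is the boundedness
          condition on coordinate sums.\<close>
        have "sum (u y) I = real N" if "feasible S z y" for z y
          using feasible_mass[OF that] feasible_total_mass[OF that]
          by (simp add: sumI u_def)
        with that show ?thesis by (auto simp: F_def)
      qed
      show "(\<lambda>v. f v + t * (g v - f v)) \<in> F"
        if fg: "f \<in> F" "g \<in> F" "\<forall>v. 0 \<le> f v + t * (g v - f v)" for f g t
      proof -
        obtain y z y' z' where y: "f = u y" "feasible S z y" "g = u y'" "feasible S z' y'"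
          using fg by (auto simp: F_def)
        have "0 \<le> y i x k + t * (y' i x k - y i x k)" for i x k
          using fg(3) spec[of _ "(i, x, k)"] by (auto simp: y u_def)
        from feasible_affine[OF y(2,4) this]
        have "u (\<lambda>i x k. y i x k + t * (y' i x k - y i x k)) \<in> F"
          by (auto simp: F_def)
        then show ?thesis by (simp add: u_def y case_prod_beta')
      qed
    qed
    then show ?thesis using that by blast
  qed
  then obtain y z where y: "g = u y" "feasible S z y"
    by (auto simp: basic_in_def F_def)
  have "alg1_output N lam P S z y"
    unfolding alg1_output_def lp_vertex_def
  proof (intro conjI allI impI)
    show "feasible S z y" by fact
    show "cost S y \<le> cost S y'" if "feasible S z' y'" for z' y'
      using g(2) that unfolding y by (auto simp: F_def cost)
  next
    fix z1 y1 z2 y2 t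
    assume *: "feasible S z1 y1 \<and> feasible S z2 y2 \<and> 0 < t \<and> t < 1 \<and>
      z = (\<lambda>x. (1 - t) * z1 x + t * z2 x) \<and> y = (\<lambda>i x k. (1 - t) * y1 i x k + t * y2 i x k)"
    \<comment> \<open>A proper convex combination of nonnegative numbers vanishes only if both do.
      Hence both endpoints have support inside that of \<open>y\<close>, and basicness identifies
      them with it.\<close>
    have zero: "y1 i x k = 0 \<and> y2 i x k = 0" if "y i x k = 0" for i x k
    proof -
      have "0 \<le> (1 - t) * y1 i x k" "0 \<le> t * y2 i x k"
        using * feasible_nonneg by (auto intro!: mult_nonneg_nonneg)
      moreover have "(1 - t) * y1 i x k + t * y2 i x k = 0" using * that by simp
      ultimately have "(1 - t) * y1 i x k = 0" "t * y2 i x k = 0" by linarith+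
      then show ?thesis using * by auto
    qed
    have f12: "feasible S z1 y1" "feasible S z2 y2" using * by auto
    have "support (u y1) \<subseteq> support (u y)" "support (u y2) \<subseteq> support (u y)"
      using zero by (auto simp: support_def u_def)
    moreover have "u y1 \<in> F" "u y2 \<in> F" using f12 by (auto simp: F_def)
    ultimately have "u y1 = u y" "u y2 = u y"
      using g(1) by (simp_all add: basic_in_def y)
    then have "y1 = y2" by (simp add: u_inj)
    moreover
    from f12[THEN feasible_mass, OF N_pos] have "z1 x = z2 x" for x
      using \<open>y1 = y2\<close> by metis
    ultimately show "z1 = z2" "y1 = y2" by blast+
  qed
  then show ?thesis by blast
qed

text \<open>
  Choose for every support point \<open>x\<close> of \<open>z\<close> one point \<open>k i x\<close> of each \<open>P i\<close> that receives mass
  from \<open>x\<close>.  Shifting the masses along these tuples preserves feasibility if a homogeneous system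
  holds in which, for each \<open>i > 1\<close>, one of the equations is redundant.
\<close>

lemma vertex_sparse:
  assumes v: "lp_vertex N P S z y" and S: "finite S"
  shows "int (card (mass_supp z)) \<le> (\<Sum>i\<in>{1..N}. int (card (set_pmf (P i)))) - int N + 1"
proof (rule ccontr)
  assume big: "\<not> ?thesis"
  have f: "feasible S z y" using v by (simp add: lp_vertex_def)
  let ?U = "mass_supp z"
  have U: "?U \<subseteq> S" "finite ?U"
    using feasible_mass_supp[OF f] S finite_subset by auto
  have "\<exists>k. k \<in> set_pmf (P i) \<and> 0 < y i x k" if "i \<in> {1..N}" "x \<in> ?U" for i x
  proof (rule ccontr)
    assume "\<not> ?thesis"
    then have "(\<Sum>k\<in>set_pmf (P i). y i x k) \<le> 0" by (intro sum_nonpos) force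
    with feasible_mass[OF f that(1), of x] that(2) show False by (simp add: mass_supp_def)
  qed
  then obtain k where k: "\<And>i x. i \<in> {1..N} \<Longrightarrow> x \<in> ?U \<Longrightarrow> k i x \<in> set_pmf (P i) \<and> 0 < y i x (k i x)"
    by metis
  define k0 where "k0 = (\<lambda>i. SOME k. k \<in> set_pmf (P i))"
  have k0: "k0 i \<in> set_pmf (P i)" for i
    unfolding k0_def using set_pmf_not_empty[of "P i"] by (simp add: some_in_eq)
  \<comment> \<open>For each i the equations of all points of \<open>P i\<close> add up to the same
    total, the sum of \<open>a\<close>. The full set for i = 1 makes this total zero, so one
    equation may be dropped for every other i; this is the origin of the correction - N + 1.\<close>
  define E where "E = (SIGMA i:{1..N}. if i = 1 then set_pmf (P i) else set_pmf (P i) - {k0 i})"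
  have finE: "finite E" using finite_supp by (auto simp: E_def)
  have "int (card E) = (\<Sum>i\<in>{1..N}. int (card (set_pmf (P i))) - (if i = 1 then 0 else 1))"
  proof -
    have "card (set_pmf (P i)) \<ge> 1" if "i \<in> {1..N}" for i
      using finite_supp[OF that] set_pmf_not_empty[of "P i"] by (simp add: Suc_leI card_gt_0_iff)
    then show ?thesis using finite_supp k0 unfolding E_def
      by (subst card_SigmaI) (auto simp: of_nat_diff intro!: sum.cong)
  qed
  also have "\<dots> = (\<Sum>i\<in>{1..N}. int (card (set_pmf (P i)))) - (int N - 1)"
  proof -
    have "(\<Sum>i\<in>{1..N}. if i = 1 then 0 else (1::int)) = int (card ({1..N} - {1}))"
      by (simp add: sum.If_cases) (simp add: set_diff_eq Int_def)
    then show ?thesis using N_pos by (simp add: sum_subtractf of_nat_diff)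
  qed
  finally have "card E < card ?U" using big by linarith
  from homogeneous_system_nontrivial_solution[OF finE U(2) this,
      of "\<lambda>e x. if k (fst e) x = snd e then 1 else 0"]
  obtain a :: "'a \<Rightarrow> real" where a: "\<exists>x\<in>?U. a x \<noteq> 0"
    and aE': "\<forall>e\<in>E. (\<Sum>x\<in>?U. (if k (fst e) x = snd e then 1 else 0) * a x) = 0"
    by blast
  have aE: "(\<Sum>x\<in>?U. if k i x = p then a x else 0) = 0" if "(i, p) \<in> E" for i p
    using bspec[OF aE' that] by (simp add: if_distrib[of "\<lambda>t. t * _"] cong: if_cong)
  have tot: "(\<Sum>p\<in>set_pmf (P i). \<Sum>x\<in>?U. if k i x = p then a x else 0) = (\<Sum>x\<in>?U. a x)"
    if i: "i \<in> {1..N}" for i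
    using finite_supp[OF i] k[OF i] by (subst sum.swap) (auto intro!: sum.cong)
  have "(\<Sum>x\<in>?U. a x) = 0"
    using tot[OF N_pos] aE[of 1] N_pos by (simp add: E_def)
  then have all: "(\<Sum>x\<in>?U. if k i x = p then a x else 0) = 0"
    if i: "i \<in> {1..N}" and p: "p \<in> set_pmf (P i)" for i p
  proof (cases "(i, p) \<in> E")
    case False
    then have "p = k0 i" "i \<noteq> 1" using i p by (auto simp: E_def split: if_splits)
    moreover have "(\<Sum>q\<in>set_pmf (P i) - {k0 i}. \<Sum>x\<in>?U. if k i x = q then a x else 0) = 0"
      using aE i \<open>i \<noteq> 1\<close> by (intro sum.neutral) (auto simp: E_def)
    ultimately show ?thesis
      using tot[OF i] \<open>(\<Sum>x\<in>?U. a x) = 0\<close> finite_supp[OF i] p by (simp add: sum.remove[of _ p])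
  qed (rule aE)
  define D where "D = (\<lambda>i x p. if i \<in> {1..N} \<and> x \<in> ?U \<and> k i x = p then a x else 0)"
  \<comment> \<open>\<open>\<mu> / M\<close> is a step length that preserves nonnegativity in both
    directions. The inserted 1 keeps \<open>M\<close> away from zero and both extrema over nonempty
    sets.\<close>
  define M where "M = Max (insert 1 ((\<lambda>x. \<bar>a x\<bar>) ` ?U))"
  define \<mu> where "\<mu> = Min (insert 1 ((\<lambda>(i, x). y i x (k i x)) ` ({1..N} \<times> ?U)))"
  have M: "1 \<le> M" "\<And>x. x \<in> ?U \<Longrightarrow> \<bar>a x\<bar> \<le> M"
    using U by (auto simp: M_def intro!: Max_ge)
  have "0 < \<mu>" unfolding \<mu>_def using U k by (subst Min_gr_iff) auto
  moreover have \<mu>: "\<mu> \<le> y i x (k i x)" if "i \<in> {1..N}" "x \<in> ?U" for i x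
    unfolding \<mu>_def using U that by (intro Min_le) auto
  ultimately have \<epsilon>: "0 < \<mu> / M" using M by simp
  have bound: "\<bar>\<mu> / M * D i x p\<bar> \<le> y i x p" for i x p
  proof (cases "i \<in> {1..N} \<and> x \<in> ?U \<and> k i x = p")
    case True
    then have "\<bar>\<mu> / M * D i x p\<bar> = \<mu> * (\<bar>a x\<bar> / M)"
      using M \<open>0 < \<mu>\<close> by (simp add: D_def abs_mult)
    also have "\<dots> \<le> \<mu> * 1"
      using M True \<open>0 < \<mu>\<close> by (intro mult_left_mono) auto
    finally show ?thesis using \<mu>[of i x] True by simp
  next
    case False
    then show ?thesis using feasible_nonneg[OF f] by (auto simp: D_def)
  qed
  have shift: "feasible S (\<lambda>x. z x + t * (if x \<in> ?U then a x else 0)) (\<lambda>i x p. y i x p + t * D i x p)"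
    if t: "\<bar>t\<bar> = \<mu> / M" for t
    unfolding lp_feasible_def
  proof (intro conjI ballI allI impI)
    fix i x assume i: "i \<in> {1..N}"
    have "(\<Sum>p\<in>set_pmf (P i). D i x p) = (if x \<in> ?U then a x else 0)"
      using i finite_supp[OF i] k[OF i] by (auto simp: D_def)
    then show "(\<Sum>p\<in>set_pmf (P i). y i x p + t * D i x p) = z x + t * (if x \<in> ?U then a x else 0)"
      by (simp add: sum.distrib sum_distrib_left[symmetric] feasible_mass[OF f i])
  next
    fix i p assume i: "i \<in> {1..N}" and p: "p \<in> set_pmf (P i)"
    have "(\<Sum>x\<in>S. D i x p) = (\<Sum>x\<in>?U. if k i x = p then a x else 0)"
      using U S i by (intro sum.mono_neutral_cong_right) (auto simp: D_def)
    then show "(\<Sum>x\<in>S. y i x p + t * D i x p) = pmf (P i) p"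
      using f i p all by (simp add: sum.distrib sum_distrib_left[symmetric] lp_feasible_def)
  next
    fix i x p
    have "\<bar>t * D i x p\<bar> \<le> y i x p" using bound[of i x p] t M \<open>0 < \<mu>\<close> by (simp add: abs_mult)
    then show "0 \<le> y i x p + t * D i x p" by linarith
  next
    fix x assume "x \<notin> S"
    then show "z x + t * (if x \<in> ?U then a x else 0) = 0" using f U by (auto simp: lp_feasible_def)
  next
    fix i x p assume "\<not> (i \<in> {1..N} \<and> x \<in> S \<and> p \<in> set_pmf (P i))"
    then show "y i x p + t * D i x p = 0" using f U k by (auto simp: lp_feasible_def D_def)
  qed
  \<comment> \<open>The vertex is the midpoint of its two shifts, which therefore coincide; this
    forces \<open>a\<close> to vanish on the support.\<close>
  have "(\<lambda>x. z x + \<mu> / M * (if x \<in> ?U then a x else 0)) =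
      (\<lambda>x. z x + - (\<mu> / M) * (if x \<in> ?U then a x else 0))"
  proof -
    have vert: "z1 = z2" if "feasible S z1 y1 \<and> feasible S z2 y2 \<and> 0 < t \<and> t < 1 \<and>
        z = (\<lambda>x. (1 - t) * z1 x + t * z2 x) \<and> y = (\<lambda>i x k. (1 - t) * y1 i x k + t * y2 i x k)"
      for z1 y1 z2 y2 t
      using v that unfolding lp_vertex_def by blast
    show ?thesis
      by (rule vert[of _ "\<lambda>i x p. y i x p + \<mu> / M * D i x p" _
            "\<lambda>i x p. y i x p + - (\<mu> / M) * D i x p" "1 / 2"],
          intro conjI shift) (use M \<open>0 < \<mu>\<close> in \<open>auto simp: algebra_simps fun_eq_iff\<close>)
  qed
  note eq = fun_cong[OF this]
  have "a x = 0" if "x \<in> ?U" for x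
    using eq[of x] \<epsilon> that by auto
  with a show False by blast
qed

end

section \<open>Wasserstein distances to discrete measures\<close>

lemma W2_sq:
  "(W2 M M')\<^sup>2 = enn2real (INF \<gamma>\<in>couplings M M'. \<integral>\<^sup>+p. ennreal ((norm (fst p - snd p))\<^sup>2) \<partial>\<gamma>)"
  by (simp add: W2_def)

lemma W2_sq_le:
  assumes "\<gamma> \<in> couplings M M'" "(\<integral>\<^sup>+p. ennreal ((norm (fst p - snd p))\<^sup>2) \<partial>\<gamma>) \<le> ennreal c" "0 \<le> c"
  shows "(W2 M M')\<^sup>2 \<le> c"
  unfolding W2_sq using assms by (intro enn2real_leI INF_lower2)

text \<open>The finite joint law becomes a Borel coupling through the identity map, which is
  measurable because every set is measurable for a pmf.\<close>

lemma W2_map_pmf_le: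
  fixes \<pi> :: "('a::euclidean_space \<times> 'a) pmf"
  assumes fin: "finite (set_pmf \<pi>)"
  shows "(W2 (borel_pmf (map_pmf fst \<pi>)) (borel_pmf (map_pmf snd \<pi>)))\<^sup>2 \<le>
    (\<Sum>p\<in>set_pmf \<pi>. (norm (fst p - snd p))\<^sup>2 * pmf \<pi> p)"
proof (rule W2_sq_le)
  let ?B = "borel \<Otimes>\<^sub>M borel :: ('a \<times> 'a) measure"
  let ?\<gamma> = "distr (measure_pmf \<pi>) ?B (\<lambda>p. p)"
  have meas: "(\<lambda>p. p) \<in> measurable (measure_pmf \<pi>) ?B"
    by (simp add: space_pair_measure measurable_def)
  have "prob_space ?\<gamma>"
    using meas by (rule measure_pmf.prob_space_distr)
  moreover have "distr ?\<gamma> borel h = borel_pmf (map_pmf h \<pi>)"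
    if [measurable]: "h \<in> borel_measurable ?B" for h :: "'a \<times> 'a \<Rightarrow> 'a"
  proof -
    have "distr ?\<gamma> borel h = distr (measure_pmf \<pi>) borel h"
      by (subst distr_distr[OF _ meas]) (simp_all add: o_def)
    also have "\<dots> = borel_pmf (map_pmf h \<pi>)"
      unfolding borel_pmf_def map_pmf_rep_eq by (subst distr_distr) (simp_all add: o_def)
    finally show ?thesis .
  qed
  ultimately show "?\<gamma> \<in> couplings (borel_pmf (map_pmf fst \<pi>)) (borel_pmf (map_pmf snd \<pi>))"
    by (simp add: couplings_def)
  have "(\<integral>\<^sup>+p. ennreal ((norm (fst p - snd p))\<^sup>2) \<partial>?\<gamma>) =
      (\<integral>\<^sup>+p. ennreal ((norm (fst p - snd p))\<^sup>2) \<partial>measure_pmf \<pi>)"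
    by (rule nn_integral_distr[OF meas]) measurable
  also have "\<dots> = ennreal (\<Sum>p\<in>set_pmf \<pi>. (norm (fst p - snd p))\<^sup>2 * pmf \<pi> p)"
    using fin by (simp add: nn_integral_measure_pmf_finite ennreal_mult' sum_ennreal[symmetric])
  finally show "(\<integral>\<^sup>+p. ennreal ((norm (fst p - snd p))\<^sup>2) \<partial>?\<gamma>) \<le>
      ennreal (\<Sum>p\<in>set_pmf \<pi>. (norm (fst p - snd p))\<^sup>2 * pmf \<pi> p)" by simp
qed (simp add: sum_nonneg)

lemma borel_pmf_prob_space: "prob_space (borel_pmf Q)"
  unfolding borel_pmf_def by (rule measure_pmf.prob_space_distr) simp

lemma sets_borel_pmf [simp, measurable_cong]: "sets (borel_pmf Q) = sets borel"
  by (simp add: borel_pmf_def)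

lemma finite_second_moment_borel_pmf:
  "finite (set_pmf Q) \<Longrightarrow> finite_second_moment (borel_pmf Q)"
  unfolding finite_second_moment_def
  using borel_pmf_prob_space[of Q]
  by (auto simp: borel_pmf_def integrable_distr_eq integrable_measure_pmf_finite)

lemma AE_borel_pmf:
  "finite (set_pmf Q) \<Longrightarrow> (AE x in borel_pmf Q. x \<in> set_pmf Q)"
  unfolding borel_pmf_def by (subst AE_distr_iff) (auto simp: AE_measure_pmf finite_imp_closed)

lemma couplings_AE_snd:
  assumes "\<gamma> \<in> couplings M (borel_pmf R)" "finite (set_pmf R)"
  shows "AE p in \<gamma>. snd p \<in> set_pmf R"
proof -
  have [measurable_cong]: "sets \<gamma> = sets (borel \<Otimes>\<^sub>M borel)"
    and d: "distr \<gamma> borel snd = borel_pmf R" using assms by (auto simp: couplings_def)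
  have "AE x in distr \<gamma> borel snd. x \<in> set_pmf R" unfolding d by (rule AE_borel_pmf) fact
  then show ?thesis by (rule AE_distrD[rotated]) measurable
qed

lemma norm_diff_sq_le: "(norm (x - y :: 'a::real_inner))\<^sup>2 \<le> 2 * (norm x)\<^sup>2 + 2 * (norm y)\<^sup>2"
proof -
  have "(norm (x - y))\<^sup>2 + (norm (x + y))\<^sup>2 = 2 * (norm x)\<^sup>2 + 2 * (norm y)\<^sup>2"
    by (simp add: power2_norm_eq_inner inner_simps inner_commute)
  then show ?thesis by (smt (verit) zero_le_power2)
qed

text \<open>The product coupling suffices: the second moment of M and the finite support of R bound
  its cost. Hence the infimum behind \<open>W2\<close> is finite and \<open>enn2real\<close> does
  not distort it.\<close>

lemma finite_cost_coupling:
  assumes M: "finite_second_moment M" and R: "finite (set_pmf R)"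
  shows "\<exists>\<gamma>\<in>couplings M (borel_pmf R). (\<integral>\<^sup>+p. ennreal ((norm (fst p - snd p))\<^sup>2) \<partial>\<gamma>) < \<infinity>"
proof -
  interpret M: prob_space M using M by (simp add: finite_second_moment_def)
  interpret R: prob_space "borel_pmf R" by (rule borel_pmf_prob_space)
  interpret MR: pair_prob_space M "borel_pmf R" ..
  have [measurable_cong]: "sets M = sets borel" using M by (simp add: finite_second_moment_def)
  let ?\<gamma> = "M \<Otimes>\<^sub>M borel_pmf R"
  have "distr ?\<gamma> borel fst = distr ?\<gamma> M fst"
    by (rule distr_cong) (auto simp: \<open>sets M = sets borel\<close>)
  then have 1: "distr ?\<gamma> borel fst = M" by (simp add: R.distr_pair_fst)
  have "distr ?\<gamma> borel snd = distr (distr (borel_pmf R \<Otimes>\<^sub>M M) ?\<gamma> (\<lambda>(x, y). (y, x))) borel snd"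
    by (subst MR.distr_pair_swap) simp
  also have "\<dots> = distr (borel_pmf R \<Otimes>\<^sub>M M) (borel_pmf R) fst"
    by (subst distr_distr) (auto simp: o_def case_prod_beta' intro!: distr_cong)
  finally have 2: "distr ?\<gamma> borel snd = borel_pmf R" by (simp add: M.distr_pair_fst)
  have \<gamma>: "?\<gamma> \<in> couplings M (borel_pmf R)"
    unfolding couplings_def using 1 2
    by (auto simp: MR.prob_space_axioms intro!: sets_pair_measure_cong \<open>sets M = sets borel\<close>)
  obtain B where B: "\<And>k. k \<in> set_pmf R \<Longrightarrow> (norm k)\<^sup>2 \<le> B" "0 \<le> B"
  proof
    show "(norm k)\<^sup>2 \<le> (\<Sum>k\<in>set_pmf R. (norm k)\<^sup>2)" if "k \<in> set_pmf R" for k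
      using R that by (intro member_le_sum) auto
  qed (simp add: sum_nonneg)
  have "(\<integral>\<^sup>+p. ennreal ((norm (fst p - snd p))\<^sup>2) \<partial>?\<gamma>) \<le>
      (\<integral>\<^sup>+p. ennreal (2 * (norm (fst p))\<^sup>2 + 2 * B) \<partial>?\<gamma>)"
    using couplings_AE_snd[OF \<gamma> R]
    by (intro nn_integral_mono_AE) (auto intro!: ennreal_leI order_trans[OF norm_diff_sq_le] B)
  also have "\<dots> = (\<integral>\<^sup>+u. ennreal (2 * (norm u)\<^sup>2 + 2 * B) \<partial>distr ?\<gamma> borel fst)"
    by (subst nn_integral_distr) auto
  also have "\<dots> = (\<integral>\<^sup>+u. ennreal (2 * (norm u)\<^sup>2 + 2 * B) \<partial>M)" by (simp add: 1)
  also have "\<dots> = ennreal (\<integral>u. 2 * (norm u)\<^sup>2 + 2 * B \<partial>M)"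
    using M B(2) by (intro nn_integral_eq_integral) (auto simp: finite_second_moment_def)
  also have "\<dots> < \<infinity>" by simp
  finally show ?thesis using \<gamma> by blast
qed

text \<open>A finite infimum lies strictly below itself plus \<epsilon>, which replaces the
  existence of an optimal coupling. The \<epsilon> disappears again when values of linear programs
  are compared.\<close>

lemma near_optimal_coupling:
  assumes M: "finite_second_moment M" and R: "finite (set_pmf R)" and "0 < \<epsilon>"
  shows "\<exists>\<gamma>\<in>couplings M (borel_pmf R).
    (\<integral>\<^sup>+p. ennreal ((norm (fst p - snd p))\<^sup>2) \<partial>\<gamma>) \<le> ennreal ((W2 M (borel_pmf R))\<^sup>2 + \<epsilon>)"
proof -
  let ?I = "INF \<gamma>\<in>couplings M (borel_pmf R). \<integral>\<^sup>+p. ennreal ((norm (fst p - snd p))\<^sup>2) \<partial>\<gamma>"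
  have "?I < \<infinity>" using finite_cost_coupling[OF M R] by (auto simp: INF_less_iff)
  then have "?I = ennreal ((W2 M (borel_pmf R))\<^sup>2)"
    unfolding W2_sq by simp
  also have "\<dots> < ennreal ((W2 M (borel_pmf R))\<^sup>2 + \<epsilon>)"
    using \<open>0 < \<epsilon>\<close> by (simp add: ennreal_less_iff)
  finally show ?thesis by (auto simp: INF_less_iff intro: less_imp_le)
qed

section \<open>Disintegration of couplings with a discrete measure\<close>

text \<open>
  Up to null sets, \<open>f k\<close> is the Radon-Nikodym derivative of \<open>A \<mapsto> \<gamma> (A \<times> {k})\<close>.
\<close>

lemma coupling_disintegration:
  fixes M :: "'a::euclidean_space measure"
  assumes M: "prob_space M" "sets M = sets borel" and R: "finite (set_pmf R)"
    and \<gamma>: "\<gamma> \<in> couplings M (borel_pmf R)"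
  shows "\<exists>f. (\<forall>k. f k \<in> borel_measurable borel) \<and> (\<forall>k u. 0 \<le> f k u) \<and>
    (\<forall>k u. k \<notin> set_pmf R \<longrightarrow> f k u = 0) \<and> (\<forall>u. (\<Sum>k\<in>set_pmf R. f k u) = 1) \<and>
    (\<forall>k\<in>set_pmf R. (\<integral>\<^sup>+u. ennreal (f k u) \<partial>M) = ennreal (pmf R k)) \<and>
    (\<Sum>k\<in>set_pmf R. \<integral>\<^sup>+u. ennreal ((norm (u - k))\<^sup>2 * f k u) \<partial>M) \<le>
      (\<integral>\<^sup>+p. ennreal ((norm (fst p - snd p))\<^sup>2) \<partial>\<gamma>)"
proof -
  interpret M: prob_space M by fact
  interpret G: prob_space \<gamma> using \<gamma> by (simp add: couplings_def)
  note [measurable_cong] = M(2)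
  have sets[measurable_cong]: "sets \<gamma> = sets (borel \<Otimes>\<^sub>M borel)"
    and fst: "distr \<gamma> borel fst = M" and snd: "distr \<gamma> borel snd = borel_pmf R"
    using \<gamma> by (auto simp: couplings_def)
  have AEsnd: "AE p in \<gamma>. snd p \<in> set_pmf R" by (rule couplings_AE_snd) fact+
  \<comment> \<open>The part of \<gamma> whose second coordinate is k, projected to the first
    coordinate. It is dominated by the first marginal M, so it has a density.\<close>
  define \<nu> where "\<nu> k = distr (density \<gamma> (\<lambda>p. indicator {k} (snd p))) borel fst" for k :: 'a
  have \<nu>: "(\<integral>\<^sup>+u. h u \<partial>\<nu> k) = (\<integral>\<^sup>+p. indicator {k} (snd p) * h (fst p) \<partial>\<gamma>)"
    if [measurable]: "h \<in> borel_measurable borel" for h k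
    unfolding \<nu>_def by (subst nn_integral_distr; (subst nn_integral_density)?) simp_all
  have sets_\<nu>: "sets (\<nu> k) = sets M" for k by (simp add: \<nu>_def M)
  have "absolutely_continuous M (\<nu> k)" for k
    unfolding absolutely_continuous_def
  proof
    fix A assume A: "A \<in> null_sets M"
    then have Ab[measurable]: "A \<in> sets borel" using M by (auto simp: null_sets_def)
    have "emeasure (\<nu> k) A = (\<integral>\<^sup>+p. indicator {k} (snd p) * indicator A (fst p) \<partial>\<gamma>)"
      using \<nu>[of "indicator A" k] by (simp add: sets_\<nu> M)
    also have "\<dots> \<le> (\<integral>\<^sup>+p. indicator A (fst p) \<partial>\<gamma>)"
      by (intro nn_integral_mono) (auto simp: indicator_def)
    also have "\<dots> = (\<integral>\<^sup>+u. indicator A u \<partial>distr \<gamma> borel fst)"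
      by (subst nn_integral_distr) simp_all
    also have "\<dots> = 0" using A by (simp add: fst M null_sets_def)
    finally show "A \<in> null_sets (\<nu> k)" by (simp add: null_sets_def sets_\<nu> M)
  qed
  then have "\<exists>g\<in>borel_measurable M. density M g = \<nu> k" for k
    by (rule M.Radon_Nikodym) (rule sets_\<nu>)
  then obtain g where gm: "\<And>k. g k \<in> borel_measurable M" and g: "\<And>k. density M (g k) = \<nu> k"
    by metis
  have [measurable]: "g k \<in> borel_measurable borel" for k
    using gm[of k] M(2) by (simp cong: measurable_cong_sets)
  have gint: "(\<integral>\<^sup>+u. g k u * h u \<partial>M) = (\<integral>\<^sup>+p. indicator {k} (snd p) * h (fst p) \<partial>\<gamma>)"
    if [measurable]: "h \<in> borel_measurable borel" for h k
    using \<nu>[OF that, of k] by (subst (asm) g[symmetric], subst (asm) nn_integral_density) simp_all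
  let ?K = "set_pmf R"
  have ind1: "(\<Sum>k\<in>?K. indicator {k} (q::'a)) = (1::ennreal)" if "q \<in> ?K" for q
    using R that by (simp add: indicator_def sum.delta')
  \<comment> \<open>The second coordinate lies in the support of R almost surely, so the measures
    \<nu> k add up to M; uniqueness of densities gives the sum 1 almost everywhere.\<close>
  have "density M (\<lambda>u. \<Sum>k\<in>?K. g k u) = density M (\<lambda>_. 1)"
  proof (rule measure_eqI)
    fix A assume "A \<in> sets (density M (\<lambda>u. \<Sum>k\<in>?K. g k u))"
    then have A[measurable]: "A \<in> sets borel" by (simp add: M)
    have "emeasure (density M (\<lambda>u. \<Sum>k\<in>?K. g k u)) A =
        (\<integral>\<^sup>+u. (\<Sum>k\<in>?K. g k u * indicator A u) \<partial>M)"
      using A by (subst emeasure_density) (simp_all add: M sum_distrib_right)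
    also have "\<dots> = (\<Sum>k\<in>?K. \<integral>\<^sup>+p. indicator {k} (snd p) * indicator A (fst p) \<partial>\<gamma>)"
      by (subst nn_integral_sum) (simp_all add: gint)
    also have "\<dots> = (\<integral>\<^sup>+p. (\<Sum>k\<in>?K. indicator {k} (snd p)) * indicator A (fst p) \<partial>\<gamma>)"
      by (subst nn_integral_sum[symmetric]) (simp_all add: sum_distrib_right)
    also have "\<dots> = (\<integral>\<^sup>+p. indicator A (fst p) \<partial>\<gamma>)"
      using AEsnd by (intro nn_integral_cong_AE) (auto simp: ind1)
    also have "\<dots> = (\<integral>\<^sup>+u. indicator A u \<partial>distr \<gamma> borel fst)"
      by (subst nn_integral_distr) simp_all
    finally show "emeasure (density M (\<lambda>u. \<Sum>k\<in>?K. g k u)) A = emeasure (density M (\<lambda>_. 1)) A"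
      by (simp add: fst M density_1)
  qed simp
  then have AE1: "AE u in M. (\<Sum>k\<in>?K. g k u) = 1"
    by (subst (asm) M.density_unique_iff) simp_all
  obtain k0 where k0: "k0 \<in> ?K" using set_pmf_not_empty[of R] by auto
  \<comment> \<open>On the null set where the densities do not sum to 1, all mass goes to the fixed
    point \<open>k0\<close>. The weights then sum to 1 at every u, as the later pointwise estimates
    require.\<close>
  define f where "f = (\<lambda>k u. if k \<notin> ?K then 0 else if (\<Sum>k\<in>?K. g k u) = 1 then enn2real (g k u)
    else if k = k0 then 1 else 0)"
  have fg: "ennreal (f k u) = g k u" if "(\<Sum>k\<in>?K. g k u) = 1" "k \<in> ?K" for k u
  proof -
    have "g k u \<le> (\<Sum>k\<in>?K. g k u)" using R that by (intro member_le_sum) auto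
    then have "g k u < \<infinity>" using that by (simp add: order_le_less_trans)
    then show ?thesis using that by (simp add: f_def)
  qed
  have fAE: "AE u in M. \<forall>k\<in>?K. ennreal (f k u) = g k u" using AE1 by eventually_elim (simp add: fg)
  have fm[measurable]: "f k \<in> borel_measurable borel" for k
    unfolding f_def by measurable
  have fn: "0 \<le> f k u" for k u by (simp add: f_def)
  have "(\<Sum>k\<in>?K. f k u) = 1" for u
  proof (cases "(\<Sum>k\<in>?K. g k u) = 1")
    case True
    then have "ennreal (\<Sum>k\<in>?K. f k u) = 1" by (simp add: sum_ennreal[symmetric] fn fg)
    then show ?thesis by (simp add: ennreal_eq_1)
  next
    case False
    then show ?thesis using R k0 by (simp add: f_def)
  qed
  moreover have "(\<integral>\<^sup>+u. ennreal (f k u) \<partial>M) = ennreal (pmf R k)" if k: "k \<in> ?K" for k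
  proof -
    have "(\<integral>\<^sup>+u. ennreal (f k u) \<partial>M) = (\<integral>\<^sup>+u. g k u * 1 \<partial>M)"
      using fAE k by (intro nn_integral_cong_AE) auto
    also have "\<dots> = (\<integral>\<^sup>+p. indicator {k} (snd p) \<partial>\<gamma>)"
      by (subst gint) simp_all
    also have "\<dots> = (\<integral>\<^sup>+q. indicator {k} q \<partial>distr \<gamma> borel snd)"
      by (subst nn_integral_distr) simp_all
    also have "\<dots> = emeasure (borel_pmf R) {k}" by (simp add: snd)
    also have "\<dots> = ennreal (pmf R k)"
      by (simp add: borel_pmf_def emeasure_distr emeasure_pmf_single)
    finally show ?thesis .
  qed
  moreover have "(\<Sum>k\<in>?K. \<integral>\<^sup>+u. ennreal ((norm (u - k))\<^sup>2 * f k u) \<partial>M) \<le>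
      (\<integral>\<^sup>+p. ennreal ((norm (fst p - snd p))\<^sup>2) \<partial>\<gamma>)"
  proof -
    have "(\<Sum>k\<in>?K. \<integral>\<^sup>+u. ennreal ((norm (u - k))\<^sup>2 * f k u) \<partial>M) =
        (\<Sum>k\<in>?K. \<integral>\<^sup>+u. g k u * ennreal ((norm (u - k))\<^sup>2) \<partial>M)"
      using fAE fn by (intro sum.cong nn_integral_cong_AE)
        (auto simp: ennreal_mult mult.commute elim!: eventually_mono)
    also have "\<dots> = (\<Sum>k\<in>?K. \<integral>\<^sup>+p. indicator {k} (snd p) * ennreal ((norm (fst p - k))\<^sup>2) \<partial>\<gamma>)"
      by (simp add: gint)
    also have "\<dots> = (\<integral>\<^sup>+p. (\<Sum>k\<in>?K. indicator {k} (snd p) * ennreal ((norm (fst p - k))\<^sup>2)) \<partial>\<gamma>)"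
      by (subst nn_integral_sum) simp_all
    also have "\<dots> \<le> (\<integral>\<^sup>+p. ennreal ((norm (fst p - snd p))\<^sup>2) \<partial>\<gamma>)"
    proof (intro nn_integral_mono)
      fix p :: "'a \<times> 'a"
      have "(\<Sum>k\<in>?K. indicator {k} (snd p) * ennreal ((norm (fst p - k))\<^sup>2)) =
          (\<Sum>k\<in>?K. if k = snd p then ennreal ((norm (fst p - snd p))\<^sup>2) else 0)"
        by (intro sum.cong) (auto simp: indicator_def)
      then show "(\<Sum>k\<in>?K. indicator {k} (snd p) * ennreal ((norm (fst p - k))\<^sup>2)) \<le>
          ennreal ((norm (fst p - snd p))\<^sup>2)" using R by simp
    qed
    finally show ?thesis .
  qed
  ultimately show ?thesis
    using fm fn by (intro exI[of _ f]) (auto simp: f_def)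
qed

lemma near_optimal_kernel:
  fixes M :: "'a::euclidean_space measure"
  assumes M: "finite_second_moment M" and R: "finite (set_pmf R)" and "0 < \<epsilon>"
  shows "\<exists>f. (\<forall>k. f k \<in> borel_measurable borel) \<and> (\<forall>k u. 0 \<le> f k u) \<and>
    (\<forall>k u. k \<notin> set_pmf R \<longrightarrow> f k u = 0) \<and> (\<forall>u. (\<Sum>k\<in>set_pmf R. f k u) = 1) \<and>
    (\<forall>k\<in>set_pmf R. (\<integral>u. f k u \<partial>M) = pmf R k) \<and>
    (\<Sum>k\<in>set_pmf R. \<integral>u. (norm (u - k))\<^sup>2 * f k u \<partial>M) \<le> (W2 M (borel_pmf R))\<^sup>2 + \<epsilon>"
proof -
  have prob: "prob_space M" and sets[measurable_cong]: "sets M = sets borel"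
    using M by (auto simp: finite_second_moment_def)
  interpret M: prob_space M by fact
  obtain \<gamma> where \<gamma>: "\<gamma> \<in> couplings M (borel_pmf R)"
    "(\<integral>\<^sup>+p. ennreal ((norm (fst p - snd p))\<^sup>2) \<partial>\<gamma>) \<le> ennreal ((W2 M (borel_pmf R))\<^sup>2 + \<epsilon>)"
    using near_optimal_coupling[OF M R \<open>0 < \<epsilon>\<close>] by blast
  from coupling_disintegration[OF prob sets R \<gamma>(1)] obtain f where
    fm: "\<And>k. f k \<in> borel_measurable borel" and fn: "\<And>k u. 0 \<le> f k u"
    and f0: "\<And>k u. k \<notin> set_pmf R \<Longrightarrow> f k u = 0" and f1: "\<And>u. (\<Sum>k\<in>set_pmf R. f k u) = 1"
    and fint: "\<And>k. k \<in> set_pmf R \<Longrightarrow> (\<integral>\<^sup>+u. ennreal (f k u) \<partial>M) = ennreal (pmf R k)"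
    and fcost: "(\<Sum>k\<in>set_pmf R. \<integral>\<^sup>+u. ennreal ((norm (u - k))\<^sup>2 * f k u) \<partial>M) \<le>
      (\<integral>\<^sup>+p. ennreal ((norm (fst p - snd p))\<^sup>2) \<partial>\<gamma>)" by blast
  note [measurable] = fm
  \<comment> \<open>Each summand is bounded by the whole cost, which is finite; this gives
    integrability and allows real integrals from here on.\<close>
  have eq: "(\<integral>\<^sup>+u. ennreal ((norm (u - k))\<^sup>2 * f k u) \<partial>M) = ennreal (\<integral>u. (norm (u - k))\<^sup>2 * f k u \<partial>M)"
    if k: "k \<in> set_pmf R" for k
  proof (rule nn_integral_eq_integral)
    have "(\<integral>\<^sup>+u. ennreal ((norm (u - k))\<^sup>2 * f k u) \<partial>M) \<le>
        (\<Sum>k\<in>set_pmf R. \<integral>\<^sup>+u. ennreal ((norm (u - k))\<^sup>2 * f k u) \<partial>M)"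
      using R k by (intro member_le_sum) auto
    also have "\<dots> \<le> ennreal ((W2 M (borel_pmf R))\<^sup>2 + \<epsilon>)" using fcost \<gamma>(2) by (rule order_trans)
    also have "\<dots> < \<infinity>" by simp
    finally show "integrable M (\<lambda>u. (norm (u - k))\<^sup>2 * f k u)"
      using fn by (intro integrableI_nonneg) auto
  qed (use fn in auto)
  have "ennreal (\<Sum>k\<in>set_pmf R. \<integral>u. (norm (u - k))\<^sup>2 * f k u \<partial>M) =
      (\<Sum>k\<in>set_pmf R. ennreal (\<integral>u. (norm (u - k))\<^sup>2 * f k u \<partial>M))"
    using fn by (intro sum_ennreal[symmetric]) auto
  also have "\<dots> = (\<Sum>k\<in>set_pmf R. \<integral>\<^sup>+u. ennreal ((norm (u - k))\<^sup>2 * f k u) \<partial>M)"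
    by (simp add: eq)
  also have "\<dots> \<le> ennreal ((W2 M (borel_pmf R))\<^sup>2 + \<epsilon>)" using fcost \<gamma>(2) by (rule order_trans)
  finally have "(\<Sum>k\<in>set_pmf R. \<integral>u. (norm (u - k))\<^sup>2 * f k u \<partial>M) \<le> (W2 M (borel_pmf R))\<^sup>2 + \<epsilon>"
    using \<open>0 < \<epsilon>\<close> by (subst (asm) ennreal_le_iff) (auto intro: add_nonneg_nonneg less_imp_le)
  moreover have "(\<integral>u. f k u \<partial>M) = pmf R k" if "k \<in> set_pmf R" for k
    using fint[OF that] fn by (subst integral_eq_nn_integral) auto
  ultimately show ?thesis using fm fn f0 f1 by (intro exI[of _ f]) auto
qed

lemma integral_borel_pmf:
  fixes h :: "'a::euclidean_space \<Rightarrow> real"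
  assumes "finite S" "set_pmf Q \<subseteq> S" and [measurable]: "h \<in> borel_measurable borel"
  shows "(\<integral>x. h x \<partial>borel_pmf Q) = (\<Sum>x\<in>S. h x * pmf Q x)"
  unfolding borel_pmf_def using assms
  by (subst integral_distr) (auto intro!: integral_measure_pmf_real)

text \<open>The double sum is twice the variance of the weights \<open>g\<close>.\<close>

lemma pairwise_sq_dist_le:
  fixes u :: "'a::real_inner"
  assumes g1: "(\<Sum>k\<in>K. g k) = 1"
  shows "(\<Sum>x\<in>K. \<Sum>k\<in>K. (norm (x - k))\<^sup>2 * (g x * g k)) \<le> 2 * (\<Sum>k\<in>K. (norm (u - k))\<^sup>2 * g k)"
proof -
  \<comment> \<open>The mean of the weights relative to \<open>u\<close>. The cross terms of the
    expansion sum to \<open>2 * (a \<bullet> a)\<close>, and discarding them passes from the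
    variance to the second moment about \<open>u\<close>.\<close>
  define a where "a = (\<Sum>k\<in>K. g k *\<^sub>R (k - u))"
  define v where "v = (\<Sum>k\<in>K. (norm (u - k))\<^sup>2 * g k)"
  have aa: "a \<bullet> a = (\<Sum>x\<in>K. \<Sum>k\<in>K. (g x *\<^sub>R (x - u)) \<bullet> (g k *\<^sub>R (k - u)))"
    unfolding a_def by (subst inner_sum_left, intro sum.cong refl, rule inner_sum_right)
  have "(norm (x - k))\<^sup>2 * (g x * g k) =
      ((norm (u - x))\<^sup>2 * g x) * g k + g x * ((norm (u - k))\<^sup>2 * g k) -
      2 * ((g x *\<^sub>R (x - u)) \<bullet> (g k *\<^sub>R (k - u)))" for x k
    by (simp add: power2_norm_eq_inner inner_simps inner_commute algebra_simps)
  then have "(\<Sum>x\<in>K. \<Sum>k\<in>K. (norm (x - k))\<^sup>2 * (g x * g k)) =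
      (\<Sum>x\<in>K. ((norm (u - x))\<^sup>2 * g x)) * (\<Sum>k\<in>K. g k) + (\<Sum>x\<in>K. g x) * (\<Sum>k\<in>K. (norm (u - k))\<^sup>2 * g k)
      - 2 * (a \<bullet> a)"
    by (simp add: sum_subtractf sum.distrib sum_product aa sum_distrib_left[symmetric])
  also have "\<dots> = 2 * v - 2 * (a \<bullet> a)" using g1 by (simp add: v_def)
  also have "\<dots> \<le> 2 * v" by simp
  finally show ?thesis by (simp add: v_def)
qed

section \<open>Comparison of \<open>phi\<close> with the costs of feasible solutions\<close>

context weighted_measures
begin

declare One_nat_def [simp del]

text \<open>For each i separately, a transport is a finite joint law of Q and \<open>P i\<close>,
  hence a coupling.\<close>

lemma phi_le_transport_cost:
  assumes Q: "finite (set_pmf Q)" and y: "is_transport N P Q y"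
  shows "phi N lam P (borel_pmf Q) \<le> cost (set_pmf Q) y"
  unfolding phi_def transport_cost_def
proof (intro sum_mono mult_left_mono)
  fix i assume i: "i \<in> {1..N}"
  show "0 \<le> lam i" using lam_pos[OF i] by simp
  let ?K = "set_pmf (P i)"
  let ?X = "set_pmf Q \<times> ?K"
  \<comment> \<open>A transport may have arbitrary values off the supports; they are cut off to
    obtain a probability mass function on all pairs.\<close>
  define f where "f = (\<lambda>(x, k). if (x, k) \<in> ?X then y i x k else 0)"
  have fin: "finite ?X" "finite ?K" using Q finite_supp[OF i] by auto
  have fn: "0 \<le> f p" for p
    using y i by (cases p) (simp add: f_def is_transport_def)
  have f1: "(\<Sum>k\<in>?K. f (x, k)) = pmf Q x" if "x \<in> set_pmf Q" for x
    using y i that by (simp add: f_def is_transport_def)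
  have f2: "(\<Sum>x\<in>set_pmf Q. f (x, k)) = pmf (P i) k" if "k \<in> ?K" for k
    using y i that by (simp add: f_def is_transport_def)
  have "(\<integral>\<^sup>+p. ennreal (f p) \<partial>count_space UNIV) = (\<Sum>p\<in>?X. ennreal (f p))"
    using fin fn by (intro nn_integral_count_space') (auto simp: f_def split: if_splits)
  also have "\<dots> = ennreal (\<Sum>x\<in>set_pmf Q. \<Sum>k\<in>?K. f (x, k))"
    using fn by (simp add: sum_ennreal sum.cartesian_product case_prod_beta')
  also have "\<dots> = 1" using f1 Q by (simp add: sum_pmf_eq_1)
  finally have f: "(\<integral>\<^sup>+p. ennreal (f p) \<partial>count_space UNIV) = 1" .
  define \<pi> where "\<pi> = embed_pmf f"
  have pmf: "pmf \<pi> p = f p" for p unfolding \<pi>_def using fn f by (rule pmf_embed_pmf)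
  have supp: "set_pmf \<pi> \<subseteq> ?X" by (auto simp: set_pmf_eq pmf f_def split: if_splits)
  have marg: "pmf (map_pmf h \<pi>) a = (\<Sum>p\<in>?X. if h p = a then f p else 0)" for h :: "'a \<times> 'a \<Rightarrow> 'a" and a
  proof -
    have "pmf (map_pmf h \<pi>) a = (\<integral>p. indicator {a} (h p) \<partial>measure_pmf \<pi>)"
    proof -
      have "(\<lambda>p. indicator {a} (h p) :: real) = indicator (h -` {a})" by (auto simp: indicator_def fun_eq_iff)
      then show ?thesis by (simp add: pmf_map)
    qed
    also have "\<dots> = (\<Sum>p\<in>?X. indicator {a} (h p) * pmf \<pi> p)"
      using fin supp by (intro integral_measure_pmf_real) auto
    also have "\<dots> = (\<Sum>p\<in>?X. if h p = a then f p else 0)"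
      by (intro sum.cong) (auto simp: pmf)
    finally show ?thesis .
  qed
  have "map_pmf fst \<pi> = Q"
  proof (rule pmf_eqI)
    fix a
    have "pmf (map_pmf fst \<pi>) a = (\<Sum>x\<in>set_pmf Q. \<Sum>k\<in>?K. if x = a then f (x, k) else 0)"
      unfolding marg sum.cartesian_product by (intro sum.cong) auto
    also have "\<dots> = (\<Sum>x\<in>set_pmf Q. if x = a then pmf Q a else 0)"
      by (intro sum.cong) (auto simp: f1)
    finally show "pmf (map_pmf fst \<pi>) a = pmf Q a" using Q by (simp add: set_pmf_eq)
  qed
  moreover have "map_pmf snd \<pi> = P i"
  proof (rule pmf_eqI)
    fix a
    have "pmf (map_pmf snd \<pi>) a = (\<Sum>x\<in>set_pmf Q. \<Sum>k\<in>?K. if k = a then f (x, k) else 0)"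
      unfolding marg sum.cartesian_product by (intro sum.cong) auto
    also have "\<dots> = (\<Sum>k\<in>?K. \<Sum>x\<in>set_pmf Q. if k = a then f (x, k) else 0)" by (rule sum.swap)
    also have "\<dots> = (\<Sum>k\<in>?K. if k = a then pmf (P i) a else 0)"
      by (intro sum.cong) (auto simp: f2)
    finally show "pmf (map_pmf snd \<pi>) a = pmf (P i) a" using fin by (simp add: set_pmf_eq)
  qed
  moreover have "(\<Sum>p\<in>set_pmf \<pi>. (norm (fst p - snd p))\<^sup>2 * pmf \<pi> p) =
      (\<Sum>x\<in>set_pmf Q. \<Sum>k\<in>?K. (norm (x - k))\<^sup>2 * y i x k)"
  proof -
    have "(\<Sum>p\<in>set_pmf \<pi>. (norm (fst p - snd p))\<^sup>2 * pmf \<pi> p) =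
        (\<Sum>p\<in>?X. (norm (fst p - snd p))\<^sup>2 * f p)"
      using fin supp by (intro sum.mono_neutral_cong_left) (auto simp: pmf set_pmf_eq)
    then show ?thesis
      by (simp add: sum.cartesian_product case_prod_beta' f_def mem_Times_iff)
  qed
  ultimately show "(W2 (borel_pmf Q) (borel_pmf (P i)))\<^sup>2 \<le>
      (\<Sum>x\<in>set_pmf Q. \<Sum>k\<in>?K. (norm (x - k))\<^sup>2 * y i x k)"
    using W2_map_pmf_le[of \<pi>] finite_subset[OF supp fin(1)] by simp
qed

text \<open>Since the weights sum to 1, an error of \<epsilon> in each squared distance amounts to
  \<epsilon> in \<open>phi\<close>.\<close>

lemma near_optimal_kernels:
  assumes M: "finite_second_moment M" and "0 < \<epsilon>"
  obtains f where "\<And>i k. i \<in> {1..N} \<Longrightarrow> f i k \<in> borel_measurable borel"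
    "\<And>i k u. i \<in> {1..N} \<Longrightarrow> 0 \<le> f i k u"
    "\<And>i k u. i \<in> {1..N} \<Longrightarrow> k \<notin> set_pmf (P i) \<Longrightarrow> f i k u = 0"
    "\<And>i u. i \<in> {1..N} \<Longrightarrow> (\<Sum>k\<in>set_pmf (P i). f i k u) = 1"
    "\<And>i k. i \<in> {1..N} \<Longrightarrow> k \<in> set_pmf (P i) \<Longrightarrow> (\<integral>u. f i k u \<partial>M) = pmf (P i) k"
    "(\<Sum>i\<in>{1..N}. lam i * (\<Sum>k\<in>set_pmf (P i). \<integral>u. (norm (u - k))\<^sup>2 * f i k u \<partial>M)) \<le>
      phi N lam P M + \<epsilon>"
proof -
  have "\<forall>i\<in>{1..N}. \<exists>f. (\<forall>k. f k \<in> borel_measurable borel) \<and> (\<forall>k u. 0 \<le> f k u) \<and>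
    (\<forall>k u. k \<notin> set_pmf (P i) \<longrightarrow> f k u = 0) \<and> (\<forall>u. (\<Sum>k\<in>set_pmf (P i). f k u) = 1) \<and>
    (\<forall>k\<in>set_pmf (P i). (\<integral>u. f k u \<partial>M) = pmf (P i) k) \<and>
    (\<Sum>k\<in>set_pmf (P i). \<integral>u. (norm (u - k))\<^sup>2 * f k u \<partial>M) \<le> (W2 M (borel_pmf (P i)))\<^sup>2 + \<epsilon>"
    using near_optimal_kernel[OF M finite_supp \<open>0 < \<epsilon>\<close>] by blast
  from bchoice[OF this] obtain f where f: "\<forall>i\<in>{1..N}. (\<forall>k. f i k \<in> borel_measurable borel) \<and>
    (\<forall>k u. 0 \<le> f i k u) \<and>
    (\<forall>k u. k \<notin> set_pmf (P i) \<longrightarrow> f i k u = 0) \<and> (\<forall>u. (\<Sum>k\<in>set_pmf (P i). f i k u) = 1) \<and>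
    (\<forall>k\<in>set_pmf (P i). (\<integral>u. f i k u \<partial>M) = pmf (P i) k) \<and>
    (\<Sum>k\<in>set_pmf (P i). \<integral>u. (norm (u - k))\<^sup>2 * f i k u \<partial>M) \<le> (W2 M (borel_pmf (P i)))\<^sup>2 + \<epsilon>" ..
  have "(\<Sum>i\<in>{1..N}. lam i * (\<Sum>k\<in>set_pmf (P i). \<integral>u. (norm (u - k))\<^sup>2 * f i k u \<partial>M)) \<le>
      (\<Sum>i\<in>{1..N}. lam i * ((W2 M (borel_pmf (P i)))\<^sup>2 + \<epsilon>))"
    using f lam_pos by (intro sum_mono mult_left_mono) (auto intro: less_imp_le)
  also have "\<dots> = phi N lam P M + \<epsilon>"
    by (simp add: phi_def algebra_simps sum.distrib sum_distrib_left[symmetric] lam_sum)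
  finally show ?thesis using that[of f] f by simp
qed

text \<open>Multiplied by the masses of Q, the kernels become the variables of the linear program at
  the same cost, because integrals against Q are finite sums over S.\<close>

lemma feasible_near_phi:
  assumes S: "finite S" "set_pmf Q \<subseteq> S" and "0 < \<epsilon>"
  shows "\<exists>z y. feasible S z y \<and> cost S y \<le> phi N lam P (borel_pmf Q) + \<epsilon>"
proof -
  have "finite_second_moment (borel_pmf Q)"
    using S finite_subset by (auto intro: finite_second_moment_borel_pmf)
  from near_optimal_kernels[OF this \<open>0 < \<epsilon>\<close>] obtain f where
    fm[measurable]: "\<And>i k. i \<in> {1..N} \<Longrightarrow> f i k \<in> borel_measurable borel" and
    f: "\<And>i k u. i \<in> {1..N} \<Longrightarrow> 0 \<le> f i k u"
    "\<And>i k u. i \<in> {1..N} \<Longrightarrow> k \<notin> set_pmf (P i) \<Longrightarrow> f i k u = 0"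
    "\<And>i u. i \<in> {1..N} \<Longrightarrow> (\<Sum>k\<in>set_pmf (P i). f i k u) = 1"
    "\<And>i k. i \<in> {1..N} \<Longrightarrow> k \<in> set_pmf (P i) \<Longrightarrow> (\<integral>u. f i k u \<partial>borel_pmf Q) = pmf (P i) k" and
    c: "(\<Sum>i\<in>{1..N}. lam i * (\<Sum>k\<in>set_pmf (P i). \<integral>u. (norm (u - k))\<^sup>2 * f i k u \<partial>borel_pmf Q)) \<le>
      phi N lam P (borel_pmf Q) + \<epsilon>" by blast
  define y where "y = (\<lambda>i x k. if i \<in> {1..N} then f i k x * pmf Q x else 0)"
  have Q0: "pmf Q x = 0" if "x \<notin> S" for x using that S by (auto simp: set_pmf_eq)
  have "feasible S (pmf Q) y"
    unfolding lp_feasible_def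
  proof (intro conjI ballI allI impI)
    show "(\<Sum>k\<in>set_pmf (P i). y i x k) = pmf Q x" if "i \<in> {1..N}" for i x
      using that by (simp add: y_def sum_distrib_right[symmetric] f)
    show "(\<Sum>x\<in>S. y i x k) = pmf (P i) k" if "i \<in> {1..N}" "k \<in> set_pmf (P i)" for i k
      using that f(4)[OF that] by (simp add: y_def integral_borel_pmf[OF S fm])
    show "y i x k = 0" if "\<not> (i \<in> {1..N} \<and> x \<in> S \<and> k \<in> set_pmf (P i))" for i x k
      using that f(2) Q0 by (auto simp: y_def)
  qed (use f Q0 in \<open>auto simp: y_def\<close>)
  moreover have "cost S y = (\<Sum>i\<in>{1..N}. lam i *
      (\<Sum>k\<in>set_pmf (P i). \<integral>u. (norm (u - k))\<^sup>2 * f i k u \<partial>borel_pmf Q))"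
    unfolding transport_cost_def
  proof (rule sum.cong[OF refl], rule arg_cong2[where f = "(*)", OF refl])
    fix i assume i: "i \<in> {1..N}"
    note [measurable] = fm[OF i]
    show "(\<Sum>x\<in>S. \<Sum>k\<in>set_pmf (P i). (norm (x - k))\<^sup>2 * y i x k) =
        (\<Sum>k\<in>set_pmf (P i). \<integral>u. (norm (u - k))\<^sup>2 * f i k u \<partial>borel_pmf Q)"
      using i by (subst sum.swap) (auto simp: integral_borel_pmf[OF S] y_def mult.assoc)
  qed
  ultimately show ?thesis using c by (intro exI[of _ "pmf Q"] exI[of _ y]) simp
qed

text \<open>
  For a point \<open>u\<close> of the support of \<open>M\<close>, let \<open>g x u\<close> be the mixture of the kernels.  Sending the
  mass \<open>g x u\<close> to the kernels independently is feasible, and costs at most twice as much as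
  starting from \<open>u\<close> itself.
\<close>

lemma feasible_two_phi:
  assumes M: "finite_second_moment M" and "0 < \<epsilon>"
  shows "\<exists>z y. feasible (\<Union>i\<in>{1..N}. set_pmf (P i)) z y \<and>
    cost (\<Union>i\<in>{1..N}. set_pmf (P i)) y \<le> 2 * (phi N lam P M + \<epsilon>)"
proof -
  let ?S = "\<Union>i\<in>{1..N}. set_pmf (P i)"
  have S: "finite ?S" using finite_supp by auto
  have prob: "prob_space M" and sets[measurable_cong]: "sets M = sets borel"
    and int2: "integrable M (\<lambda>x. (norm x)\<^sup>2)"
    using M by (auto simp: finite_second_moment_def)
  interpret M: prob_space M by fact
  from near_optimal_kernels[OF M \<open>0 < \<epsilon>\<close>] obtain f where
    fm[measurable]: "\<And>i k. i \<in> {1..N} \<Longrightarrow> f i k \<in> borel_measurable borel" and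
    fn: "\<And>i k u. i \<in> {1..N} \<Longrightarrow> 0 \<le> f i k u" and
    f0: "\<And>i k u. i \<in> {1..N} \<Longrightarrow> k \<notin> set_pmf (P i) \<Longrightarrow> f i k u = 0" and
    f1: "\<And>i u. i \<in> {1..N} \<Longrightarrow> (\<Sum>k\<in>set_pmf (P i). f i k u) = 1" and
    fi: "\<And>i k. i \<in> {1..N} \<Longrightarrow> k \<in> set_pmf (P i) \<Longrightarrow> (\<integral>u. f i k u \<partial>M) = pmf (P i) k" and
    c: "(\<Sum>i\<in>{1..N}. lam i * (\<Sum>k\<in>set_pmf (P i). \<integral>u. (norm (u - k))\<^sup>2 * f i k u \<partial>M)) \<le>
      phi N lam P M + \<epsilon>" by blast
  have fS: "(\<Sum>k\<in>?S. f i k u) = 1" if i: "i \<in> {1..N}" for i u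
    using f1[OF i] f0[OF i] S i by (subst sum.mono_neutral_right[of ?S "set_pmf (P i)"]) auto
  have fle: "f i k u \<le> 1" if i: "i \<in> {1..N}" for i k u
    using f1[OF i, of u] member_le_sum[of k "set_pmf (P i)" "\<lambda>k. f i k u"] fn[OF i] f0[OF i]
      finite_supp[OF i] by (cases "k \<in> set_pmf (P i)") auto
  define g where "g = (\<lambda>x u. \<Sum>i\<in>{1..N}. lam i * f i x u)"
  have gm[measurable]: "g x \<in> borel_measurable borel" for x unfolding g_def by measurable
  have gn: "0 \<le> g x u" for x u
    unfolding g_def using fn lam_pos by (intro sum_nonneg mult_nonneg_nonneg) (auto intro: less_imp_le)
  have g1: "(\<Sum>x\<in>?S. g x u) = 1" for u
    unfolding g_def by (subst sum.swap) (simp add: sum_distrib_left[symmetric] fS lam_sum)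
  have gle: "g x u \<le> 1" for x u
  proof -
    have "g x u \<le> (\<Sum>i\<in>{1..N}. lam i * 1)"
      unfolding g_def using fle lam_pos by (intro sum_mono mult_left_mono) (auto intro: less_imp_le)
    then show ?thesis using lam_sum by simp
  qed
  have int_bdd: "integrable M h" if [measurable]: "h \<in> borel_measurable borel"
    and "\<And>u. 0 \<le> h u" "\<And>u. h u \<le> 1" for h :: "'a \<Rightarrow> real"
    using that by (intro M.integrable_const_bound[of _ 1]) auto
  have int_norm: "integrable M (\<lambda>u. (norm (u - k))\<^sup>2 * h u)" if [measurable]: "h \<in> borel_measurable borel"
    and h: "\<And>u. 0 \<le> h u" "\<And>u. h u \<le> 1" for h :: "'a \<Rightarrow> real" and k
  proof (rule Bochner_Integration.integrable_bound)
    show "integrable M (\<lambda>u. 2 * (norm u)\<^sup>2 + 2 * (norm k)\<^sup>2)" using int2 by simp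
    show "AE u in M. norm ((norm (u - k))\<^sup>2 * h u) \<le> norm (2 * (norm u)\<^sup>2 + 2 * (norm k)\<^sup>2)"
    proof (intro AE_I2)
      fix u
      have "(norm (u - k))\<^sup>2 * h u \<le> (norm (u - k))\<^sup>2 * 1" by (intro mult_left_mono h) simp
      also have "\<dots> \<le> 2 * (norm u)\<^sup>2 + 2 * (norm k)\<^sup>2" using norm_diff_sq_le[of u k] by simp
      finally show "norm ((norm (u - k))\<^sup>2 * h u) \<le> norm (2 * (norm u)\<^sup>2 + 2 * (norm k)\<^sup>2)"
        using h by simp
    qed
  qed simp
  define z where "z = (\<lambda>x. if x \<in> ?S then \<integral>u. g x u \<partial>M else 0)"
  define y where "y = (\<lambda>i x k. if i \<in> {1..N} \<and> x \<in> ?S then \<integral>u. g x u * f i k u \<partial>M else 0)"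
  have int_gf: "integrable M (\<lambda>u. g x u * f i k u)" if i: "i \<in> {1..N}" for i x k
    using fm[OF i] gn gle fn[OF i] fle[OF i] by (intro int_bdd) (auto intro: mult_le_one)
  have "feasible ?S z y"
    unfolding lp_feasible_def
  proof (intro conjI ballI allI impI)
    show "(\<Sum>k\<in>set_pmf (P i). y i x k) = z x" if "i \<in> {1..N}" "x \<in> ?S" for i x
      using that int_gf f1
      by (simp add: y_def z_def Bochner_Integration.integral_sum[symmetric] sum_distrib_left[symmetric])
    show "(\<Sum>x\<in>?S. y i x k) = pmf (P i) k" if "i \<in> {1..N}" "k \<in> set_pmf (P i)" for i k
      using that int_gf g1 fi
      by (simp add: y_def Bochner_Integration.integral_sum[symmetric] sum_distrib_right[symmetric])
    show "y i x k = 0" if "\<not> (i \<in> {1..N} \<and> x \<in> ?S \<and> k \<in> set_pmf (P i))" for i x k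
      using that f0 by (auto simp: y_def)
    show "0 \<le> y i x k" for i x k using gn fn by (auto simp: y_def intro!: integral_nonneg_AE)
  qed (auto simp: z_def)
  moreover have "cost ?S y \<le> 2 * (phi N lam P M + \<epsilon>)"
  proof -
    have int_gg: "integrable M (\<lambda>u. (norm (x - k))\<^sup>2 * (g x u * g k u))" for x k
      using gn gle by (intro integrable_mult_right int_bdd) (auto intro: mult_le_one)
    have int_ug: "integrable M (\<lambda>u. (norm (u - k))\<^sup>2 * g k u)" for k
      using gn gle by (intro int_norm) auto
    \<comment> \<open>Once the inner sums run over all of \<open>?S\<close>, the index i can be
      summed first, which turns the weighted kernels into the mixture \<open>g\<close>. The cost
      becomes the expected squared distance of two independent samples of \<open>g\<close>, and this
      symmetry yields the factor 2.\<close>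
    have "cost ?S y = (\<Sum>i\<in>{1..N}. lam i * (\<Sum>x\<in>?S. \<Sum>k\<in>?S. (norm (x - k))\<^sup>2 * y i x k))"
      unfolding transport_cost_def
    proof (rule sum.cong[OF refl], rule arg_cong2[where f = "(*)", OF refl], rule sum.cong[OF refl])
      fix i x assume i: "i \<in> {1..N}" and x: "x \<in> ?S"
      show "(\<Sum>k\<in>set_pmf (P i). (norm (x - k))\<^sup>2 * y i x k) = (\<Sum>k\<in>?S. (norm (x - k))\<^sup>2 * y i x k)"
        using S i f0[OF i] by (intro sum.mono_neutral_left) (auto simp: y_def)
    qed
    also have "\<dots> = (\<Sum>x\<in>?S. \<Sum>i\<in>{1..N}. \<Sum>k\<in>?S. (norm (x - k))\<^sup>2 * (lam i * y i x k))"
      by (subst sum.swap) (simp add: sum_distrib_left mult.left_commute)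
    also have "\<dots> = (\<Sum>x\<in>?S. \<Sum>k\<in>?S. \<Sum>i\<in>{1..N}. (norm (x - k))\<^sup>2 * (lam i * y i x k))"
      by (intro sum.cong refl sum.swap)
    also have "\<dots> = (\<Sum>x\<in>?S. \<Sum>k\<in>?S. (norm (x - k))\<^sup>2 * (\<Sum>i\<in>{1..N}. lam i * y i x k))"
      by (simp add: sum_distrib_left)
    also have "\<dots> = (\<Sum>x\<in>?S. \<Sum>k\<in>?S. \<integral>u. (norm (x - k))\<^sup>2 * (g x u * g k u) \<partial>M)"
    proof (intro sum.cong refl)
      fix x k assume x: "x \<in> ?S"
      have "(\<Sum>i\<in>{1..N}. lam i * y i x k) = (\<Sum>i\<in>{1..N}. \<integral>u. lam i * (g x u * f i k u) \<partial>M)"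
        using x by (simp add: y_def)
      also have "\<dots> = (\<integral>u. (\<Sum>i\<in>{1..N}. lam i * (g x u * f i k u)) \<partial>M)"
        using int_gf by (subst Bochner_Integration.integral_sum) auto
      also have "\<dots> = (\<integral>u. g x u * g k u \<partial>M)"
        unfolding fun_cong[OF g_def, of k] by (simp add: sum_distrib_left mult.left_commute)
      finally show "(norm (x - k))\<^sup>2 * (\<Sum>i\<in>{1..N}. lam i * y i x k) =
          (\<integral>u. (norm (x - k))\<^sup>2 * (g x u * g k u) \<partial>M)" by simp
    qed
    also have "\<dots> = (\<integral>u. (\<Sum>x\<in>?S. \<Sum>k\<in>?S. (norm (x - k))\<^sup>2 * (g x u * g k u)) \<partial>M)"
      using int_gg by (simp add: Bochner_Integration.integral_sum)
    also have "\<dots> \<le> (\<integral>u. 2 * (\<Sum>k\<in>?S. (norm (u - k))\<^sup>2 * g k u) \<partial>M)"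
      using int_gg int_ug g1
      by (intro integral_mono Bochner_Integration.integrable_sum integrable_mult_right
          pairwise_sq_dist_le) auto
    also have "\<dots> = 2 * (\<Sum>k\<in>?S. \<integral>u. (norm (u - k))\<^sup>2 * g k u \<partial>M)"
      using int_ug by (simp add: Bochner_Integration.integral_sum)
    also have "(\<Sum>k\<in>?S. \<integral>u. (norm (u - k))\<^sup>2 * g k u \<partial>M) =
        (\<Sum>k\<in>?S. \<Sum>i\<in>{1..N}. lam i * (\<integral>u. (norm (u - k))\<^sup>2 * f i k u \<partial>M))"
    proof (intro sum.cong refl)
      fix k
      have i: "integrable M (\<lambda>u. (norm (u - k))\<^sup>2 * f i k u)" if "i \<in> {1..N}" for i
        using fm fn fle that by (intro int_norm) auto
      have "(\<integral>u. (norm (u - k))\<^sup>2 * g k u \<partial>M) =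
          (\<integral>u. (\<Sum>i\<in>{1..N}. lam i * ((norm (u - k))\<^sup>2 * f i k u)) \<partial>M)"
        by (simp add: g_def sum_distrib_left mult.left_commute)
      also have "\<dots> = (\<Sum>i\<in>{1..N}. lam i * (\<integral>u. (norm (u - k))\<^sup>2 * f i k u \<partial>M))"
        using i by (subst Bochner_Integration.integral_sum) auto
      finally show "(\<integral>u. (norm (u - k))\<^sup>2 * g k u \<partial>M) =
          (\<Sum>i\<in>{1..N}. lam i * (\<integral>u. (norm (u - k))\<^sup>2 * f i k u \<partial>M))" .
    qed
    also have "\<dots> = (\<Sum>i\<in>{1..N}. lam i * (\<Sum>k\<in>?S. \<integral>u. (norm (u - k))\<^sup>2 * f i k u \<partial>M))"
      by (subst sum.swap) (simp add: sum_distrib_left)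
    also have "\<dots> = (\<Sum>i\<in>{1..N}. lam i * (\<Sum>k\<in>set_pmf (P i). \<integral>u. (norm (u - k))\<^sup>2 * f i k u \<partial>M))"
    proof (rule sum.cong[OF refl], rule arg_cong2[where f = "(*)", OF refl])
      fix i assume i: "i \<in> {1..N}"
      show "(\<Sum>k\<in>?S. \<integral>u. (norm (u - k))\<^sup>2 * f i k u \<partial>M) =
          (\<Sum>k\<in>set_pmf (P i). \<integral>u. (norm (u - k))\<^sup>2 * f i k u \<partial>M)"
        using S i f0[OF i] by (intro sum.mono_neutral_right) auto
    qed
    finally show ?thesis using c by simp
  qed
  ultimately show ?thesis by blast
qed

end

section \<open>The lexicographic order\<close>

text \<open>The positive cone of the order. Comparisons become statements about differences, and
  compatibility with weighted means becomes closure of the cone under addition and positive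
  scaling.\<close>

definition lex_pos :: "real ^ 'd::{finite,linorder} \<Rightarrow> bool" where
  "lex_pos v \<longleftrightarrow> (\<exists>a. 0 < v $ a \<and> (\<forall>b<a. v $ b = 0))"

lemma lex_less_iff_pos: "lex_less u v \<longleftrightarrow> lex_pos (v - u)"
proof -
  have "(u $ a < v $ a \<and> (\<forall>b<a. u $ b = v $ b)) = (0 < (v - u) $ a \<and> (\<forall>b<a. (v - u) $ b = 0))" for a
    by auto
  then show ?thesis by (simp only: lex_less_def lex_pos_def)
qed

lemma lex_pos_scaleR:
  assumes "0 < c" "lex_pos v"
  shows "lex_pos (c *\<^sub>R v)"
proof -
  obtain a where "0 < v $ a" "\<forall>b<a. v $ b = 0" using assms by (auto simp: lex_pos_def)
  then have "0 < (c *\<^sub>R v) $ a \<and> (\<forall>b<a. (c *\<^sub>R v) $ b = 0)" using assms by simp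
  then show ?thesis unfolding lex_pos_def by blast
qed

lemma lex_pos_add:
  assumes "lex_pos u" "lex_pos v"
  shows "lex_pos (u + v)"
proof -
  obtain a b where a: "0 < u $ a" "\<forall>c<a. u $ c = 0" and b: "0 < v $ b" "\<forall>c<b. v $ c = 0"
    using assms by (auto simp: lex_pos_def)
  have "0 < (u + v) $ min a b \<and> (\<forall>c<min a b. (u + v) $ c = 0)"
    using a b by (cases a b rule: linorder_cases) auto
  then show ?thesis unfolding lex_pos_def by blast
qed

lemma lex_pos_total:
  fixes v :: "real ^ 'd::{finite,linorder}"
  assumes "v \<noteq> 0"
  shows "lex_pos v \<or> lex_pos (- v)"
proof -
  let ?A = "{a. v $ a \<noteq> 0}"
  define a where "a = Min ?A"
  have ne: "?A \<noteq> {}" using assms by (auto simp: vec_eq_iff)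
  have "a \<in> ?A" unfolding a_def by (rule Min_in) (use ne in auto)
  moreover have "v $ b = 0" if "b < a" for b
  proof (rule ccontr)
    assume "v $ b \<noteq> 0"
    then have "a \<le> b" unfolding a_def by (intro Min_le) auto
    with that show False by simp
  qed
  ultimately show ?thesis
    unfolding lex_pos_def by (cases "0 < v $ a") (auto intro!: exI[of _ a])
qed

lemma lex_less_irrefl: "\<not> lex_less v v"
  by (simp add: lex_less_def)

lemma lex_less_trans:
  assumes "lex_less u v" "lex_less v w"
  shows "lex_less u w"
proof -
  have "lex_pos ((v - u) + (w - v))" using assms by (intro lex_pos_add) (simp_all only: lex_less_iff_pos)
  moreover have "(v - u) + (w - v) = w - u" by simp
  ultimately show ?thesis by (simp only: lex_less_iff_pos)
qed

lemma lex_less_total: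
  assumes "u \<noteq> v"
  shows "lex_less u v \<or> lex_less v u"
proof -
  have "v - u \<noteq> 0" using assms by simp
  from lex_pos_total[OF this] show ?thesis unfolding lex_less_iff_pos by (simp only: minus_diff_eq)
qed

lemma lex_maximal_exists:
  "finite A \<Longrightarrow> A \<noteq> {} \<Longrightarrow> \<exists>v. lex_maximal A v"
proof (induction A rule: finite_ne_induct)
  case (singleton x)
  have "lex_maximal {x} x" by (simp add: lex_maximal_def)
  then show ?case ..
next
  case (insert x A)
  then obtain v where v: "lex_maximal A v" by blast
  show ?case
  proof (cases "x = v \<or> lex_less x v")
    case True
    with v have "lex_maximal (insert x A) v" by (auto simp: lex_maximal_def)
    then show ?thesis ..
  next
    case False
    then have less: "lex_less v x" using lex_less_total[of x v] by auto
    have "lex_less u x" if "u \<in> A" for u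
      using v that less lex_less_trans[OF _ less] by (cases "u = v") (auto simp: lex_maximal_def)
    then have "lex_maximal (insert x A) x" by (auto simp: lex_maximal_def)
    then show ?thesis ..
  qed
qed

text \<open>No cancellation is possible inside the cone: one nonzero summand already makes the sum
  positive.\<close>

lemma lex_pos_sum:
  assumes "finite I" "\<And>i. i \<in> I \<Longrightarrow> w i = 0 \<or> lex_pos (w i)"
  shows "(\<forall>i\<in>I. w i = 0) \<or> lex_pos (\<Sum>i\<in>I. w i)"
  using assms
proof (induction I rule: finite_induct)
  case (insert i I)
  then have IH: "(\<forall>i\<in>I. w i = 0) \<or> lex_pos (\<Sum>i\<in>I. w i)" by blast
  from insert.prems[of i] have "w i = 0 \<or> lex_pos (w i)" by simp
  with IH show ?case using insert.hyps lex_pos_add[of "w i" "\<Sum>i\<in>I. w i"] by auto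
qed simp


section \<open>Invariants of the local improvement\<close>

lemma add_mass_apply:
  "add_mass N l q e m l' i x = m l' i x + (if l' = l \<and> i \<in> {1..N} \<and> x = q i then e else 0)"
  by (simp add: add_mass_def)

lemma mean_point_cong: "(\<And>i. i \<in> {1..N} \<Longrightarrow> q i = q' i) \<Longrightarrow> mean_point N lam q = mean_point N lam q'"
  by (simp add: mean_point_def)

text \<open>The first entry ranks the phases; the next ones follow the loops over l and j. The last
  counts the points of positive mass in the active partial measures, one of which is used up by
  every move or extraction.\<close>

fun alg2_measure :: "nat \<Rightarrow> nat \<Rightarrow> 'a alg2_state \<Rightarrow> nat \<times> nat \<times> nat \<times> nat" where
  "alg2_measure N r (Step2 l j d m) = (3, l, l - j, \<Sum>i\<in>{1..N}. card (mass_supp (m l i)))"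
| "alg2_measure N r (Step3 l d m b) = (2, Suc r - l, 0, \<Sum>i\<in>{1..N}. card (mass_supp (m l i)))"
| "alg2_measure N r (Step4 w) = (1, 0, 0, 0)"

definition lex4 :: "((nat \<times> nat \<times> nat \<times> nat) \<times> (nat \<times> nat \<times> nat \<times> nat)) set" where
  "lex4 = less_than <*lex*> less_than <*lex*> less_than <*lex*> less_than"

context weighted_measures
begin

text \<open>The parallel axis identity: the weights sum to 1, so the weighted deviations from the
  mean cancel and with them the cross terms.\<close>

lemma sum_sq_dist_mean_point:
  "(\<Sum>i\<in>{1..N}. lam i * (norm (u - q i))\<^sup>2) =
   (\<Sum>i\<in>{1..N}. lam i * (norm (mean_point N lam q - q i))\<^sup>2) + (norm (u - mean_point N lam q))\<^sup>2"
proof -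
  define c where "c = mean_point N lam q"
  have "(\<Sum>i\<in>{1..N}. lam i *\<^sub>R (c - q i)) = (\<Sum>i\<in>{1..N}. lam i) *\<^sub>R c - c"
    by (simp add: c_def mean_point_def scaleR_diff_right sum_subtractf scaleR_left.sum)
  then have "(\<Sum>i\<in>{1..N}. lam i *\<^sub>R (c - q i)) = 0" by (simp add: lam_sum)
  then have 0: "(\<Sum>i\<in>{1..N}. lam i * ((u - c) \<bullet> (c - q i))) = 0"
    using inner_sum_right[of "u - c" "\<lambda>i. lam i *\<^sub>R (c - q i)" "{1..N}"] by simp
  have eq: "(norm (u - q i))\<^sup>2 = (norm (c - q i))\<^sup>2 + 2 * ((u - c) \<bullet> (c - q i)) + (norm (u - c))\<^sup>2" for i
    by (simp add: power2_norm_eq_inner inner_simps inner_commute)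
  have "(\<Sum>i\<in>{1..N}. lam i * (norm (u - q i))\<^sup>2) =
      (\<Sum>i\<in>{1..N}. lam i * (norm (c - q i))\<^sup>2 + 2 * (lam i * ((u - c) \<bullet> (c - q i))) + lam i * (norm (u - c))\<^sup>2)"
    by (intro sum.cong refl) (simp only: eq distrib_left mult.left_commute)
  also have "\<dots> =
      (\<Sum>i\<in>{1..N}. lam i * (norm (c - q i))\<^sup>2) + 2 * (\<Sum>i\<in>{1..N}. lam i * ((u - c) \<bullet> (c - q i)))
      + (\<Sum>i\<in>{1..N}. lam i) * (norm (u - c))\<^sup>2"
    by (simp only: sum.distrib sum_distrib_left sum_distrib_right)
  finally show ?thesis using 0 by (simp add: lam_sum c_def)
qed

lemma d_min_pos: "(\<And>i. i \<in> {1..N} \<Longrightarrow> 0 < m l i (q i)) \<Longrightarrow> 0 < d_min N m l q"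
  unfolding d_min_def using N_pos by (subst Min_gr_iff) auto

lemma d_min_le: "i \<in> {1..N} \<Longrightarrow> d_min N m l q \<le> m l i (q i)"
  unfolding d_min_def by (intro Min_le) auto

lemma d_min_attained: "\<exists>i\<in>{1..N}. d_min N m l q = m l i (q i)"
proof -
  have "d_min N m l q \<in> (\<lambda>i. m l i (q i)) ` {1..N}"
    unfolding d_min_def using N_pos by (intro Min_in) auto
  then show ?thesis by auto
qed

lemma weighted_means_mean_point:
  "\<forall>i\<in>{1..N}. q i \<in> set_pmf (P i) \<Longrightarrow> mean_point N lam q \<in> weighted_means N lam P"
  by (auto simp: weighted_means_def mean_point_def)

lemma finite_weighted_means: "finite (weighted_means N lam P)"
proof -
  have "weighted_means N lam P \<subseteq> mean_point N lam ` (PiE {1..N} (\<lambda>i. set_pmf (P i)))"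
  proof
    fix v assume "v \<in> weighted_means N lam P"
    then obtain x where x: "v = mean_point N lam x" "\<forall>i\<in>{1..N}. x i \<in> set_pmf (P i)"
      by (auto simp: weighted_means_def mean_point_def)
    then have "v = mean_point N lam (restrict x {1..N})" by (simp add: mean_point_def)
    moreover have "restrict x {1..N} \<in> PiE {1..N} (\<lambda>i. set_pmf (P i))" using x by auto
    ultimately show "v \<in> mean_point N lam ` (PiE {1..N} (\<lambda>i. set_pmf (P i)))" by blast
  qed
  moreover have "finite (PiE {1..N} (\<lambda>i. set_pmf (P i)))" using finite_supp by (intro finite_PiE) auto
  ultimately show ?thesis using finite_surj by blast
qed

end

locale lex_measures = weighted_measures P lam N
  for P :: "nat \<Rightarrow> (real ^ 'd::{finite,linorder}) pmf" and lam N
begin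

text \<open>Positive weights preserve the strict inequality at any index where the tuples differ.
  This is what makes the means of successive extractions strictly decreasing.\<close>

lemma lex_less_mean_point:
  assumes "\<And>i. i \<in> {1..N} \<Longrightarrow> u i = v i \<or> lex_less (u i) (v i)" and "\<exists>i\<in>{1..N}. u i \<noteq> v i"
  shows "lex_less (mean_point N lam u) (mean_point N lam v)"
proof -
  let ?w = "\<lambda>i. lam i *\<^sub>R (v i - u i)"
  have "?w i = 0 \<or> lex_pos (?w i)" if "i \<in> {1..N}" for i
    using assms(1)[OF that] lam_pos[OF that] by (auto simp: lex_less_iff_pos lex_pos_scaleR)
  then have "(\<forall>i\<in>{1..N}. ?w i = 0) \<or> lex_pos (\<Sum>i\<in>{1..N}. ?w i)" by (intro lex_pos_sum) auto
  moreover have "\<not> (\<forall>i\<in>{1..N}. ?w i = 0)" using assms(2) lam_pos by fastforce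
  ultimately have "lex_pos (\<Sum>i\<in>{1..N}. ?w i)" by blast
  moreover have "(\<Sum>i\<in>{1..N}. ?w i) = mean_point N lam v - mean_point N lam u"
    by (simp add: mean_point_def scaleR_diff_right sum_subtractf)
  ultimately show ?thesis by (simp only: lex_less_iff_pos)
qed

end

section \<open>Invariants of one run of the local improvement\<close>

locale alg2_input = lex_measures P lam N
  for P :: "nat \<Rightarrow> (real ^ 'd::{finite,linorder}) pmf" and lam N +
  fixes S :: "(real ^ 'd::{finite,linorder}) set" and z y and s :: "nat \<Rightarrow> real ^ 'd::{finite,linorder}" and r :: nat
  assumes finite_S: "finite S" and feasible_zy: "feasible S z y"
    and bij_s: "bij_betw s {1..r} (mass_supp z)"
begin

definition partial_masses :: "(nat \<Rightarrow> real) \<Rightarrow> (nat \<Rightarrow> nat \<Rightarrow> real ^ 'd::{finite,linorder} \<Rightarrow> real) \<Rightarrow> bool" where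
  "partial_masses d m \<longleftrightarrow> (\<forall>l\<in>{1..r}. \<forall>i\<in>{1..N}. (\<forall>x. 0 \<le> m l i x) \<and>
     (\<forall>x. x \<notin> set_pmf (P i) \<longrightarrow> m l i x = 0) \<and> (\<Sum>x\<in>set_pmf (P i). m l i x) = d l)"

definition pcost :: "(nat \<Rightarrow> nat \<Rightarrow> real ^ 'd::{finite,linorder} \<Rightarrow> real) \<Rightarrow> real" where
  "pcost m = (\<Sum>l\<in>{1..r}. \<Sum>i\<in>{1..N}. lam i * (\<Sum>x\<in>set_pmf (P i). (norm (s l - x))\<^sup>2 * m l i x))"

text \<open>
  If \<open>Step2\<close> has moved anything, then the last tuple moved belongs to a partial measure whose point
  \<open>s j\<close> is not the mean of the tuple, as that mean is equidistant from \<open>s j\<close> and some other \<open>s l\<close>.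
\<close>

definition step2_good :: "(nat \<Rightarrow> real) \<Rightarrow> (nat \<Rightarrow> nat \<Rightarrow> real ^ 'd::{finite,linorder} \<Rightarrow> real) \<Rightarrow> bool" where
  "step2_good d m \<longleftrightarrow> partial_masses d m \<and>
     (\<forall>i\<in>{1..N}. \<forall>x. (\<Sum>l\<in>{1..r}. m l i x) = pmf (P i) x) \<and> pcost m = cost S y \<and>
     ((\<forall>l\<in>{1..r}. d l = z (s l)) \<or>
      (\<exists>j\<in>{1..r}. \<exists>q. (\<forall>i\<in>{1..N}. 0 < m j i (q i)) \<and> mean_point N lam q \<noteq> s j))"

text \<open>
  \<open>K l c\<close> is the tuple extracted from the \<open>l\<close>-th partial measures with mean \<open>c\<close>; it is unique
  because the extracted means decrease lexicographically.
\<close>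

definition extraction where
  "extraction m0 K m b \<longleftrightarrow> (\<forall>l\<in>{1..r}. (\<forall>c. (0::real) \<le> b l c) \<and>
     (\<forall>c. 0 < b l c \<longrightarrow> (\<forall>i\<in>{1..N}. K l c i \<in> set_pmf (P i)) \<and> mean_point N lam (K l c) = c \<and>
        (\<forall>q. (\<forall>i\<in>{1..N}. 0 < m l i (q i)) \<longrightarrow> lex_less (mean_point N lam q) c)) \<and>
     (\<forall>i\<in>{1..N}. \<forall>x. m l i x +
        (\<Sum>c\<in>weighted_means N lam P. if K l c i = x then b l c else 0) = m0 l i x))"

text \<open>A dichotomy: strict progress, which drives termination, or a stationary output certified
  as unsplit by the choice function \<open>k\<close>. Feasibility is stated over the support of
  \<open>w\<close>, since its points may lie outside S.\<close>

definition alg2_result where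
  "alg2_result w \<longleftrightarrow> mass_supp w \<subseteq> weighted_means N lam P \<and>
     (\<exists>Y. feasible (mass_supp w) w Y \<and> (cost (mass_supp w) Y < cost S y \<or>
        w = z \<and> cost (mass_supp w) Y = cost S y \<and>
        (\<exists>k. \<forall>i\<in>{1..N}. \<forall>c\<in>mass_supp w. k i c \<in> set_pmf (P i) \<and>
           (\<forall>x\<in>set_pmf (P i). Y i c x = (if x = k i c then w c else 0)))))"

text \<open>In the third step the state at the end of the second is kept as the ghost values
  \<open>d0\<close> and \<open>m0\<close>; what remains and what has been extracted must add up to
  it.\<close>

fun alg2_inv where
  "alg2_inv (Step2 l j d m) \<longleftrightarrow> l \<le> r \<and> 1 \<le> j \<and> step2_good d m"
| "alg2_inv (Step3 l d m b) \<longleftrightarrow> 1 \<le> l \<and> partial_masses d m \<and> (\<forall>l'\<in>{1..r}. l' < l \<longrightarrow> d l' = 0) \<and>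
     (\<exists>d0 m0 K. step2_good d0 m0 \<and> extraction m0 K m b)"
| "alg2_inv (Step4 w) \<longleftrightarrow> alg2_result w"

lemma s_inj: "l \<in> {1..r} \<Longrightarrow> j \<in> {1..r} \<Longrightarrow> s l = s j \<Longrightarrow> l = j"
  using inj_onD[OF bij_betw_imp_inj_on[OF bij_s]] by blast

lemma partial_masses_supp:
  assumes "partial_masses d m" "l \<in> {1..r}" "i \<in> {1..N}"
  shows "mass_supp (m l i) \<subseteq> set_pmf (P i)" "finite (mass_supp (m l i))"
    and "0 < d l \<Longrightarrow> mass_supp (m l i) \<noteq> {}"
proof -
  show sub: "mass_supp (m l i) \<subseteq> set_pmf (P i)"
    using assms unfolding partial_masses_def mass_supp_def by force
  then show "finite (mass_supp (m l i))" using finite_supp[OF assms(3)] finite_subset by blast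
  show "mass_supp (m l i) \<noteq> {}" if "0 < d l"
  proof
    assume "mass_supp (m l i) = {}"
    then have "(\<Sum>x\<in>set_pmf (P i). m l i x) \<le> 0"
      by (intro sum_nonpos) (auto simp: mass_supp_def not_less)
    then show False using that assms by (auto simp: partial_masses_def)
  qed
qed

lemma partial_masses_zero:
  assumes "partial_masses d m" "l \<in> {1..r}" "i \<in> {1..N}" "d l = 0"
  shows "m l i x = 0"
proof (cases "x \<in> set_pmf (P i)")
  case True
  have "(\<Sum>x\<in>set_pmf (P i). m l i x) = 0" "\<forall>x. 0 \<le> m l i x"
    using assms by (auto simp: partial_masses_def)
  then show ?thesis using True finite_supp[OF assms(3)] by (simp add: sum_nonneg_eq_0_iff)
qed (use assms in \<open>auto simp: partial_masses_def\<close>)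

lemma partial_masses_nonneg:
  "partial_masses d m \<Longrightarrow> l \<in> {1..r} \<Longrightarrow> 0 \<le> d l"
  using N_pos unfolding partial_masses_def by (metis sum_nonneg)

lemma partial_masses_add:
  assumes "partial_masses d m" "l \<in> {1..r}"
    and q: "\<And>i. i \<in> {1..N} \<Longrightarrow> q i \<in> set_pmf (P i) \<and> 0 \<le> m l i (q i) + e"
  shows "partial_masses (d(l := d l + e)) (add_mass N l q e m)"
  unfolding partial_masses_def
proof (intro ballI conjI allI impI)
  fix l' i assume l': "l' \<in> {1..r}" and i: "i \<in> {1..N}"
  show "0 \<le> add_mass N l q e m l' i x" for x
    using assms(1) l' i q[OF i] by (auto simp: partial_masses_def add_mass_apply)
  show "add_mass N l q e m l' i x = 0" if "x \<notin> set_pmf (P i)" for x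
    using assms(1) l' i q[OF i] that by (auto simp: partial_masses_def add_mass_apply)
  have "(\<Sum>x\<in>set_pmf (P i). add_mass N l q e m l' i x) = (\<Sum>x\<in>set_pmf (P i). m l' i x) +
      (\<Sum>x\<in>set_pmf (P i). if x = q i then (if l' = l then e else 0) else 0)"
    unfolding sum.distrib[symmetric] using i by (intro sum.cong refl) (simp add: add_mass_apply)
  also have "\<dots> = d l' + (if l' = l then e else 0)"
    using assms(1) l' i q[OF i] finite_supp[OF i] by (simp add: partial_masses_def)
  finally show "(\<Sum>x\<in>set_pmf (P i). add_mass N l q e m l' i x) = (d(l := d l + e)) l'" by simp
qed

lemma pcost_add:
  assumes l: "l \<in> {1..r}" and q: "\<And>i. i \<in> {1..N} \<Longrightarrow> q i \<in> set_pmf (P i)"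
  shows "pcost (add_mass N l q e m) = pcost m + e * (\<Sum>i\<in>{1..N}. lam i * (norm (s l - q i))\<^sup>2)"
proof -
  have "(\<Sum>x\<in>set_pmf (P i). (norm (s l' - x))\<^sup>2 * add_mass N l q e m l' i x) =
      (\<Sum>x\<in>set_pmf (P i). (norm (s l' - x))\<^sup>2 * m l' i x) +
      (if l' = l then (norm (s l - q i))\<^sup>2 * e else 0)" if i: "i \<in> {1..N}" for l' i
  proof -
    have "(\<Sum>x\<in>set_pmf (P i). (norm (s l' - x))\<^sup>2 * add_mass N l q e m l' i x) =
        (\<Sum>x\<in>set_pmf (P i). (norm (s l' - x))\<^sup>2 * m l' i x) +
        (\<Sum>x\<in>set_pmf (P i). if x = q i then (if l' = l then (norm (s l - q i))\<^sup>2 * e else 0) else 0)"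
      unfolding sum.distrib[symmetric] using i
      by (intro sum.cong) (auto simp: add_mass_apply algebra_simps)
    then show ?thesis using q[OF i] finite_supp[OF i] by simp
  qed
  then have "pcost (add_mass N l q e m) = pcost m +
      (\<Sum>l'\<in>{1..r}. \<Sum>i\<in>{1..N}. if l' = l then lam i * ((norm (s l - q i))\<^sup>2 * e) else 0)"
    unfolding pcost_def sum.distrib[symmetric] by (intro sum.cong refl) (simp add: distrib_left)
  also have "(\<Sum>l'\<in>{1..r}. \<Sum>i\<in>{1..N}. if l' = l then lam i * ((norm (s l - q i))\<^sup>2 * e) else 0) =
      (\<Sum>l'\<in>{1..r}. if l' = l then (\<Sum>i\<in>{1..N}. lam i * ((norm (s l - q i))\<^sup>2 * e)) else 0)"
    by (intro sum.cong) auto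
  also have "\<dots> = e * (\<Sum>i\<in>{1..N}. lam i * (norm (s l - q i))\<^sup>2)"
    using l by (simp add: sum_distrib_left mult.commute mult.left_commute)
  finally show ?thesis .
qed

lemma arg_max_mass:
  assumes "is_arg_max f (\<lambda>x. x \<in> mass_supp w) v"
  shows "0 < w v"
  using assms by (simp add: is_arg_max_def mass_supp_def)

lemma step2_good_move:
  assumes good: "step2_good d m" and l: "l \<in> {1..r}" and j: "j \<in> {1..r}" and jl: "j \<noteq> l"
    and q: "\<And>i. i \<in> {1..N} \<Longrightarrow> 0 < m l i (q i)"
    and eq: "(norm (mean_point N lam q - s j))\<^sup>2 = (norm (mean_point N lam q - s l))\<^sup>2"
    and e: "e = d_min N m l q"
  shows "step2_good (d(l := d l - e, j := d j + e)) (add_mass N j q e (add_mass N l q (- e) m))"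
proof -
  let ?m1 = "add_mass N l q (- e) m"
  let ?m2 = "add_mass N j q e ?m1"
  have pm: "partial_masses d m" using good by (simp add: step2_good_def)
  have qP: "q i \<in> set_pmf (P i)" if "i \<in> {1..N}" for i
    using partial_masses_supp(1)[OF pm l that] q[OF that] by (auto simp: mass_supp_def)
  have e0: "0 < e" unfolding e using q by (rule d_min_pos)
  have pm1: "partial_masses (d(l := d l + - e)) ?m1"
    using qP d_min_le[of _ m l q] by (intro partial_masses_add pm l) (auto simp: e)
  have mj: "0 \<le> ?m1 j i (q i)" if "i \<in> {1..N}" for i
    using pm1 j that by (auto simp: partial_masses_def)
  have "partial_masses ((d(l := d l + - e))(j := (d(l := d l + - e)) j + e)) ?m2"
    using qP mj e0 by (intro partial_masses_add pm1 j) (auto intro: add_nonneg_nonneg)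
  then have pm2: "partial_masses (d(l := d l - e, j := d j + e)) ?m2"
    using jl by (simp only: fun_upd_other not_False_eq_True add_uminus_conv_diff)
  have total: "(\<Sum>l'\<in>{1..r}. ?m2 l' i x) = pmf (P i) x" if "i \<in> {1..N}" for i x
  proof -
    have "(\<Sum>l'\<in>{1..r}. ?m2 l' i x) = (\<Sum>l'\<in>{1..r}. m l' i x) +
        (\<Sum>l'\<in>{1..r}. if l' = l then (if x = q i then - e else 0) else 0) +
        (\<Sum>l'\<in>{1..r}. if l' = j then (if x = q i then e else 0) else 0)"
      unfolding sum.distrib[symmetric] using that by (intro sum.cong refl) (simp add: add_mass_apply)
    then show ?thesis using good l j that by (simp add: step2_good_def)
  qed
  have pcost: "pcost ?m2 = cost S y"
  proof -
    have "pcost ?m2 = pcost ?m1 + e * (\<Sum>i\<in>{1..N}. lam i * (norm (s j - q i))\<^sup>2)"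
      using j qP by (rule pcost_add)
    also have "pcost ?m1 = pcost m + - e * (\<Sum>i\<in>{1..N}. lam i * (norm (s l - q i))\<^sup>2)"
      using l qP by (rule pcost_add)
    \<comment> \<open>The mean is equally far from \<open>s l\<close> and \<open>s j\<close>, so by
      the parallel axis identity the cost removed at \<open>s l\<close> equals the cost added at
      \<open>s j\<close>.\<close>
    also have "(\<Sum>i\<in>{1..N}. lam i * (norm (s l - q i))\<^sup>2) = (\<Sum>i\<in>{1..N}. lam i * (norm (s j - q i))\<^sup>2)"
      using eq unfolding sum_sq_dist_mean_point[of "s l" q] sum_sq_dist_mean_point[of "s j" q]
      by (simp add: norm_minus_commute)
    finally show ?thesis using good by (simp add: step2_good_def)
  qed
  have "mean_point N lam q \<noteq> s j"
    using eq s_inj[OF j l] jl by auto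
  moreover have "\<forall>i\<in>{1..N}. 0 < ?m2 j i (q i)"
  proof
    fix i assume i: "i \<in> {1..N}"
    show "0 < ?m2 j i (q i)"
      using mj[OF i] e0 i unfolding add_mass_apply[of N j q e ?m1] by simp
  qed
  ultimately show ?thesis
    unfolding step2_good_def using j pm2 total pcost by blast
qed

text \<open>Subtracting the minimal mass exhausts some point of the extracted tuple. Every tuple
  still available differs from it and is nowhere lexicographically larger, so its mean lies strictly
  below \<open>c\<close>.\<close>

lemma extraction_step:
  assumes ex: "extraction m0 K m b" and pm: "partial_masses d m" and l: "l \<in> {1..r}"
    and q: "\<And>i. i \<in> {1..N} \<Longrightarrow> lex_maximal (mass_supp (m l i)) (q i)"
    and c: "c = mean_point N lam q" and e: "e = d_min N m l q"
  shows "extraction m0 (K(l := (K l)(c := q))) (add_mass N l q (- e) m)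
    (b(l := (b l)(c := b l c + e)))"
proof -
  let ?m = "add_mass N l q (- e) m"
  have qm: "0 < m l i (q i)" if "i \<in> {1..N}" for i
    using q[OF that] by (simp add: lex_maximal_def mass_supp_def)
  have qP: "q i \<in> set_pmf (P i)" if "i \<in> {1..N}" for i
    using partial_masses_supp(1)[OF pm l that] qm[OF that] by (auto simp: mass_supp_def)
  have e0: "0 < e" unfolding e using qm by (rule d_min_pos)
  have m_le: "?m l' i x \<le> m l' i x" for l' i x using e0 by (simp add: add_mass_apply)
  have cC: "c \<in> weighted_means N lam P" unfolding c using qP by (intro weighted_means_mean_point) auto
  \<comment> \<open>An earlier extraction with mean \<open>c\<close> would have to exceed the mean
    of the tuple now available, which is \<open>c\<close> itself. Hence setting \<open>K l c\<close>
    overwrites no recorded tuple.\<close>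
  have bc: "b l c = 0"
  proof (rule ccontr)
    assume "b l c \<noteq> 0"
    moreover have "0 \<le> b l c" using ex l by (simp add: extraction_def)
    ultimately have "0 < b l c" by simp
    then have "lex_less (mean_point N lam q) c" using ex l qm by (auto simp: extraction_def)
    then show False by (simp add: c lex_less_irrefl)
  qed
  have less_c: "lex_less (mean_point N lam p) c" if p: "\<forall>i\<in>{1..N}. 0 < ?m l i (p i)" for p
    unfolding c
  proof (rule lex_less_mean_point)
    fix i assume i: "i \<in> {1..N}"
    have "0 < m l i (p i)" using p i m_le[of l i "p i"] by (auto intro: less_le_trans)
    then show "p i = q i \<or> lex_less (p i) (q i)"
      using q[OF i] by (auto simp: lex_maximal_def mass_supp_def)
  next
    obtain i where i: "i \<in> {1..N}" "e = m l i (q i)" using d_min_attained[of m l q] e by auto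
    then have "?m l i (q i) = 0" by (simp add: add_mass_apply)
    with p i have "p i \<noteq> q i" by fastforce
    with i show "\<exists>i\<in>{1..N}. p i \<noteq> q i" by blast
  qed
  show ?thesis
    unfolding extraction_def
  proof (intro ballI conjI allI impI)
    fix l' c' assume l': "l' \<in> {1..r}"
    show "0 \<le> (b(l := (b l)(c := b l c + e))) l' c'"
      using ex l' e0 by (auto simp: extraction_def)
    assume pos: "0 < (b(l := (b l)(c := b l c + e))) l' c'"
    show "mean_point N lam ((K(l := (K l)(c := q))) l' c') = c'"
      using ex l' pos c by (auto simp: extraction_def split: if_splits)
    show "(K(l := (K l)(c := q))) l' c' i \<in> set_pmf (P i)" if "i \<in> {1..N}" for i
      using ex l' pos qP that by (auto simp: extraction_def split: if_splits)
    show "lex_less (mean_point N lam p) c'" if p: "\<forall>i\<in>{1..N}. 0 < ?m l' i (p i)" for p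
    proof (cases "l' = l \<and> c' = c")
      case True
      then show ?thesis using less_c p by blast
    next
      case False
      then have "0 < b l' c'" using pos by (auto split: if_splits)
      moreover have "\<forall>i\<in>{1..N}. 0 < m l' i (p i)"
        using p m_le by (meson less_le_trans)
      ultimately show ?thesis using ex l' by (simp add: extraction_def)
    qed
  next
    fix l' i x assume l': "l' \<in> {1..r}" and i: "i \<in> {1..N}"
    let ?C = "weighted_means N lam P"
    have old: "m l' i x + (\<Sum>c\<in>?C. if K l' c i = x then b l' c else 0) = m0 l' i x"
      using ex l' i by (simp add: extraction_def)
    have "(\<Sum>c'\<in>?C. if (K(l := (K l)(c := q))) l' c' i = x
        then (b(l := (b l)(c := b l c + e))) l' c' else 0) =
        (\<Sum>c\<in>?C. if K l' c i = x then b l' c else 0) +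
        (\<Sum>c'\<in>?C. if c' = c then (if l' = l \<and> x = q i then e else 0) else 0)"
      unfolding sum.distrib[symmetric] using bc by (intro sum.cong) auto
    also have "\<dots> = (\<Sum>c\<in>?C. if K l' c i = x then b l' c else 0) + (if l' = l \<and> x = q i then e else 0)"
      using cC finite_weighted_means by simp
    finally show "?m l' i x + (\<Sum>c'\<in>?C. if (K(l := (K l)(c := q))) l' c' i = x
        then (b(l := (b l)(c := b l c + e))) l' c' else 0) = m0 l' i x"
      using old i by (auto simp: add_mass_apply)
  qed
qed


lemma alg2_init_good: "step2_good (\<lambda>l. z (s l)) (\<lambda>l i x. y i (s l) x)"
proof -
  \<comment> \<open>The enumeration \<open>s\<close> skips the points of S without mass, at which
    all variables of a feasible solution vanish.\<close>
  have reindex: "(\<Sum>l\<in>{1..r}. f (s l)) = (\<Sum>x\<in>S. f x)" if "\<And>x. z x = 0 \<Longrightarrow> f x = 0" for f :: "_ \<Rightarrow> real"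
  proof -
    have "(\<Sum>l\<in>{1..r}. f (s l)) = (\<Sum>x\<in>mass_supp z. f x)"
      by (rule sum.reindex_bij_betw[OF bij_s])
    also have "\<dots> = (\<Sum>x\<in>S. f x)"
    proof (rule sum.mono_neutral_left[OF finite_S feasible_mass_supp[OF feasible_zy]])
      show "\<forall>x\<in>S - mass_supp z. f x = 0"
      proof
        fix x assume "x \<in> S - mass_supp z"
        then have "z x = 0"
          using feasible_mass_nonneg[OF feasible_zy, of x] by (simp add: mass_supp_def)
        then show "f x = 0" by (rule that)
      qed
    qed
    finally show ?thesis .
  qed
  have y0: "y i x k = 0" if "k \<notin> set_pmf (P i)" for i x k
    using feasible_zy that by (auto simp: lp_feasible_def)
  have "partial_masses (\<lambda>l. z (s l)) (\<lambda>l i x. y i (s l) x)"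
    unfolding partial_masses_def
    using feasible_nonneg[OF feasible_zy] feasible_mass[OF feasible_zy] y0 by blast
  moreover have "(\<Sum>l\<in>{1..r}. y i (s l) k) = pmf (P i) k" if i: "i \<in> {1..N}" for i k
  proof -
    have "(\<Sum>l\<in>{1..r}. y i (s l) k) = (\<Sum>x\<in>S. y i x k)"
      using feasible_zero[OF feasible_zy i] by (rule reindex)
    also have "\<dots> = pmf (P i) k"
    proof (cases "k \<in> set_pmf (P i)")
      case True
      then show ?thesis using feasible_zy i by (simp add: lp_feasible_def)
    next
      case False
      then show ?thesis using y0 by (simp add: set_pmf_iff)
    qed
    finally show ?thesis .
  qed
  moreover have "pcost (\<lambda>l i x. y i (s l) x) = cost S y"
  proof -
    have "pcost (\<lambda>l i x. y i (s l) x) =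
        (\<Sum>x\<in>S. \<Sum>i\<in>{1..N}. lam i * (\<Sum>k\<in>set_pmf (P i). (norm (x - k))\<^sup>2 * y i x k))"
      unfolding pcost_def using feasible_zero[OF feasible_zy]
      by (intro reindex) (auto intro!: sum.neutral)
    also have "\<dots> = cost S y"
      unfolding transport_cost_def by (subst sum.swap) (simp add: sum_distrib_left)
    finally show ?thesis .
  qed
  ultimately show ?thesis unfolding step2_good_def by blast
qed

lemma extraction_init: "extraction m (\<lambda>_ _ _. 0) m (\<lambda>_ _. 0)"
  by (simp add: extraction_def)

text \<open>Nothing is left over, so \<open>b\<close> and \<open>K\<close> describe the transport
  before the third step, starting from the points \<open>s l\<close>, as well as the one after it,
  starting from the means. The two costs can therefore be compared tuple by tuple.\<close>

lemma extraction_result: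
  assumes good: "step2_good d0 m0" and ex: "extraction m0 K m b"
    and m0: "\<And>l i x. l \<in> {1..r} \<Longrightarrow> i \<in> {1..N} \<Longrightarrow> m l i x = 0"
  shows "alg2_result (\<lambda>x. \<Sum>l\<in>{1..r}. b l x)"
proof -
  let ?C = "weighted_means N lam P"
  define w where "w = (\<lambda>x. \<Sum>l\<in>{1..r}. b l x)"
  let ?A = "mass_supp w"
  have b0: "0 \<le> b l c" if "l \<in> {1..r}" for l c using ex that by (simp add: extraction_def)
  have KP: "K l c i \<in> set_pmf (P i)" if "l \<in> {1..r}" "0 < b l c" "i \<in> {1..N}" for l c i
    using ex that unfolding extraction_def by blast
  have Kc: "mean_point N lam (K l c) = c" if "l \<in> {1..r}" "0 < b l c" for l c
    using ex that unfolding extraction_def by blast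
  have m0_eq: "m0 l i x = (\<Sum>c\<in>?C. if K l c i = x then b l c else 0)"
    if "l \<in> {1..r}" "i \<in> {1..N}" for l i x
  proof -
    have "m l i x + (\<Sum>c\<in>?C. if K l c i = x then b l c else 0) = m0 l i x"
      using ex that unfolding extraction_def by blast
    then show ?thesis using m0[OF that] by simp
  qed
  have bC: "c \<in> ?C" if "l \<in> {1..r}" "0 < b l c" for l c
    using weighted_means_mean_point[of "K l c"] KP[OF that] Kc[OF that] by auto
  have w_le: "b l c \<le> w c" if "l \<in> {1..r}" for l c
    unfolding w_def using that b0 by (intro member_le_sum) auto
  have w0: "0 \<le> w c" for c unfolding w_def using b0 by (intro sum_nonneg) auto
  have AC: "?A \<subseteq> ?C"
  proof
    fix c assume "c \<in> ?A"
    then have "0 < (\<Sum>l\<in>{1..r}. b l c)" by (simp add: mass_supp_def w_def)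
    then obtain l where "l \<in> {1..r}" "0 < b l c" by (meson not_less sum_nonpos)
    then show "c \<in> ?C" by (rule bC)
  qed
  have bA: "b l c = 0" if "l \<in> {1..r}" "c \<notin> ?A" for l c
    using w_le[OF that(1), of c] b0[OF that(1), of c] that(2) by (simp add: mass_supp_def)
  \<comment> \<open>Several l may extract the same mean \<open>c\<close>, so their masses are
    collected. Only in the stationary case does each \<open>c\<close> come from a single l.\<close>
  define Y where "Y = (\<lambda>i c x. if i \<in> {1..N} \<and> x \<in> set_pmf (P i)
    then \<Sum>l\<in>{1..r}. if K l c i = x then b l c else 0 else 0)"
  have YA: "Y i c x = 0" if "c \<notin> ?A" for i c x
    using bA that by (auto simp: Y_def intro!: sum.neutral)
  have sumY: "(\<Sum>x\<in>set_pmf (P i). f x * Y i c x) = (\<Sum>l\<in>{1..r}. f (K l c i) * b l c)"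
    if i: "i \<in> {1..N}" for f :: "_ \<Rightarrow> real" and i c
  proof -
    have "(\<Sum>x\<in>set_pmf (P i). f x * Y i c x) =
        (\<Sum>x\<in>set_pmf (P i). \<Sum>l\<in>{1..r}. if K l c i = x then f x * b l c else 0)"
      using i by (intro sum.cong refl) (simp add: Y_def sum_distrib_left if_distrib cong: if_cong)
    also have "\<dots> = (\<Sum>l\<in>{1..r}. \<Sum>x\<in>set_pmf (P i). if K l c i = x then f x * b l c else 0)"
      by (rule sum.swap)
    also have "\<dots> = (\<Sum>l\<in>{1..r}. f (K l c i) * b l c)"
    proof (intro sum.cong refl)
      fix l assume l: "l \<in> {1..r}"
      show "(\<Sum>x\<in>set_pmf (P i). if K l c i = x then f x * b l c else 0) = f (K l c i) * b l c"
        using KP[OF l _ i, of c] b0[OF l, of c] finite_supp[OF i]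
        by (cases "b l c = 0") simp_all
    qed
    finally show ?thesis .
  qed
  have feasY: "feasible ?A w Y"
    unfolding lp_feasible_def
  proof (intro conjI ballI allI impI)
    show "(\<Sum>x\<in>set_pmf (P i). Y i c x) = w c" if "i \<in> {1..N}" for i c
      using sumY[OF that, of "\<lambda>_. 1" c] by (simp add: w_def)
    show "(\<Sum>c\<in>?A. Y i c x) = pmf (P i) x" if i: "i \<in> {1..N}" and x: "x \<in> set_pmf (P i)" for i x
    proof -
      have "(\<Sum>c\<in>?A. Y i c x) = (\<Sum>c\<in>?C. Y i c x)"
        using AC YA finite_weighted_means by (intro sum.mono_neutral_left) auto
      also have "\<dots> = (\<Sum>l\<in>{1..r}. \<Sum>c\<in>?C. if K l c i = x then b l c else 0)"
        using i x by (subst sum.swap) (simp add: Y_def)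
      also have "\<dots> = (\<Sum>l\<in>{1..r}. m0 l i x)" using m0_eq[OF _ i] by simp
      finally show ?thesis using good i by (simp add: step2_good_def)
    qed
    show "0 \<le> Y i c x" for i c x using b0 by (auto simp: Y_def intro!: sum_nonneg)
    show "w c = 0" if "c \<notin> ?A" for c using that w0[of c] by (simp add: mass_supp_def)
    show "Y i c x = 0" if "\<not> (i \<in> {1..N} \<and> c \<in> ?A \<and> x \<in> set_pmf (P i))" for i c x
      using that YA by (cases "c \<in> ?A") (auto simp: Y_def)
  qed
  define V where "V = (\<lambda>u l c. \<Sum>i\<in>{1..N}. lam i * (norm (u - K l c i))\<^sup>2)"
  have costY: "cost ?A Y = (\<Sum>l\<in>{1..r}. \<Sum>c\<in>?C. b l c * V c l c)"
  proof -
    have "cost ?A Y = (\<Sum>i\<in>{1..N}. lam i * (\<Sum>c\<in>?C. \<Sum>l\<in>{1..r}. (norm (c - K l c i))\<^sup>2 * b l c))"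
      unfolding transport_cost_def
    proof (rule sum.cong[OF refl], rule arg_cong2[where f = "(*)", OF refl])
      fix i assume i: "i \<in> {1..N}"
      have "(\<Sum>c\<in>?A. \<Sum>x\<in>set_pmf (P i). (norm (c - x))\<^sup>2 * Y i c x) =
          (\<Sum>c\<in>?C. \<Sum>x\<in>set_pmf (P i). (norm (c - x))\<^sup>2 * Y i c x)"
        using AC YA finite_weighted_means by (intro sum.mono_neutral_left) auto
      then show "(\<Sum>c\<in>?A. \<Sum>x\<in>set_pmf (P i). (norm (c - x))\<^sup>2 * Y i c x) =
          (\<Sum>c\<in>?C. \<Sum>l\<in>{1..r}. (norm (c - K l c i))\<^sup>2 * b l c)"
        by (simp add: sumY[OF i])
    qed
    also have "\<dots> = (\<Sum>i\<in>{1..N}. \<Sum>l\<in>{1..r}. \<Sum>c\<in>?C. b l c * (lam i * (norm (c - K l c i))\<^sup>2))"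
      by (intro sum.cong refl, subst sum.swap) (simp add: sum_distrib_left mult_ac)
    also have "\<dots> = (\<Sum>l\<in>{1..r}. \<Sum>i\<in>{1..N}. \<Sum>c\<in>?C. b l c * (lam i * (norm (c - K l c i))\<^sup>2))"
      by (rule sum.swap)
    also have "\<dots> = (\<Sum>l\<in>{1..r}. \<Sum>c\<in>?C. b l c * V c l c)"
      by (intro sum.cong refl, subst sum.swap) (simp add: V_def sum_distrib_left)
    finally show ?thesis .
  qed
  have cost0: "cost S y = (\<Sum>l\<in>{1..r}. \<Sum>c\<in>?C. b l c * V (s l) l c)"
  proof -
    have "cost S y = pcost m0" using good by (simp add: step2_good_def)
    also have "\<dots> = (\<Sum>l\<in>{1..r}. \<Sum>i\<in>{1..N}. \<Sum>c\<in>?C. b l c * (lam i * (norm (s l - K l c i))\<^sup>2))"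
      unfolding pcost_def
    proof (intro sum.cong refl)
      fix l i assume l: "l \<in> {1..r}" and i: "i \<in> {1..N}"
      have "(\<Sum>x\<in>set_pmf (P i). (norm (s l - x))\<^sup>2 * m0 l i x) =
          (\<Sum>x\<in>set_pmf (P i). \<Sum>c\<in>?C. if K l c i = x then (norm (s l - x))\<^sup>2 * b l c else 0)"
        by (simp add: m0_eq[OF l i] sum_distrib_left if_distrib cong: if_cong)
      also have "\<dots> = (\<Sum>c\<in>?C. \<Sum>x\<in>set_pmf (P i). if K l c i = x then (norm (s l - x))\<^sup>2 * b l c else 0)"
        by (rule sum.swap)
      also have "\<dots> = (\<Sum>c\<in>?C. (norm (s l - K l c i))\<^sup>2 * b l c)"
      proof (intro sum.cong refl)
        fix c
        show "(\<Sum>x\<in>set_pmf (P i). if K l c i = x then (norm (s l - x))\<^sup>2 * b l c else 0) =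
            (norm (s l - K l c i))\<^sup>2 * b l c"
          using KP[OF l _ i, of c] b0[OF l, of c] finite_supp[OF i]
          by (cases "b l c = 0") simp_all
      qed
      finally show "lam i * (\<Sum>x\<in>set_pmf (P i). (norm (s l - x))\<^sup>2 * m0 l i x) =
          (\<Sum>c\<in>?C. b l c * (lam i * (norm (s l - K l c i))\<^sup>2))"
        by (simp add: sum_distrib_left mult_ac)
    qed
    also have "\<dots> = (\<Sum>l\<in>{1..r}. \<Sum>c\<in>?C. b l c * V (s l) l c)"
      by (intro sum.cong refl, subst sum.swap) (simp add: V_def sum_distrib_left)
    finally show ?thesis .
  qed
  \<comment> \<open>By the parallel axis identity this is exactly the cost saved by starting each
    tuple from its mean instead of \<open>s l\<close>.\<close>
  define D where "D = (\<Sum>l\<in>{1..r}. \<Sum>c\<in>?C. b l c * (norm (s l - c))\<^sup>2)"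
  have "b l c * V (s l) l c = b l c * V c l c + b l c * (norm (s l - c))\<^sup>2" if l: "l \<in> {1..r}" for l c
  proof (cases "b l c = 0")
    case False
    then have "mean_point N lam (K l c) = c" using Kc[OF l] b0[OF l, of c] by simp
    then show ?thesis
      using sum_sq_dist_mean_point[of "s l" "K l c"] by (simp add: V_def distrib_left)
  qed simp
  then have costD: "cost S y = cost ?A Y + D"
    unfolding cost0 costY D_def sum.distrib[symmetric] by (intro sum.cong refl) simp
  have D0: "0 \<le> D" unfolding D_def using b0 by (intro sum_nonneg) auto
  show ?thesis
  proof (cases "D = 0")
    case False
    then have "cost ?A Y < cost S y" using costD D0 by simp
    then show ?thesis unfolding alg2_result_def w_def[symmetric] using AC feasY by blast
  next
    case True
    have bs: "b l c = 0" if l: "l \<in> {1..r}" and "c \<noteq> s l" for l c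
    proof (rule ccontr)
      assume "b l c \<noteq> 0"
      then have pos: "0 < b l c" using b0[OF l, of c] by simp
      have "(\<Sum>c\<in>?C. b l c * (norm (s l - c))\<^sup>2) = 0"
        using True l b0 unfolding D_def by (subst (asm) sum_nonneg_eq_0_iff) (auto intro!: sum_nonneg)
      then have "b l c * (norm (s l - c))\<^sup>2 = 0"
        using l b0 bC[OF l pos] finite_weighted_means by (subst (asm) sum_nonneg_eq_0_iff) auto
      with pos \<open>c \<noteq> s l\<close> show False by simp
    qed
    have single: "(\<Sum>c\<in>?C. if K l c i = x then b l c else 0) = (if K l (s l) i = x then b l (s l) else 0)"
      if l: "l \<in> {1..r}" for l i x
    proof -
      have "(\<Sum>c\<in>?C. if K l c i = x then b l c else 0) =
          (\<Sum>c\<in>?C. if c = s l then (if K l (s l) i = x then b l (s l) else 0) else 0)"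
        using bs[OF l] by (intro sum.cong) auto
      also have "\<dots> = (if K l (s l) i = x then b l (s l) else 0)"
        using finite_weighted_means bC[OF l, of "s l"] b0[OF l, of "s l"]
        by (cases "b l (s l) = 0") auto
      finally show ?thesis .
    qed
    have d0: "d0 l = b l (s l)" if l: "l \<in> {1..r}" for l
    proof -
      have "d0 l = (\<Sum>x\<in>set_pmf (P 1). m0 l 1 x)"
        using good l N_pos by (simp add: step2_good_def partial_masses_def)
      also have "\<dots> = (\<Sum>x\<in>set_pmf (P 1). if K l (s l) 1 = x then b l (s l) else 0)"
        using m0_eq[OF l N_pos] single[OF l] by simp
      also have "\<dots> = b l (s l)"
        using KP[OF l _ N_pos, of "s l"] b0[OF l, of "s l"] finite_supp[OF N_pos]
        by (cases "b l (s l) = 0") simp_all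
      finally show ?thesis .
    qed
    \<comment> \<open>With \<open>D = 0\<close> the j-th partial measures contain no tuple but
      \<open>K j (s j)\<close>, whose mean is \<open>s j\<close>. This refutes the second
      alternative of \<open>step2_good\<close>, so the masses at the points \<open>s l\<close> are
      still the initial ones.\<close>
    have "mean_point N lam q = s j" if j: "j \<in> {1..r}" and q: "\<forall>i\<in>{1..N}. 0 < m0 j i (q i)" for j q
    proof -
      have pos: "K j (s j) i = q i \<and> 0 < b j (s j)" if i: "i \<in> {1..N}" for i
        using bspec[OF q i] m0_eq[OF j i] single[OF j] by (simp split: if_splits)
      then have "mean_point N lam q = mean_point N lam (K j (s j))"
        by (intro mean_point_cong) simp
      also have "\<dots> = s j" using Kc[OF j] pos[OF N_pos] by blast
      finally show ?thesis .
    qed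
    then have d0z: "d0 l = z (s l)" if "l \<in> {1..r}" for l
      using good that unfolding step2_good_def by blast
    have other: "b l' (s l) = 0" if "l' \<in> {1..r}" "l \<in> {1..r}" "l' \<noteq> l" for l l'
      using bs[OF that(1), of "s l"] s_inj[OF that(1,2)] that(3) by metis
    have ws: "w (s l) = b l (s l)" if l: "l \<in> {1..r}" for l
    proof -
      have "w (s l) = (\<Sum>l'\<in>{1..r}. if l' = l then b l (s l) else 0)"
        unfolding w_def using other[OF _ l] by (intro sum.cong refl) simp
      then show ?thesis using l by simp
    qed
    have im: "s ` {1..r} = mass_supp z" using bij_s by (rule bij_betw_imp_surj_on)
    have "w = z"
    proof
      fix x
      show "w x = z x"
      proof (cases "x \<in> mass_supp z")
        case True
        then obtain l where "l \<in> {1..r}" "x = s l" unfolding im[symmetric] by blast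
        then show ?thesis using ws d0 d0z by simp
      next
        case False
        then have "x \<noteq> s l" if "l \<in> {1..r}" for l using that im by blast
        then have "w x = 0" unfolding w_def using bs by (intro sum.neutral ballI) blast
        then show ?thesis
          using False feasible_mass_nonneg[OF feasible_zy, of x] by (simp add: mass_supp_def)
      qed
    qed
    define L where "L = inv_into {1..r} s"
    have L: "L c \<in> {1..r} \<and> s (L c) = c" if "c \<in> ?A" for c
      using that unfolding \<open>w = z\<close> L_def im[symmetric] by (simp only: inv_into_into f_inv_into_f)
    have "K (L c) c i \<in> set_pmf (P i) \<and> (\<forall>x\<in>set_pmf (P i). Y i c x = (if x = K (L c) c i then w c else 0))"
      if i: "i \<in> {1..N}" and c: "c \<in> ?A" for i c
    proof -
      have l: "L c \<in> {1..r}" and sl: "s (L c) = c" using L[OF c] by auto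
      have wc: "w c = b (L c) c" using ws[OF l] sl by simp
      have "0 < b (L c) c" using c wc by (simp add: mass_supp_def)
      then have "K (L c) c i \<in> set_pmf (P i)" by (rule KP[OF l _ i])
      moreover have "Y i c x = (if x = K (L c) c i then w c else 0)" if x: "x \<in> set_pmf (P i)" for x
      proof -
        have "Y i c x = (\<Sum>l\<in>{1..r}. if l = L c then (if K (L c) c i = x then b (L c) c else 0) else 0)"
        proof -
          have "b l' c = 0" if "l' \<in> {1..r}" "l' \<noteq> L c" for l'
            using other[OF that(1) l that(2)] sl by simp
          then have "(\<Sum>l\<in>{1..r}. if K l c i = x then b l c else 0) =
              (\<Sum>l\<in>{1..r}. if l = L c then (if K (L c) c i = x then b (L c) c else 0) else 0)"
            by (intro sum.cong refl) simp
          then show ?thesis using i x by (simp only: Y_def simp_thms if_True)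
        qed
        then show ?thesis using l wc by auto
      qed
      ultimately show ?thesis by blast
    qed
    then have "\<exists>k. \<forall>i\<in>{1..N}. \<forall>c\<in>?A. k i c \<in> set_pmf (P i) \<and>
        (\<forall>x\<in>set_pmf (P i). Y i c x = (if x = k i c then w c else 0))"
      by (intro exI[of _ "\<lambda>i c. K (L c) c i"]) blast
    moreover have "cost ?A Y = cost S y" using costD True by simp
    ultimately show ?thesis
      unfolding alg2_result_def w_def[symmetric] using AC feasY \<open>w = z\<close> by blast
  qed
qed


lemma alg2_init_inv: "alg2_inv (alg2_init s r z y)"
  unfolding alg2_init_def using alg2_init_good by simp

lemma alg2_inv_step:
  assumes "alg2_step N lam s r a a'" "alg2_inv a"
  shows "alg2_inv a'"
  using assms
proof (induction rule: alg2_step.induct)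
  case (step2_move l j d m q c e d' m')
  then have lj: "l \<in> {1..r}" "j \<in> {1..r}" "j \<noteq> l" by auto
  have q: "0 < m l i (q i)" if "i \<in> {1..N}" for i
    using step2_move that by (auto intro: arg_max_mass)
  have good: "step2_good d m" using step2_move by simp
  have eq: "(norm (mean_point N lam q - s j))\<^sup>2 = (norm (mean_point N lam q - s l))\<^sup>2"
    using step2_move.hyps by simp
  have "step2_good d' m'"
    unfolding step2_move.hyps(8,9) using good lj q eq step2_move.hyps(7) by (rule step2_good_move)
  then show ?case using step2_move.prems by simp
next
  case (step2_exit j d m)
  have "extraction m (\<lambda>_ _ _. 0) m (\<lambda>_ _. 0)" by (rule extraction_init)
  moreover have "step2_good d m" using step2_exit by simp
  moreover have "partial_masses d m" using step2_exit by (simp add: step2_good_def)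
  ultimately show ?case unfolding alg2_inv.simps by auto
next
  case (step3_extract l d m q c e d' m' b' b)
  then have l: "l \<in> {1..r}" and pm: "partial_masses d m" by auto
  from step3_extract.prems obtain d0 m0 K where
    good: "step2_good d0 m0" and ex: "extraction m0 K m b" by auto
  have q: "lex_maximal (mass_supp (m l i)) (q i)" if "i \<in> {1..N}" for i
    using step3_extract that by blast
  have qm: "0 < m l i (q i)" if "i \<in> {1..N}" for i
    using q[OF that] by (simp add: lex_maximal_def mass_supp_def)
  have qP: "q i \<in> set_pmf (P i)" if "i \<in> {1..N}" for i
    using partial_masses_supp(1)[OF pm l that] qm[OF that] by (auto simp: mass_supp_def)
  have "partial_masses (d(l := d l + - e)) (add_mass N l q (- e) m)"
    using qP d_min_le[of _ m l q] step3_extract.hyps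
    by (intro partial_masses_add pm l) auto
  moreover have "extraction m0 (K(l := (K l)(c := q))) m' b'"
    unfolding step3_extract.hyps by (rule extraction_step[OF ex pm l q refl refl])
  moreover have "\<forall>l'\<in>{1..r}. l' < l \<longrightarrow> d' l' = 0"
    using step3_extract by auto
  ultimately show ?case
    using step3_extract good by auto
next
  case (step3_next_l l d m b)
  then have l: "l \<in> {1..r}" and pm: "partial_masses d m" by auto
  have "d l = 0" using step3_next_l partial_masses_nonneg[OF pm l] by simp
  then show ?case using step3_next_l by (auto simp: less_Suc_eq)
next
  case (step3_exit l d m b)
  then obtain d0 m0 K where good: "step2_good d0 m0" and ex: "extraction m0 K m b" by auto
  have pm: "partial_masses d m" and "\<forall>l'\<in>{1..r}. l' < l \<longrightarrow> d l' = 0"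
    using step3_exit.prems by auto
  with step3_exit.hyps have "d l' = 0" if "l' \<in> {1..r}" for l' using that by simp
  then have "m l' i x = 0" if "l' \<in> {1..r}" "i \<in> {1..N}" for l' i x
    using that by (intro partial_masses_zero[OF pm]) auto
  then show ?case unfolding alg2_inv.simps by (rule extraction_result[OF good ex])
qed auto

section \<open>Progress and termination of the local improvement\<close>

lemma alg2_progress:
  assumes "alg2_inv a" "\<And>w. a \<noteq> Step4 w"
  shows "\<exists>a'. alg2_step N lam s r a a'"
proof (cases a)
  case (Step2 l j d m)
  then have good: "step2_good d m" and lr: "l \<le> r" "1 \<le> j" using assms by auto
  then have pm: "partial_masses d m" by (simp add: step2_good_def)
  consider "l = 0" | "0 < l" "\<not> (j < l \<and> 0 < d l)" | "0 < l" "j < l" "0 < d l" by auto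
  then show ?thesis
  proof cases
    case 1
    then show ?thesis using Step2 step2_exit by blast
  next
    case 2
    then show ?thesis using Step2 step2_next_l by blast
  next
    case 3
    then have l: "l \<in> {1..r}" using lr by auto
    have "\<exists>v. is_arg_max (\<lambda>x. (s j - s l) \<bullet> x) (\<lambda>x. x \<in> mass_supp (m l i)) v" if "i \<in> {1..N}" for i
    proof -
      let ?A = "mass_supp (m l i)"
      have "finite ?A" "?A \<noteq> {}" using partial_masses_supp[OF pm l that] 3 by auto
      from ex_is_arg_min_if_finite[OF this, of "\<lambda>x. - ((s j - s l) \<bullet> x)"]
      show ?thesis by (simp add: is_arg_min_def is_arg_max_def)
    qed
    then obtain q where q:
      "\<forall>i\<in>{1..N}. is_arg_max (\<lambda>x. (s j - s l) \<bullet> x) (\<lambda>x. x \<in> mass_supp (m l i)) (q i)"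
      by metis
    show ?thesis
    proof (cases "(norm (mean_point N lam q - s j))\<^sup>2 = (norm (mean_point N lam q - s l))\<^sup>2")
      case True
      from step2_move[where d = d and m = m and l = l and j = j and s = s, OF 3 q refl this refl refl refl]
      show ?thesis unfolding Step2 ..
    next
      case False
      from step2_next_j[where d = d and m = m and l = l and j = j and s = s, OF 3 q refl this]
      show ?thesis unfolding Step2 ..
    qed
  qed
next
  case (Step3 l d m b)
  then have pm: "partial_masses d m" and l1: "1 \<le> l" using assms by auto
  consider "r < l" | "l \<le> r" "\<not> 0 < d l" | "l \<le> r" "0 < d l" by linarith
  then show ?thesis
  proof cases
    case 1
    then show ?thesis using Step3 step3_exit by blast
  next
    case 2
    then show ?thesis using Step3 step3_next_l by blast
  next
    case 3
    then have l: "l \<in> {1..r}" using l1 by auto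
    have "\<exists>v. lex_maximal (mass_supp (m l i)) v" if "i \<in> {1..N}" for i
      using partial_masses_supp[OF pm l that] 3 by (intro lex_maximal_exists) auto
    then obtain q where q: "\<forall>i\<in>{1..N}. lex_maximal (mass_supp (m l i)) (q i)" by metis
    from step3_extract[where d = d and m = m and l = l, OF 3 q refl refl refl refl refl]
    show ?thesis unfolding Step3 ..
  qed
qed (use assms in auto)

text \<open>The minimal mass is attained, so one point of the tuple disappears while none appears.
  The masses are compared at level l only, so that the moves of the second step, which also add mass
  at level j, are covered.\<close>

lemma card_supp_decreases:
  assumes pm: "partial_masses d m" and l: "l \<in> {1..r}"
    and q: "\<And>i. i \<in> {1..N} \<Longrightarrow> 0 < m l i (q i)"
    and m': "\<And>i x. m' l i x = add_mass N l q (- d_min N m l q) m l i x"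
  shows "(\<Sum>i\<in>{1..N}. card (mass_supp (m' l i))) < (\<Sum>i\<in>{1..N}. card (mass_supp (m l i)))"
proof (rule sum_strict_mono_ex1)
  have e: "0 < d_min N m l q" using q by (rule d_min_pos)
  have sub: "mass_supp (m' l i) \<subseteq> mass_supp (m l i)" for i
    using e by (auto simp: mass_supp_def m' add_mass_apply split: if_splits)
  show "\<forall>i\<in>{1..N}. card (mass_supp (m' l i)) \<le> card (mass_supp (m l i))"
    using partial_masses_supp(2)[OF pm l] sub by (intro ballI card_mono)
  obtain i where i: "i \<in> {1..N}" "d_min N m l q = m l i (q i)" using d_min_attained[of m l q] by blast
  then have "q i \<notin> mass_supp (m' l i)" "q i \<in> mass_supp (m l i)"
    using q by (auto simp: mass_supp_def m' add_mass_apply)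
  then have "mass_supp (m' l i) \<subset> mass_supp (m l i)" using sub by blast
  then show "\<exists>i\<in>{1..N}. card (mass_supp (m' l i)) < card (mass_supp (m l i))"
    using i partial_masses_supp(2)[OF pm l] by (blast intro: psubset_card_mono)
qed simp

lemma alg2_measure_decreases:
  assumes "alg2_step N lam s r a a'" "alg2_inv a"
  shows "(alg2_measure N r a', alg2_measure N r a) \<in> lex4"
  using assms
proof (induction rule: alg2_step.induct)
  case (step2_move l j d m q c e d' m')
  then have l: "l \<in> {1..r}" and pm: "partial_masses d m" by (auto simp: step2_good_def)
  have "0 < m l i (q i)" if "i \<in> {1..N}" for i
    using step2_move that by (auto intro: arg_max_mass)
  moreover have "m' l i x = add_mass N l q (- d_min N m l q) m l i x" for i x
    using step2_move by (simp add: add_mass_apply)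
  ultimately have "(\<Sum>i\<in>{1..N}. card (mass_supp (m' l i))) < (\<Sum>i\<in>{1..N}. card (mass_supp (m l i)))"
    by (rule card_supp_decreases[OF pm l])
  then show ?case by (simp add: lex4_def)
next
  case (step3_extract l d m q c e d' m' b' b)
  then have l: "l \<in> {1..r}" and pm: "partial_masses d m" by auto
  have "0 < m l i (q i)" if "i \<in> {1..N}" for i
    using step3_extract that by (auto simp: lex_maximal_def mass_supp_def)
  moreover have "m' l i x = add_mass N l q (- d_min N m l q) m l i x" for i x
    using step3_extract by simp
  ultimately have "(\<Sum>i\<in>{1..N}. card (mass_supp (m' l i))) < (\<Sum>i\<in>{1..N}. card (mass_supp (m l i)))"
    by (rule card_supp_decreases[OF pm l])
  then show ?case by (simp add: lex4_def)
qed (auto simp: lex4_def)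

end

section \<open>The value of the linear program\<close>

context weighted_measures
begin

text \<open>As an infimum it depends on S alone and not on the optimal vertex that happens to be
  chosen.\<close>

definition lp_value :: "'a set \<Rightarrow> real" where
  "lp_value S = (INF y\<in>{y. \<exists>z. feasible S z y}. cost S y)"

lemma lp_value_le: "feasible S z y \<Longrightarrow> lp_value S \<le> cost S y"
  unfolding lp_value_def by (rule cINF_lower) (auto intro!: bdd_belowI[of _ 0] dest: cost_nonneg)

lemma lp_value_eq:
  assumes "alg1_output N lam P S z y"
  shows "lp_value S = cost S y"
  unfolding lp_value_def using assms
  by (intro cInf_eq_minimum) (auto simp: alg1_output_def lp_vertex_def)

text \<open>Near-optimal couplings give feasible costs arbitrarily close to \<open>phi\<close>, and
  the left-hand side does not depend on \<epsilon>.\<close>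

lemma lp_value_le_phi:
  assumes "finite S" "set_pmf Q \<subseteq> S"
  shows "lp_value S \<le> phi N lam P (borel_pmf Q)"
proof (rule field_le_epsilon)
  fix \<epsilon> :: real assume "0 < \<epsilon>"
  from feasible_near_phi[OF assms this] show "lp_value S \<le> phi N lam P (borel_pmf Q) + \<epsilon>"
    using lp_value_le by (meson order_trans)
qed

lemma lp_value_le_two_phi:
  assumes "finite_second_moment M"
  shows "lp_value (\<Union>i\<in>{1..N}. set_pmf (P i)) \<le> 2 * phi N lam P M"
proof (rule field_le_epsilon)
  fix \<epsilon> :: real assume "0 < \<epsilon>"
  \<comment> \<open>Halved because the estimate doubles the error together with
    \<open>phi\<close>.\<close>
  then have "0 < \<epsilon> / 2" by simp
  from feasible_two_phi[OF assms this] obtain z y where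
    "feasible (\<Union>i\<in>{1..N}. set_pmf (P i)) z y"
    "cost (\<Union>i\<in>{1..N}. set_pmf (P i)) y \<le> 2 * (phi N lam P M + \<epsilon> / 2)" by blast
  then show "lp_value (\<Union>i\<in>{1..N}. set_pmf (P i)) \<le> 2 * phi N lam P M + \<epsilon>"
    using lp_value_le by fastforce
qed

lemma feasible_imp_is_transport:
  "feasible (set_pmf Q) (pmf Q) y \<Longrightarrow> is_transport N P Q y"
  by (simp add: lp_feasible_def is_transport_def)

text \<open>Setting a transport to zero off the supports changes neither its constraints nor its
  cost, but makes it a feasible solution.\<close>

lemma lp_value_le_transport:
  assumes "finite (set_pmf Q)" "is_transport N P Q y"
  shows "lp_value (set_pmf Q) \<le> cost (set_pmf Q) y"
proof -
  define y' where
    "y' = (\<lambda>i x k. if i \<in> {1..N} \<and> x \<in> set_pmf Q \<and> k \<in> set_pmf (P i) then y i x k else 0)"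
  have "feasible (set_pmf Q) (pmf Q) y'"
    unfolding lp_feasible_def
  proof (intro conjI ballI allI impI)
    show "(\<Sum>k\<in>set_pmf (P i). y' i x k) = pmf Q x" if "i \<in> {1..N}" "x \<in> set_pmf Q" for i x
      using assms(2) that by (simp add: y'_def is_transport_def)
    show "(\<Sum>x\<in>set_pmf Q. y' i x k) = pmf (P i) k" if "i \<in> {1..N}" "k \<in> set_pmf (P i)" for i k
      using assms(2) that by (simp add: y'_def is_transport_def)
    show "0 \<le> y' i x k" for i x k
      using assms(2) by (simp add: y'_def is_transport_def)
    show "pmf Q x = 0" if "x \<notin> set_pmf Q" for x using that by (simp add: set_pmf_iff)
    show "y' i x k = 0" if "\<not> (i \<in> {1..N} \<and> x \<in> set_pmf Q \<and> k \<in> set_pmf (P i))" for i x k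
      unfolding y'_def using that by (rule if_not_P)
  qed
  then have "lp_value (set_pmf Q) \<le> cost (set_pmf Q) y'" by (rule lp_value_le)
  also have "\<dots> = cost (set_pmf Q) y"
    unfolding transport_cost_def by (simp add: y'_def)
  finally show ?thesis .
qed

lemma lp_value_antimono:
  assumes "A \<subseteq> B" "finite B" "A \<noteq> {}"
  shows "lp_value B \<le> lp_value A"
proof -
  have "finite A" using assms finite_subset by blast
  from alg1_output_exists[OF this \<open>A \<noteq> {}\<close>] obtain z y where zy: "alg1_output N lam P A z y" by blast
  then have f: "feasible A z y" by (simp add: alg1_output_def lp_vertex_def)
  show ?thesis
    using lp_value_le[OF feasible_mono(1)[OF f assms(1,2)]] feasible_mono(2)[OF f assms(1,2)]
      lp_value_eq[OF zy] by simp
qed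

lemma feasible_pmf:
  assumes f: "feasible S w y" and S: "finite S"
  obtains Q where "pmf Q = w" "set_pmf Q = mass_supp w"
proof
  have nn: "0 \<le> w x" for x using f by (rule feasible_mass_nonneg)
  have w0: "w x = 0" if "x \<notin> S" for x using f that by (simp add: lp_feasible_def)
  have "(\<integral>\<^sup>+x. ennreal (w x) \<partial>count_space UNIV) = (\<Sum>x\<in>S. ennreal (w x))"
    using S w0 by (intro nn_integral_count_space') auto
  also have "\<dots> = 1" using feasible_total_mass[OF f] nn by (simp add: sum_ennreal)
  finally have "(\<integral>\<^sup>+x. ennreal (w x) \<partial>count_space UNIV) = 1" .
  from pmf_embed_pmf[OF nn this] show "pmf (embed_pmf w) = w" by (simp add: fun_eq_iff)
  then show "set_pmf (embed_pmf w) = mass_supp w"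
    using nn by (auto simp: set_pmf_eq mass_supp_def less_le)
qed

end


section \<open>The iterated algorithm\<close>

context lex_measures
begin

abbreviation initial_set where "initial_set \<equiv> \<Union>i\<in>{1..N}. set_pmf (P i)"

text \<open>The initial set is added separately, as it need not consist of weighted means; the empty
  set is excluded because its program is infeasible.\<close>

definition candidate_sets where
  "candidate_sets = insert initial_set (Pow (weighted_means N lam P)) - {{}}"

text \<open>Counting the candidates of smaller value turns a strict decrease of real numbers into
  one of natural numbers.\<close>

definition better_sets where
  "better_sets S = {T \<in> candidate_sets. lp_value T < lp_value S}"

text \<open>The factor 2 is proved for the initial set only; the bound on the value carries it to
  every later iteration.\<close>

definition admissible where
  "admissible S \<longleftrightarrow> S \<in> candidate_sets \<and> lp_value S \<le> lp_value initial_set"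

text \<open>A running local improvement stores the masses but not the transport it started from, so
  \<open>y\<close> is recovered existentially.\<close>

fun alg3_inv where
  "alg3_inv (RunAlg1 S) \<longleftrightarrow> admissible S"
| "alg3_inv (RunAlg2 S z s r a) \<longleftrightarrow> admissible S \<and> (\<exists>y. alg1_output N lam P S z y \<and>
     bij_betw s {1..r} (mass_supp z) \<and> alg2_input.alg2_inv P lam N S z y s r a)"
| "alg3_inv (Return S w) \<longleftrightarrow> admissible S \<and> (\<exists>y. alg1_output N lam P S w y \<and>
     alg2_input.alg2_result P lam N S w y w)"

text \<open>Within one iteration, the entry 4 ranks above and 0 below the phases 3, 2, 1 of the
  local improvement.\<close>

fun alg3_measure where
  "alg3_measure (RunAlg1 S) = (card (better_sets S), 4, 0, 0, 0)"
| "alg3_measure (RunAlg2 S z s r a) = (card (better_sets S), alg2_measure N r a)"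
| "alg3_measure (Return S w) = (card (better_sets S), 0, 0, 0, 0)"

lemma finite_candidate_sets: "finite candidate_sets"
  using finite_weighted_means by (simp add: candidate_sets_def)

lemma admissible_finite: "admissible S \<Longrightarrow> finite S \<and> S \<noteq> {}"
  using finite_weighted_means finite_supp finite_subset
  by (auto simp: admissible_def candidate_sets_def)

lemma alg1_output_alg2_input:
  assumes "alg1_output N lam P S z y" "bij_betw s {1..r::nat} (mass_supp z)" "finite S"
  shows "alg2_input P lam N S z y s r"
  using assms by unfold_locales (auto simp: alg1_output_def lp_vertex_def)

lemma alg3_init_inv: "alg3_inv (alg3_init N P)"
  using N_pos set_pmf_not_empty by (force simp: alg3_init_def admissible_def candidate_sets_def)

text \<open>A changed measure excludes the stationary alternative, so a strictly cheaper transport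
  exists over the new support.\<close>

lemma alg2_result_improves:
  assumes S: "admissible S" and zy: "alg1_output N lam P S z y"
    and w: "alg2_input.alg2_result P lam N S z y w" and s: "bij_betw s {1..r::nat} (mass_supp z)"
    and "w \<noteq> z"
  shows "admissible (mass_supp w)" "lp_value (mass_supp w) < lp_value S"
proof -
  interpret alg2_input P lam N S z y s r
    using alg1_output_alg2_input[OF zy s] admissible_finite[OF S] by blast
  from w \<open>w \<noteq> z\<close> obtain Y where sub: "mass_supp w \<subseteq> weighted_means N lam P"
    and Y: "feasible (mass_supp w) w Y" "cost (mass_supp w) Y < cost S y"
    by (auto simp: alg2_result_def)
  have "mass_supp w \<noteq> {}" using feasible_total_mass[OF Y(1)] by auto
  then have "mass_supp w \<in> candidate_sets" using sub by (simp add: candidate_sets_def)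
  moreover show less: "lp_value (mass_supp w) < lp_value S"
    using lp_value_le[OF Y(1)] Y(2) lp_value_eq[OF zy] by simp
  ultimately show "admissible (mass_supp w)" using S by (simp add: admissible_def)
qed

lemma alg3_inv_step:
  assumes "alg3_step N lam P a a'" "alg3_inv a"
  shows "alg3_inv a'"
  using assms
proof (induction rule: alg3_step.induct)
  case (alg3_solve S z y s r)
  then have "alg2_input P lam N S z y s r"
    using alg1_output_alg2_input admissible_finite by simp
  from alg2_input.alg2_init_inv[OF this] show ?case using alg3_solve by auto
next
  case (alg3_alg2 s r a a' S z)
  then obtain y where y: "admissible S" "alg1_output N lam P S z y" "bij_betw s {1..r} (mass_supp z)"
    "alg2_input.alg2_inv P lam N S z y s r a" by auto
  then have "alg2_input P lam N S z y s r"
    using alg1_output_alg2_input admissible_finite by simp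
  from alg2_input.alg2_inv_step[OF this alg3_alg2.hyps y(4)] show ?case using y by auto
next
  case (alg3_repeat w z S s r)
  then obtain y where y: "admissible S" "alg1_output N lam P S z y" "bij_betw s {1..r} (mass_supp z)"
    "alg2_input.alg2_inv P lam N S z y s r (Step4 w)" by auto
  then interpret alg2_input P lam N S z y s r
    using alg1_output_alg2_input admissible_finite by simp
  show ?case using alg2_result_improves(1)[OF y(1,2) _ y(3)] y(4) alg3_repeat.hyps by simp
next
  case (alg3_return w z S s r)
  then obtain y where y: "admissible S" "alg1_output N lam P S z y" "bij_betw s {1..r} (mass_supp z)"
    "alg2_input.alg2_inv P lam N S z y s r (Step4 w)" by auto
  then interpret alg2_input P lam N S z y s r
    using alg1_output_alg2_input admissible_finite by simp
  show ?case using y alg3_return.hyps by auto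
qed

lemma alg3_reachable_inv:
  "(alg3_step N lam P)\<^sup>*\<^sup>* (alg3_init N P) a \<Longrightarrow> alg3_inv a"
  by (induction rule: rtranclp_induct) (auto simp: alg3_init_inv intro: alg3_inv_step)

lemma alg3_measure_decreases:
  assumes "alg3_step N lam P a a'" "alg3_inv a"
  shows "(alg3_measure a', alg3_measure a) \<in> less_than <*lex*> lex4"
  using assms
proof (induction rule: alg3_step.induct)
  case (alg3_solve S z y s r)
  then show ?case by (simp add: alg2_init_def lex4_def)
next
  case (alg3_alg2 s r a a' S z)
  then obtain y where y: "admissible S" "alg1_output N lam P S z y" "bij_betw s {1..r} (mass_supp z)"
    "alg2_input.alg2_inv P lam N S z y s r a" by auto
  then have "alg2_input P lam N S z y s r"
    using alg1_output_alg2_input admissible_finite by simp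
  from alg2_input.alg2_measure_decreases[OF this alg3_alg2.hyps y(4)] show ?case by simp
next
  case (alg3_repeat w z S s r)
  then obtain y where y: "admissible S" "alg1_output N lam P S z y" "bij_betw s {1..r} (mass_supp z)"
    "alg2_input.alg2_inv P lam N S z y s r (Step4 w)" by auto
  then interpret alg2_input P lam N S z y s r
    using alg1_output_alg2_input admissible_finite by simp
  have "admissible (mass_supp w)" and less: "lp_value (mass_supp w) < lp_value S"
    using alg2_result_improves[OF y(1,2) _ y(3)] y(4) alg3_repeat.hyps by simp_all
  \<comment> \<open>The new set is better than S but not better than itself, which makes the
    inclusion below strict.\<close>
  then have "mass_supp w \<in> better_sets S - better_sets (mass_supp w)"
    by (simp add: better_sets_def admissible_def)
  moreover have "better_sets (mass_supp w) \<subseteq> better_sets S"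
    using less by (auto simp: better_sets_def)
  moreover have "finite (better_sets S)" using finite_candidate_sets by (simp add: better_sets_def)
  ultimately have "card (better_sets (mass_supp w)) < card (better_sets S)"
    by (intro psubset_card_mono) auto
  then show ?case by simp
next
  case (alg3_return w z S s r)
  then show ?case by (simp add: lex4_def)
qed

lemma alg3_terminates:
  "\<nexists>run. run 0 = alg3_init N P \<and> (\<forall>n::nat. alg3_step N lam P (run n) (run (Suc n)))"
proof
  assume "\<exists>run. run 0 = alg3_init N P \<and> (\<forall>n::nat. alg3_step N lam P (run n) (run (Suc n)))"
  then obtain run where run: "run 0 = alg3_init N P" "\<And>n::nat. alg3_step N lam P (run n) (run (Suc n))"
    by blast
  have "alg3_inv (run n)" for n
    by (induction n) (auto simp: run alg3_init_inv intro: alg3_inv_step[OF run(2)])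
  then have "\<forall>n. (alg3_measure (run (Suc n)), alg3_measure (run n)) \<in> less_than <*lex*> lex4"
    using alg3_measure_decreases run(2) by blast
  then have "\<exists>f. \<forall>n::nat. (f (Suc n), f n) \<in> less_than <*lex*> lex4"
    by (intro exI[of _ "\<lambda>n. alg3_measure (run n)"])
  moreover have "wf (less_than <*lex*> lex4)" unfolding lex4_def by (intro wf_lex_prod wf_less_than)
  ultimately show False unfolding wf_iff_no_infinite_down_chain by blast
qed

lemma alg3_progress:
  assumes "alg3_inv a"
  shows "(\<exists>S w. a = Return S w) \<or> (\<exists>a'. alg3_step N lam P a a')"
proof (cases a)
  case (RunAlg1 S)
  then have S: "finite S" "S \<noteq> {}" using assms admissible_finite by auto
  obtain z y where zy: "alg1_output N lam P S z y" using alg1_output_exists[OF S] by blast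
  then have "mass_supp z \<subseteq> S" by (intro feasible_mass_supp[of _ _ y]) (simp add: alg1_output_def lp_vertex_def)
  then have "finite (mass_supp z)" using S finite_subset by blast
  then obtain s :: "nat \<Rightarrow> _" where "bij_betw s {1..card (mass_supp z)} (mass_supp z)"
    using ex_bij_betw_nat_finite_1 by blast
  with zy show ?thesis using RunAlg1 alg3_solve by blast
next
  case (RunAlg2 S z s r b)
  then obtain y where y: "admissible S" "alg1_output N lam P S z y" "bij_betw s {1..r} (mass_supp z)"
    "alg2_input.alg2_inv P lam N S z y s r b" using assms by auto
  then have input: "alg2_input P lam N S z y s r"
    using alg1_output_alg2_input admissible_finite by simp
  show ?thesis
  proof (cases "\<exists>w. b = Step4 w")
    case True
    then obtain w where "b = Step4 w" ..
    then show ?thesis using RunAlg2 alg3_repeat[of w z] alg3_return[of w z] by (cases "w = z") blast+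
  next
    case False
    then obtain b' where "alg2_step N lam s r b b'"
      using alg2_input.alg2_progress[OF input y(4)] by blast
    then show ?thesis using RunAlg2 alg3_alg2 by blast
  qed
qed auto

text \<open>The returned masses are both an optimal vertex and an output of the local improvement:
  the first property gives sparsity and optimality over S, the second the weighted means and the
  unsplit transport.\<close>

lemma alg3_return_correct:
  assumes "alg3_inv (Return S w)"
  shows "\<exists>P'. w = pmf P' \<and> finite (set_pmf P') \<and>
    approximate_barycenter N lam P S P' \<and>
    set_pmf P' \<subseteq> weighted_means N lam P \<and>
    (\<forall>Pbar. barycenter N lam P Pbar \<longrightarrow>
       phi N lam P (borel_pmf P') \<le> 2 * phi N lam P Pbar) \<and>
    (\<exists>y. optimal_transport N lam P P' y \<and> non_mass_splitting N P P' y \<and>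
       transport_cost N lam P (set_pmf P') y = phi N lam P (borel_pmf P') \<and>
       (\<forall>Pbar. barycenter N lam P Pbar \<longrightarrow>
          transport_cost N lam P (set_pmf P') y \<le> 2 * phi N lam P Pbar)) \<and>
    int (card (set_pmf P')) \<le> (\<Sum>i\<in>{1..N}. int (card (set_pmf (P i)))) - int N + 1"
proof -
  from assms obtain y where S: "admissible S" and zy: "alg1_output N lam P S w y"
    and res: "alg2_input.alg2_result P lam N S w y w" by auto
  have finS: "finite S" using admissible_finite[OF S] by simp
  have vert: "lp_vertex N P S w y" using zy unfolding alg1_output_def by blast
  then have feas: "feasible S w y" unfolding lp_vertex_def by blast
  have sub: "mass_supp w \<subseteq> S" by (rule feasible_mass_supp[OF feas])
  have finw: "finite (mass_supp w)" using sub finS finite_subset by blast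
  obtain s :: "nat \<Rightarrow> _" where "bij_betw s {1..card (mass_supp w)} (mass_supp w)"
    using ex_bij_betw_nat_finite_1[OF finw] by blast
  from alg1_output_alg2_input[OF zy this finS]
  interpret alg2_input P lam N S w y s "card (mass_supp w)" .
  from res obtain Y where means: "mass_supp w \<subseteq> weighted_means N lam P"
    and Y: "feasible (mass_supp w) w Y"
    and alt: "cost (mass_supp w) Y < cost S y \<or> w = w \<and> cost (mass_supp w) Y = cost S y \<and>
      (\<exists>k. \<forall>i\<in>{1..N}. \<forall>c\<in>mass_supp w. k i c \<in> set_pmf (P i) \<and>
         (\<forall>x\<in>set_pmf (P i). Y i c x = (if x = k i c then w c else 0)))"
    unfolding alg2_result_def by blast
  \<comment> \<open>The new transport is feasible over S as well, so it cannot beat the optimum;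
    only the stationary alternative survives.\<close>
  have "cost S y \<le> cost (mass_supp w) Y"
    using lp_value_le[OF feasible_mono(1)[OF Y sub finS]] feasible_mono(2)[OF Y sub finS]
      lp_value_eq[OF zy] by simp
  then have "\<not> cost (mass_supp w) Y < cost S y" by simp
  with alt have "cost (mass_supp w) Y = cost S y" and
    "\<exists>k. \<forall>i\<in>{1..N}. \<forall>c\<in>mass_supp w. k i c \<in> set_pmf (P i) \<and>
         (\<forall>x\<in>set_pmf (P i). Y i c x = (if x = k i c then w c else 0))" by blast+
  then obtain k where k: "\<And>i c. i \<in> {1..N} \<Longrightarrow> c \<in> mass_supp w \<Longrightarrow> k i c \<in> set_pmf (P i) \<and>
      (\<forall>x\<in>set_pmf (P i). Y i c x = (if x = k i c then w c else 0))"
    and cost: "cost (mass_supp w) Y = lp_value S" using lp_value_eq[OF zy] by metis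
  obtain P' where P': "pmf P' = w" "set_pmf P' = mass_supp w"
    using feasible_pmf[OF feas finS] by blast
  have fin: "finite (set_pmf P')" using finw P' by simp
  have trans: "is_transport N P P' Y"
    using Y by (intro feasible_imp_is_transport) (simp add: P')
  have costP: "cost (set_pmf P') Y = lp_value S" using cost by (simp add: P')
  \<comment> \<open>\<open>phi\<close> is squeezed: the transport bounds it by the value of the
    program from above, near-optimal couplings from below.\<close>
  have phi: "phi N lam P (borel_pmf P') = lp_value S"
    using phi_le_transport_cost[OF fin trans] lp_value_le_phi[of S P'] finS sub costP by (simp add: P')
  have two: "lp_value S \<le> 2 * phi N lam P Pbar" if "barycenter N lam P Pbar" for Pbar
    using S lp_value_le_two_phi[of Pbar] that by (simp add: admissible_def barycenter_def)
  have "approximate_barycenter N lam P S P'"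
    using sub finS lp_value_le_phi[OF finS] by (auto simp: approximate_barycenter_def phi P')
  moreover have "optimal_transport N lam P P' Y"
  proof -
    \<comment> \<open>Transports from \<open>P'\<close> itself are feasible over the smaller set,
      whose optimal value cannot lie below that of S.\<close>
    have "lp_value S \<le> lp_value (set_pmf P')"
      using sub finS set_pmf_not_empty[of P'] by (intro lp_value_antimono) (simp_all add: P')
    then show ?thesis
      using trans lp_value_le_transport[OF fin] costP unfolding optimal_transport_def
      by (auto intro: order_trans)
  qed
  moreover have "non_mass_splitting N P P' Y"
    unfolding non_mass_splitting_def
  proof (intro ballI)
    fix x i assume x: "x \<in> set_pmf P'" and i: "i \<in> {1..N}"
    \<comment> \<open>Positivity gives uniqueness: all other targets receive 0, which is not the
      mass of x.\<close>
    have "0 < pmf P' x" using x by (simp add: pmf_positive)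
    then show "\<exists>!k. k \<in> set_pmf (P i) \<and> Y i x k = pmf P' x \<and>
        (\<forall>k'\<in>set_pmf (P i). k' \<noteq> k \<longrightarrow> Y i x k' = 0)"
      using k[OF i, of x] x by (intro ex1I[of _ "k i x"]) (auto simp: P' split: if_splits)
  qed
  moreover have "int (card (set_pmf P')) \<le> (\<Sum>i\<in>{1..N}. int (card (set_pmf (P i)))) - int N + 1"
    using vertex_sparse[OF vert finS] by (simp add: P')
  ultimately show ?thesis
    using P' fin means two by (intro exI[of _ P'] conjI exI[of _ Y] allI impI) (simp_all add: phi cost)
qed

end

text \<open>Because the algorithm is nondeterministic, its returning a result is expressed by the
  absence of infinite runs together with the absence of stuck states, and correctness is claimed for
  every reachable result.\<close>

theorem theorem5:
  fixes P :: "nat \<Rightarrow> (real ^ 'd::{finite,linorder}) pmf"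
    and lam :: "nat \<Rightarrow> real" and N :: nat
  assumes "\<And>i. i \<in> {1..N} \<Longrightarrow> finite (set_pmf (P i))"
    and "\<And>i. i \<in> {1..N} \<Longrightarrow> 0 < lam i"
    and "(\<Sum>i\<in>{1..N}. lam i) = 1"
  shows
    "(\<nexists>run. run 0 = alg3_init N P \<and> (\<forall>n::nat. alg3_step N lam P (run n) (run (Suc n)))) \<and>
     (\<forall>a. (alg3_step N lam P)\<^sup>*\<^sup>* (alg3_init N P) a \<longrightarrow>
        (\<exists>S w. a = Return S w) \<or> (\<exists>a'. alg3_step N lam P a a')) \<and>
     (\<forall>S w. (alg3_step N lam P)\<^sup>*\<^sup>* (alg3_init N P) (Return S w) \<longrightarrow>
        (\<exists>P'. w = pmf P' \<and> finite (set_pmf P') \<and>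
           approximate_barycenter N lam P S P' \<and>
           set_pmf P' \<subseteq> weighted_means N lam P \<and>
           (\<forall>Pbar. barycenter N lam P Pbar \<longrightarrow>
              phi N lam P (borel_pmf P') \<le> 2 * phi N lam P Pbar) \<and>
           (\<exists>y. optimal_transport N lam P P' y \<and> non_mass_splitting N P P' y \<and>
              transport_cost N lam P (set_pmf P') y = phi N lam P (borel_pmf P') \<and>
              (\<forall>Pbar. barycenter N lam P Pbar \<longrightarrow>
                 transport_cost N lam P (set_pmf P') y \<le> 2 * phi N lam P Pbar)) \<and>
           int (card (set_pmf P')) \<le> (\<Sum>i\<in>{1..N}. int (card (set_pmf (P i)))) - int N + 1))"
proof -
  interpret lex_measures P lam N by unfold_locales (fact assms)+
  show ?thesis
    using alg3_terminates alg3_progress[OF alg3_reachable_inv]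
      alg3_return_correct[OF alg3_reachable_inv] by blast
qed

end
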